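(* Let $k$ be any field of characteristic not equal to $2$, and let $\mathrm{AGL}_1=\left\{\begin{pmatrix} x & y\\ 0 & 1\end{pmatrix} : x\neq 0\right\}$ be the algebraic group over $k$ of affine transformations of the line. For an integer $r>0$ let $N_r$ be the connected sum of $r$ projective planes, and write $q=[\mathbb{A}^1_k]\in \mathrm{K}_0(\mathrm{Var}_k)$. Then for any $r>0$: (i) the virtual class in $\mathrm{K}_0(\mathrm{Var}_k)$ of the $\mathrm{AGL}_1$-representation variety of $N_r$ is $$[R_{\mathrm{AGL}_1}(N_r)] = 2 q^{r-1}(q-1)^{r-1} + q^{r-1}(q-1);$$ (ii) the virtual class in $\mathrm{K}_0(\mathrm{Var}_k)$ of the $\mathrm{AGL}_1$-character variety of $N_r$ is $$[X_{\mathrm{AGL}_1}(N_r)] = 2(q-1)^{r-1}.$$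
   Context: The Grothendieck ring of varieties $\mathrm{K}_0(\mathrm{Var}_k)$ is the quotient of the free abelian group on isomorphism classes of varieties over $k$ by the relations $[X]=[Z]+[X\setminus Z]$ for every closed subvariety $Z\subset X$, with multiplication $[X]\cdot[Y]=[X\times_k Y]$ and unit $[\mathrm{Spec}\,k]$. The virtual class of a variety is its image in this ring. For an algebraic group $G$ over $k$, the $G$-representation variety of a closed connected manifold $M$ is $R_G(M)=\mathrm{Hom}(\pi_1(M),G)$, regarded as a closed subvariety of $G^n$ via the images of $n$ generators of $\pi_1(M)$. Since $\pi_1(N_r)=\langle a_1,\dots,a_r \mid a_1^2\cdots a_r^2=1\rangle$, one has $$R_G(N_r)=\{(A_1,\dots,A_r)\in G^r : A_1^2\cdots A_r^2=1\}.$$ The group $G$ acts on $R_G(M)$ by (simultaneous) conjugation, and the $G$-character variety is the GIT quotient $X_G(M)=R_G(M)/\!/G$ (the spectrum of the ring of $G$-invariant regular functions on $R_G(M)$). *)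

theory Defs
  imports
    "HOL-Analysis.Analysis"
    "HOL-Algebra.Algebraic_Closure_Type"
    "HOL-Library.Poly_Mapping"
begin
(* otherwise X cannot be used as a variable *)
no_notation Polynomials.var ("X\<index>")

section \<open>Varieties over an arbitrary field\<close>

text \<open>
  A variety over \<open>k\<close> is a reduced separated scheme of finite type over \<open>k\<close>, not necessarily
  irreducible. We use the classical (Serre, Weil) description of these objects. Let \<open>K\<close> be an algebraic
  closure of \<open>k\<close>. The points of \<open>X\<close> are its \<open>K\<close>-points, the topology is the \<open>k\<close>-Zariski topology (so
  conjugate points over \<open>k\<close> are not separated by open sets), and the structure sheaf consists of \<open>K\<close>-valued
  functions which are regular over \<open>k\<close>. As a reduced finitely generated \<open>k\<close>-algebra \<open>A\<close> embeds into the
  functions on the set of \<open>k\<close>-algebra homomorphisms from \<open>A\<close> to \<open>K\<close>, this is an equivalence of categories.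
  Products are reduced fibre products over \<open>k\<close>, and closed subvarieties carry the reduced structure.

  An element of \<open>sections X U\<close> is a function on the whole point type of which only the values on \<open>U\<close>
  matter; \<open>sections X U\<close> is meaningful for open \<open>U\<close> only.
\<close>

record (overloaded) ('k::field, 'a) fspace =
  topol :: "'a topology"
  sections :: "'a set \<Rightarrow> ('a \<Rightarrow> 'k alg_closure) set"

abbreviation pts :: "('k::field, 'a) fspace \<Rightarrow> 'a set" where
  "pts X \<equiv> topspace (topol X)"

locale function_space =
  fixes X :: "('k::field, 'a) fspace"
  assumes sections_cong:
      "\<And>U f g. openin (topol X) U \<Longrightarrow> f \<in> sections X U \<Longrightarrow> (\<And>x. x \<in> U \<Longrightarrow> g x = f x) \<Longrightarrow> g \<in> sections X U"
    and sections_restrict: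
      "\<And>U V f. openin (topol X) U \<Longrightarrow> openin (topol X) V \<Longrightarrow> V \<subseteq> U \<Longrightarrow> f \<in> sections X U \<Longrightarrow> f \<in> sections X V"
    and sections_glue:
      "\<And>U f. openin (topol X) U \<Longrightarrow>
        (\<And>x. x \<in> U \<Longrightarrow> \<exists>V. openin (topol X) V \<and> x \<in> V \<and> V \<subseteq> U \<and> f \<in> sections X V) \<Longrightarrow> f \<in> sections X U"
    and sections_const: "\<And>U c. openin (topol X) U \<Longrightarrow> (\<lambda>_. to_ac c) \<in> sections X U"
    and sections_add:
      "\<And>U f g. openin (topol X) U \<Longrightarrow> f \<in> sections X U \<Longrightarrow> g \<in> sections X U \<Longrightarrow> (\<lambda>x. f x + g x) \<in> sections X U"
    and sections_mult:
      "\<And>U f g. openin (topol X) U \<Longrightarrow> f \<in> sections X U \<Longrightarrow> g \<in> sections X U \<Longrightarrow> (\<lambda>x. f x * g x) \<in> sections X U"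
    and openin_nonzero:
      "\<And>U f. openin (topol X) U \<Longrightarrow> f \<in> sections X U \<Longrightarrow> openin (topol X) {x \<in> U. f x \<noteq> 0}"
    and sections_inverse:
      "\<And>U f. openin (topol X) U \<Longrightarrow> f \<in> sections X U \<Longrightarrow> (\<lambda>x. inverse (f x)) \<in> sections X {x \<in> U. f x \<noteq> 0}"

definition regular_map :: "('k::field, 'a) fspace \<Rightarrow> ('k, 'b) fspace \<Rightarrow> ('a \<Rightarrow> 'b) \<Rightarrow> bool" where
  "regular_map X Y \<phi> \<longleftrightarrow> continuous_map (topol X) (topol Y) \<phi> \<and>
     (\<forall>V g. openin (topol Y) V \<longrightarrow> g \<in> sections Y V \<longrightarrow>
        (\<lambda>x. g (\<phi> x)) \<in> sections X {x \<in> pts X. \<phi> x \<in> V})"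

definition isomorphic :: "('k::field, 'a) fspace \<Rightarrow> ('k, 'b) fspace \<Rightarrow> bool" (infix "\<cong>\<^sub>v" 50) where
  "X \<cong>\<^sub>v Y \<longleftrightarrow> (\<exists>\<phi> \<psi>. regular_map X Y \<phi> \<and> regular_map Y X \<psi> \<and>
     (\<forall>x \<in> pts X. \<psi> (\<phi> x) = x) \<and> (\<forall>y \<in> pts Y. \<phi> (\<psi> y) = y))"

text \<open>The structure induced on a subset; the intended use is for locally closed subsets.\<close>

definition induced :: "('k::field, 'a) fspace \<Rightarrow> 'a set \<Rightarrow> ('k, 'a) fspace" where
  "induced X S = \<lparr>
     topol = subtopology (topol X) S,
     sections = (\<lambda>U. {f. \<forall>x \<in> U. \<exists>V g. openin (topol X) V \<and> x \<in> V \<and> g \<in> sections X V \<and>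
                          (\<forall>y \<in> U \<inter> V. f y = g y)})\<rparr>"

text \<open>
  The common pattern of affine spaces and of products: given pairs of a set \<open>D\<close> and a ring \<open>A\<close> of functions
  on \<open>D\<close>, the non-vanishing loci of the elements of the rings form a base of the topology, and sections
  are the functions that are locally fractions of elements of the rings.
\<close>

definition fraction_space :: "('a set \<times> ('a \<Rightarrow> 'k::field alg_closure) set) set \<Rightarrow> ('k, 'a) fspace" where
  "fraction_space \<A> = \<lparr>
     topol = topology_generated_by {{x \<in> D. h x \<noteq> 0} | D A h. (D, A) \<in> \<A> \<and> h \<in> A},
     sections = (\<lambda>U. {f. \<forall>x \<in> U. \<exists>D A g h. (D, A) \<in> \<A> \<and> g \<in> A \<and> h \<in> A \<and> x \<in> D \<and> h x \<noteq> 0 \<and>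
                          (\<forall>y \<in> U \<inter> D. h y \<noteq> 0 \<longrightarrow> f y = g y / h y)})\<rparr>"

text \<open>Polynomial functions over \<open>k\<close> in a family \<open>C\<close> of coordinate functions.\<close>

inductive_set polynomials :: "('a \<Rightarrow> 'k::field alg_closure) set \<Rightarrow> ('a \<Rightarrow> 'k alg_closure) set"
  for C where
  const: "(\<lambda>_. to_ac c) \<in> polynomials C"
| coord: "f \<in> C \<Longrightarrow> f \<in> polynomials C"
| add: "f \<in> polynomials C \<Longrightarrow> g \<in> polynomials C \<Longrightarrow> (\<lambda>x. f x + g x) \<in> polynomials C"
| mult: "f \<in> polynomials C \<Longrightarrow> g \<in> polynomials C \<Longrightarrow> (\<lambda>x. f x * g x) \<in> polynomials C"

definition zariski :: "('a \<Rightarrow> 'k::field alg_closure) set \<Rightarrow> 'a set \<Rightarrow> ('k, 'a) fspace" where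
  "zariski C S = fraction_space {(S, polynomials C)}"

text \<open>
  The functions on \<open>U \<times> V\<close> coming from the tensor product over \<open>k\<close> of the rings of sections. The resulting
  product is the categorical one: see the lemmas \<open>regular_map_fst\<close>, \<open>regular_map_snd\<close>, \<open>regular_map_Pair\<close>.
\<close>

inductive_set tensors :: "('k::field, 'a) fspace \<Rightarrow> ('k, 'b) fspace \<Rightarrow> 'a set \<Rightarrow> 'b set \<Rightarrow> ('a \<times> 'b \<Rightarrow> 'k alg_closure) set"
  for X Y U V where
  tensor: "f \<in> sections X U \<Longrightarrow> g \<in> sections Y V \<Longrightarrow> (\<lambda>z. f (fst z) * g (snd z)) \<in> tensors X Y U V"
| add: "s \<in> tensors X Y U V \<Longrightarrow> t \<in> tensors X Y U V \<Longrightarrow> (\<lambda>z. s z + t z) \<in> tensors X Y U V"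

definition prod_space :: "('k::field, 'a) fspace \<Rightarrow> ('k, 'b) fspace \<Rightarrow> ('k, 'a \<times> 'b) fspace" (infixr "\<times>\<^sub>v" 75) where
  "X \<times>\<^sub>v Y = fraction_space {(U \<times> V, tensors X Y U V) | U V. openin (topol X) U \<and> openin (topol Y) V}"

definition coords :: "nat \<Rightarrow> ('k::field alg_closure list \<Rightarrow> 'k alg_closure) set" where
  "coords n = {\<lambda>x. x ! i | i. i < n}"

definition affine_space :: "nat \<Rightarrow> ('k::field, 'k alg_closure list) fspace" where
  "affine_space n = zariski (coords n) {x. length x = n}"

definition zero_set :: "nat \<Rightarrow> ('k::field alg_closure list \<Rightarrow> 'k alg_closure) set \<Rightarrow> 'k alg_closure list set" where
  "zero_set n P = {x. length x = n \<and> (\<forall>p \<in> P. p x = 0)}"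

definition affine_variety :: "('k::field, 'a) fspace \<Rightarrow> bool" where
  "affine_variety X \<longleftrightarrow> (\<exists>n. \<exists>P \<subseteq> polynomials (coords n). X \<cong>\<^sub>v induced (affine_space n) (zero_set n P))"

text \<open>The empty space is a variety. The last condition is separatedness.\<close>

definition variety :: "('k::field, 'a) fspace \<Rightarrow> bool" where
  "variety X \<longleftrightarrow> function_space X \<and>
     (\<exists>\<U>. finite \<U> \<and> \<Union>\<U> = pts X \<and> (\<forall>U \<in> \<U>. openin (topol X) U \<and> affine_variety (induced X U))) \<and>
     closedin (topol (X \<times>\<^sub>v X)) {(x, x) | x. x \<in> pts X}"


section \<open>Basic properties\<close>

lemma openin_generated_by_base:
  assumes "\<And>A B x. A \<in> \<B> \<Longrightarrow> B \<in> \<B> \<Longrightarrow> x \<in> A \<Longrightarrow> x \<in> B \<Longrightarrow> \<exists>D \<in> \<B>. x \<in> D \<and> D \<subseteq> A \<inter> B"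
  shows "openin (topology_generated_by \<B>) U \<longleftrightarrow> (\<forall>x \<in> U. \<exists>D \<in> \<B>. x \<in> D \<and> D \<subseteq> U)"
proof
  assume "openin (topology_generated_by \<B>) U"
  then have "generate_topology_on \<B> U" by (rule openin_topology_generated_by)
  then show "\<forall>x \<in> U. \<exists>D \<in> \<B>. x \<in> D \<and> D \<subseteq> U"
  proof induction
    case (Int a b)
    show ?case
    proof
      fix x assume x: "x \<in> a \<inter> b"
      obtain A B where "A \<in> \<B>" "x \<in> A" "A \<subseteq> a" "B \<in> \<B>" "x \<in> B" "B \<subseteq> b"
        using x Int.IH by blast
      with assms[of A B x] show "\<exists>D \<in> \<B>. x \<in> D \<and> D \<subseteq> a \<inter> b" by blast
    qed
  next
    case (UN K)
    then show ?case by (meson UnionE Union_upper order_trans)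
  qed auto
next
  assume "\<forall>x \<in> U. \<exists>D \<in> \<B>. x \<in> D \<and> D \<subseteq> U"
  then show "openin (topology_generated_by \<B>) U"
    by (subst openin_subopen) (metis topology_generated_by_Basis)
qed

locale fraction_data =
  fixes \<A> :: "('a set \<times> ('a \<Rightarrow> 'k::field alg_closure) set) set"
  assumes const: "\<And>D A c. (D, A) \<in> \<A> \<Longrightarrow> (\<lambda>_. to_ac c) \<in> A"
    and add: "\<And>D A f g. (D, A) \<in> \<A> \<Longrightarrow> f \<in> A \<Longrightarrow> g \<in> A \<Longrightarrow> (\<lambda>x. f x + g x) \<in> A"
    and mult: "\<And>D A f g. (D, A) \<in> \<A> \<Longrightarrow> f \<in> A \<Longrightarrow> g \<in> A \<Longrightarrow> (\<lambda>x. f x * g x) \<in> A"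
    and meet: "\<And>D A E B. (D, A) \<in> \<A> \<Longrightarrow> (E, B) \<in> \<A> \<Longrightarrow> \<exists>C. (D \<inter> E, C) \<in> \<A> \<and> A \<subseteq> C \<and> B \<subseteq> C"
begin

abbreviation basic :: "'a set \<Rightarrow> bool" where
  "basic W \<equiv> \<exists>D A h. W = {x \<in> D. h x \<noteq> 0} \<and> (D, A) \<in> \<A> \<and> h \<in> A"

lemma openin_iff:
  "openin (topol (fraction_space \<A>)) U \<longleftrightarrow>
     (\<forall>x \<in> U. \<exists>D A h. (D, A) \<in> \<A> \<and> h \<in> A \<and> x \<in> D \<and> h x \<noteq> 0 \<and> {x \<in> D. h x \<noteq> 0} \<subseteq> U)"
proof -
  have *: "\<exists>W \<in> {W. basic W}. x \<in> W \<and> W \<subseteq> A \<inter> B"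
    if "A \<in> {W. basic W}" "B \<in> {W. basic W}" "x \<in> A" "x \<in> B" for A B x
  proof -
    from that obtain D1 A1 h1 D2 A2 h2 where
      1: "A = {x \<in> D1. h1 x \<noteq> 0}" "(D1, A1) \<in> \<A>" "h1 \<in> A1" and
      2: "B = {x \<in> D2. h2 x \<noteq> 0}" "(D2, A2) \<in> \<A>" "h2 \<in> A2" by blast
    obtain C where C: "(D1 \<inter> D2, C) \<in> \<A>" "A1 \<subseteq> C" "A2 \<subseteq> C" using meet 1 2 by meson
    have "(\<lambda>x. h1 x * h2 x) \<in> C" using mult[OF C(1)] C 1 2 by blast
    then have "basic {x \<in> D1 \<inter> D2. h1 x * h2 x \<noteq> 0}"
      by (intro exI[of _ "D1 \<inter> D2"] exI[of _ C] exI[of _ "\<lambda>x. h1 x * h2 x"]) (simp add: C(1))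
    moreover have "{x \<in> D1 \<inter> D2. h1 x * h2 x \<noteq> 0} = A \<inter> B" using 1 2 by auto
    ultimately show ?thesis using that by auto
  qed
  have base: "openin (topol (fraction_space \<A>)) U \<longleftrightarrow> (\<forall>x \<in> U. \<exists>W \<in> {W. basic W}. x \<in> W \<and> W \<subseteq> U)"
    unfolding fraction_space_def fspace.select_convs
    by (rule openin_generated_by_base) (rule *)
  have "(\<exists>W \<in> {W. basic W}. x \<in> W \<and> W \<subseteq> U) \<longleftrightarrow>
      (\<exists>D A h. (D, A) \<in> \<A> \<and> h \<in> A \<and> x \<in> D \<and> h x \<noteq> 0 \<and> {x \<in> D. h x \<noteq> 0} \<subseteq> U)" (is "?L \<longleftrightarrow> ?R") for x
  proof
    assume ?L
    then obtain D A h where "(D, A) \<in> \<A>" "h \<in> A" "x \<in> {x \<in> D. h x \<noteq> 0}" "{x \<in> D. h x \<noteq> 0} \<subseteq> U"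
      by (elim bexE CollectE exE conjE) simp
    then show ?R by (intro exI[of _ D] exI[of _ A] exI[of _ h]) simp
  next
    assume ?R
    then obtain D A h where *: "(D, A) \<in> \<A>" "h \<in> A" "x \<in> D" "h x \<noteq> 0" "{x \<in> D. h x \<noteq> 0} \<subseteq> U"
      by (elim exE conjE)
    then have "basic {x \<in> D. h x \<noteq> 0}"
      by (intro exI[of _ D] exI[of _ A] exI[of _ h]) simp
    with * show ?L by (intro bexI[of _ "{x \<in> D. h x \<noteq> 0}"]) simp_all
  qed
  then show ?thesis unfolding base by (rule ball_cong[OF refl])
qed

lemma openin_basic: "(D, A) \<in> \<A> \<Longrightarrow> h \<in> A \<Longrightarrow> openin (topol (fraction_space \<A>)) {x \<in> D. h x \<noteq> 0}"
  unfolding openin_iff by blast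

lemma openin_domain: "(D, A) \<in> \<A> \<Longrightarrow> openin (topol (fraction_space \<A>)) D"
  using openin_basic[of D A "\<lambda>_. to_ac 1"] const[of D A 1] by simp

lemma pts_fraction: "pts (fraction_space \<A>) = \<Union>(fst ` \<A>)"
proof
  show "pts (fraction_space \<A>) \<subseteq> \<Union>(fst ` \<A>)"
    using openin_iff[of "pts (fraction_space \<A>)"] openin_topspace by force
  show "\<Union>(fst ` \<A>) \<subseteq> pts (fraction_space \<A>)"
    using openin_domain openin_subset by fastforce
qed

lemma sections_iff:
  "f \<in> sections (fraction_space \<A>) U \<longleftrightarrow>
     (\<forall>x \<in> U. \<exists>D A g h. (D, A) \<in> \<A> \<and> g \<in> A \<and> h \<in> A \<and> x \<in> D \<and> h x \<noteq> 0 \<and>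
                          (\<forall>y \<in> U \<inter> D. h y \<noteq> 0 \<longrightarrow> f y = g y / h y))"
  by (simp add: fraction_space_def)

lemma section_at:
  assumes "f \<in> sections (fraction_space \<A>) U" "x \<in> U"
  obtains D A g h where "(D, A) \<in> \<A>" "g \<in> A" "h \<in> A" "x \<in> D" "h x \<noteq> 0"
    "\<forall>y \<in> U \<inter> D. h y \<noteq> 0 \<longrightarrow> f y = g y / h y"
proof -
  from assms obtain D A g h where "(D, A) \<in> \<A>" "g \<in> A" "h \<in> A" "x \<in> D" "h x \<noteq> 0"
    "\<forall>y \<in> U \<inter> D. h y \<noteq> 0 \<longrightarrow> f y = g y / h y"
    unfolding sections_iff by metis
  then show thesis using that by blast
qed

lemma section_at2:
  assumes "f \<in> sections (fraction_space \<A>) U" "f' \<in> sections (fraction_space \<A>) U" "x \<in> U"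
  obtains D A g g' h where "(D, A) \<in> \<A>" "g \<in> A" "g' \<in> A" "h \<in> A" "x \<in> D" "h x \<noteq> 0"
    "\<forall>y \<in> U \<inter> D. h y \<noteq> 0 \<longrightarrow> f y = g y / h y"
    "\<forall>y \<in> U \<inter> D. h y \<noteq> 0 \<longrightarrow> f' y = g' y / h y"
proof -
  obtain D A g h where 1: "(D, A) \<in> \<A>" "g \<in> A" "h \<in> A" "x \<in> D" "h x \<noteq> 0"
    "\<forall>y \<in> U \<inter> D. h y \<noteq> 0 \<longrightarrow> f y = g y / h y"
    by (rule section_at[OF assms(1,3)])
  obtain E B g' h' where 2: "(E, B) \<in> \<A>" "g' \<in> B" "h' \<in> B" "x \<in> E" "h' x \<noteq> 0"
    "\<forall>y \<in> U \<inter> E. h' y \<noteq> 0 \<longrightarrow> f' y = g' y / h' y"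
    by (rule section_at[OF assms(2,3)])
  obtain C where C: "(D \<inter> E, C) \<in> \<A>" "A \<subseteq> C" "B \<subseteq> C" using meet 1(1) 2(1) by meson
  have m: "(\<lambda>y. g y * h' y) \<in> C" "(\<lambda>y. g' y * h y) \<in> C" "(\<lambda>y. h y * h' y) \<in> C"
    using mult[OF C(1)] C 1 2 by blast+
  show thesis
    by (rule that[OF C(1) m]) (use 1 2 in auto)
qed

lemma function_space_fraction: "function_space (fraction_space \<A>)"
proof
  let ?X = "fraction_space \<A>"
  fix U assume U: "openin (topol ?X) U"
  show "g \<in> sections ?X U" if "f \<in> sections ?X U" "\<And>x. x \<in> U \<Longrightarrow> g x = f x" for f g
    using that by (simp add: sections_iff)
  show "f \<in> sections ?X V" if VU: "openin (topol ?X) V" "V \<subseteq> U" and fU: "f \<in> sections ?X U" for V f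
    unfolding sections_iff
  proof
    fix x assume "x \<in> V"
    then have "x \<in> U" using VU by blast
    obtain D A g h where "(D, A) \<in> \<A>" "g \<in> A" "h \<in> A" "x \<in> D" "h x \<noteq> 0"
      "\<forall>y \<in> U \<inter> D. h y \<noteq> 0 \<longrightarrow> f y = g y / h y"
      by (rule section_at[OF fU \<open>x \<in> U\<close>])
    with VU show "\<exists>D A g h. (D, A) \<in> \<A> \<and> g \<in> A \<and> h \<in> A \<and> x \<in> D \<and> h x \<noteq> 0 \<and>
                          (\<forall>y \<in> V \<inter> D. h y \<noteq> 0 \<longrightarrow> f y = g y / h y)"
      using VU(2) by (intro exI[of _ D] exI[of _ A] exI[of _ g] exI[of _ h]) auto
  qed
  show "f \<in> sections ?X U"
    if *: "\<And>x. x \<in> U \<Longrightarrow> \<exists>V. openin (topol ?X) V \<and> x \<in> V \<and> V \<subseteq> U \<and> f \<in> sections ?X V" for f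
    unfolding sections_iff
  proof
    fix x assume "x \<in> U"
    then obtain V where V: "openin (topol ?X) V" "x \<in> V" "V \<subseteq> U" "f \<in> sections ?X V" using * by blast
    obtain D A g h where 1: "(D, A) \<in> \<A>" "g \<in> A" "h \<in> A" "x \<in> D" "h x \<noteq> 0"
      "\<forall>y \<in> V \<inter> D. h y \<noteq> 0 \<longrightarrow> f y = g y / h y"
      by (rule section_at[OF V(4,2)])
    obtain E B k where 2: "(E, B) \<in> \<A>" "k \<in> B" "x \<in> E" "k x \<noteq> 0" "{x \<in> E. k x \<noteq> 0} \<subseteq> V"
      using V(1)[unfolded openin_iff, rule_format, OF V(2)] by blast
    obtain C where C: "(D \<inter> E, C) \<in> \<A>" "A \<subseteq> C" "B \<subseteq> C" using meet 1(1) 2(1) by meson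
    have m: "(\<lambda>y. g y * k y) \<in> C" "(\<lambda>y. h y * k y) \<in> C"
      using mult[OF C(1)] C 1 2 by blast+
    have "f y = (g y * k y) / (h y * k y)" if "y \<in> D \<inter> E" "h y * k y \<noteq> 0" for y
      using that 1(6) 2(5) by auto
    then show "\<exists>D A g h. (D, A) \<in> \<A> \<and> g \<in> A \<and> h \<in> A \<and> x \<in> D \<and> h x \<noteq> 0 \<and>
                          (\<forall>y \<in> U \<inter> D. h y \<noteq> 0 \<longrightarrow> f y = g y / h y)"
      using C(1) m 1 2 by (intro exI[of _ "D \<inter> E"] exI[of _ C] exI[of _ "\<lambda>y. g y * k y"] exI[of _ "\<lambda>y. h y * k y"]) auto
  qed
  show "(\<lambda>_. to_ac c) \<in> sections ?X U" for c
    unfolding sections_iff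
  proof
    fix x assume "x \<in> U"
    then obtain D A where 1: "(D, A) \<in> \<A>" "x \<in> D"
      using U unfolding openin_iff by meson
    then show "\<exists>D A g h. (D, A) \<in> \<A> \<and> g \<in> A \<and> h \<in> A \<and> x \<in> D \<and> h x \<noteq> 0 \<and>
                          (\<forall>y \<in> U \<inter> D. h y \<noteq> 0 \<longrightarrow> to_ac c = g y / h y)"
      using const[OF 1(1), of c] const[OF 1(1), of 1]
      by (intro exI[of _ D] exI[of _ A] exI[of _ "\<lambda>_. to_ac c"] exI[of _ "\<lambda>_. to_ac 1"]) auto
  qed
  fix f assume f: "f \<in> sections ?X U"
  show "(\<lambda>x. f x + g x) \<in> sections ?X U" if g: "g \<in> sections ?X U" for g
    unfolding sections_iff
  proof
    fix x assume "x \<in> U"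
    obtain D A p q h where
      *: "(D, A) \<in> \<A>" "p \<in> A" "q \<in> A" "h \<in> A" "x \<in> D" "h x \<noteq> 0"
      "\<forall>y \<in> U \<inter> D. h y \<noteq> 0 \<longrightarrow> f y = p y / h y"
      "\<forall>y \<in> U \<inter> D. h y \<noteq> 0 \<longrightarrow> g y = q y / h y" by (rule section_at2[OF f g \<open>x \<in> U\<close>])
    show "\<exists>D A g' h. (D, A) \<in> \<A> \<and> g' \<in> A \<and> h \<in> A \<and> x \<in> D \<and> h x \<noteq> 0 \<and>
                          (\<forall>y \<in> U \<inter> D. h y \<noteq> 0 \<longrightarrow> f y + g y = g' y / h y)"
      by (rule exI[of _ D], rule exI[of _ A], rule exI[of _ "\<lambda>y. p y + q y"], rule exI[of _ h])
        (use * add in \<open>auto simp: add_divide_distrib\<close>)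
  qed
  show "(\<lambda>x. f x * g x) \<in> sections ?X U" if g: "g \<in> sections ?X U" for g
    unfolding sections_iff
  proof
    fix x assume "x \<in> U"
    obtain D A p q h where
      *: "(D, A) \<in> \<A>" "p \<in> A" "q \<in> A" "h \<in> A" "x \<in> D" "h x \<noteq> 0"
      "\<forall>y \<in> U \<inter> D. h y \<noteq> 0 \<longrightarrow> f y = p y / h y"
      "\<forall>y \<in> U \<inter> D. h y \<noteq> 0 \<longrightarrow> g y = q y / h y" by (rule section_at2[OF f g \<open>x \<in> U\<close>])
    show "\<exists>D A g' h. (D, A) \<in> \<A> \<and> g' \<in> A \<and> h \<in> A \<and> x \<in> D \<and> h x \<noteq> 0 \<and>
                          (\<forall>y \<in> U \<inter> D. h y \<noteq> 0 \<longrightarrow> f y * g y = g' y / h y)"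
      by (rule exI[of _ D], rule exI[of _ A], rule exI[of _ "\<lambda>y. p y * q y"], rule exI[of _ "\<lambda>y. h y * h y"])
        (use * mult in \<open>auto\<close>)
  qed
  show "openin (topol ?X) {x \<in> U. f x \<noteq> 0}"
    unfolding openin_iff
  proof
    fix x assume x: "x \<in> {x \<in> U. f x \<noteq> 0}"
    then have xU: "x \<in> U" by simp
    obtain D A g h where 1: "(D, A) \<in> \<A>" "g \<in> A" "h \<in> A" "x \<in> D" "h x \<noteq> 0"
      "\<forall>y \<in> U \<inter> D. h y \<noteq> 0 \<longrightarrow> f y = g y / h y"
      by (rule section_at[OF f xU])
    obtain E B k where 2: "(E, B) \<in> \<A>" "k \<in> B" "x \<in> E" "k x \<noteq> 0" "{x \<in> E. k x \<noteq> 0} \<subseteq> U"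
      using U[unfolded openin_iff, rule_format, OF xU] by blast
    obtain C where C: "(D \<inter> E, C) \<in> \<A>" "A \<subseteq> C" "B \<subseteq> C" using meet 1(1) 2(1) by meson
    have m: "(\<lambda>y. g y * k y) \<in> C" "h \<in> C"
      using mult[OF C(1)] C 1 2 by blast+
    have m': "(\<lambda>y. (g y * k y) * h y) \<in> C" using mult[OF C(1) m] .
    have gx: "g x \<noteq> 0" using x 1 by auto
    show "\<exists>D A h. (D, A) \<in> \<A> \<and> h \<in> A \<and> x \<in> D \<and> h x \<noteq> 0 \<and> {x \<in> D. h x \<noteq> 0} \<subseteq> {x \<in> U. f x \<noteq> 0}"
      by (rule exI[of _ "D \<inter> E"], rule exI[of _ C], rule exI[of _ "\<lambda>y. (g y * k y) * h y"])
        (use C m' gx 1 2 in auto)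
  qed
  show "(\<lambda>x. inverse (f x)) \<in> sections ?X {x \<in> U. f x \<noteq> 0}"
    unfolding sections_iff
  proof
    fix x assume x: "x \<in> {x \<in> U. f x \<noteq> 0}"
    then have xU: "x \<in> U" by simp
    obtain D A g h where 1: "(D, A) \<in> \<A>" "g \<in> A" "h \<in> A" "x \<in> D" "h x \<noteq> 0"
      "\<forall>y \<in> U \<inter> D. h y \<noteq> 0 \<longrightarrow> f y = g y / h y"
      by (rule section_at[OF f xU])
    show "\<exists>D A g h. (D, A) \<in> \<A> \<and> g \<in> A \<and> h \<in> A \<and> x \<in> D \<and> h x \<noteq> 0 \<and>
                          (\<forall>y \<in> {x \<in> U. f x \<noteq> 0} \<inter> D. h y \<noteq> 0 \<longrightarrow> inverse (f y) = g y / h y)"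
      by (rule exI[of _ D], rule exI[of _ A], rule exI[of _ "\<lambda>y. h y * h y"], rule exI[of _ "\<lambda>y. g y * h y"])
        (use x 1 mult[OF 1(1)] in auto)
  qed
qed

lemma regular_map_fraction:
  assumes Z: "function_space Z"
    and pts: "\<And>z. z \<in> pts Z \<Longrightarrow> \<phi> z \<in> \<Union>(fst ` \<A>)"
    and op: "\<And>D A. (D, A) \<in> \<A> \<Longrightarrow> openin (topol Z) {z \<in> pts Z. \<phi> z \<in> D}"
    and sec: "\<And>D A h. (D, A) \<in> \<A> \<Longrightarrow> h \<in> A \<Longrightarrow> (\<lambda>z. h (\<phi> z)) \<in> sections Z {z \<in> pts Z. \<phi> z \<in> D}"
  shows "regular_map Z (fraction_space \<A>) \<phi>"
proof -
  interpret Z: function_space Z by fact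
  let ?X = "fraction_space \<A>"
  have bas: "openin (topol Z) {z \<in> {z \<in> pts Z. \<phi> z \<in> D}. h (\<phi> z) \<noteq> 0}" if "(D, A) \<in> \<A>" "h \<in> A" for D A h
    using Z.openin_nonzero[OF op[OF that(1)] sec[OF that]] .
  have cont: "openin (topol Z) {z \<in> pts Z. \<phi> z \<in> V}" if V: "openin (topol ?X) V" for V
  proof (subst openin_subopen, rule ballI)
    fix z assume z: "z \<in> {z \<in> pts Z. \<phi> z \<in> V}"
    then have zV: "\<phi> z \<in> V" by simp
    obtain D A h where 1: "(D, A) \<in> \<A>" "h \<in> A" "\<phi> z \<in> D" "h (\<phi> z) \<noteq> 0" "{x \<in> D. h x \<noteq> 0} \<subseteq> V"
      using V[unfolded openin_iff, rule_format, OF zV] by blast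
    show "\<exists>T. openin (topol Z) T \<and> z \<in> T \<and> T \<subseteq> {z \<in> pts Z. \<phi> z \<in> V}"
      using bas[OF 1(1,2)] 1 z by (intro exI[of _ "{z \<in> {z \<in> pts Z. \<phi> z \<in> D}. h (\<phi> z) \<noteq> 0}"]) auto
  qed
  show ?thesis
    unfolding regular_map_def
  proof (intro conjI allI impI)
    show "continuous_map (topol Z) (topol ?X) \<phi>"
      using cont pts by (auto simp: continuous_map pts_fraction image_subset_iff)
    fix V g assume V: "openin (topol ?X) V" and g: "g \<in> sections ?X V"
    show "(\<lambda>z. g (\<phi> z)) \<in> sections Z {z \<in> pts Z. \<phi> z \<in> V}"
    proof (rule Z.sections_glue[OF cont[OF V]])
      fix z assume z: "z \<in> {z \<in> pts Z. \<phi> z \<in> V}"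
      then have zV: "\<phi> z \<in> V" by simp
      obtain D A p h where 1: "(D, A) \<in> \<A>" "p \<in> A" "h \<in> A" "\<phi> z \<in> D" "h (\<phi> z) \<noteq> 0"
        "\<forall>y \<in> V \<inter> D. h y \<noteq> 0 \<longrightarrow> g y = p y / h y"
        by (rule section_at[OF g zV])
      define W where "W = {z \<in> {z \<in> pts Z. \<phi> z \<in> D}. h (\<phi> z) \<noteq> 0}"
      have W: "openin (topol Z) W" unfolding W_def using bas[OF 1(1,3)] .
      have "(\<lambda>z. p (\<phi> z)) \<in> sections Z W"
        using Z.sections_restrict[OF op[OF 1(1)] W _ sec[OF 1(1,2)]] by (auto simp: W_def)
      moreover have "(\<lambda>z. inverse (h (\<phi> z))) \<in> sections Z W"
        using Z.sections_inverse[OF op[OF 1(1)] sec[OF 1(1,3)]] by (simp add: W_def)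
      ultimately have s: "(\<lambda>z. p (\<phi> z) * inverse (h (\<phi> z))) \<in> sections Z W"
        using Z.sections_mult W by blast
      define W' where "W' = W \<inter> {z \<in> pts Z. \<phi> z \<in> V}"
      have W': "openin (topol Z) W'" unfolding W'_def using W cont[OF V] by blast
      have s': "(\<lambda>z. p (\<phi> z) * inverse (h (\<phi> z))) \<in> sections Z W'"
        using Z.sections_restrict[OF W W' _ s] by (auto simp: W'_def)
      have "(\<lambda>z. g (\<phi> z)) \<in> sections Z W'"
        by (rule Z.sections_cong[OF W' s']) (use 1 in \<open>auto simp: W'_def W_def divide_inverse\<close>)
      moreover have "z \<in> W'" using z 1 by (auto simp: W'_def W_def)
      ultimately show "\<exists>V'. openin (topol Z) V' \<and> z \<in> V' \<and> V' \<subseteq> {z \<in> pts Z. \<phi> z \<in> V} \<and>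
            (\<lambda>z. g (\<phi> z)) \<in> sections Z V'"
        using W' by (intro exI[of _ W']) (auto simp: W'_def)
    qed
  qed
qed

end

lemma regular_map_compose:
  assumes "regular_map X Y \<phi>" "regular_map Y Z \<psi>"
  shows "regular_map X Z (\<lambda>x. \<psi> (\<phi> x))"
  unfolding regular_map_def
proof (intro conjI allI impI)
  show "continuous_map (topol X) (topol Z) (\<lambda>x. \<psi> (\<phi> x))"
    using assms continuous_map_compose[of "topol X" "topol Y" \<phi> "topol Z" \<psi>]
    by (auto simp: regular_map_def o_def)
  fix V g assume V: "openin (topol Z) V" "g \<in> sections Z V"
  let ?W = "{y \<in> pts Y. \<psi> y \<in> V}"
  have "openin (topol Y) ?W" "(\<lambda>y. g (\<psi> y)) \<in> sections Y ?W"
    using assms V by (auto simp: regular_map_def continuous_map)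
  then have "(\<lambda>x. g (\<psi> (\<phi> x))) \<in> sections X {x \<in> pts X. \<phi> x \<in> ?W}"
    using assms(1) unfolding regular_map_def by blast
  moreover have "{x \<in> pts X. \<phi> x \<in> ?W} = {x \<in> pts X. \<psi> (\<phi> x) \<in> V}"
    using assms(1) by (auto simp: regular_map_def continuous_map)
  ultimately show "(\<lambda>x. g (\<psi> (\<phi> x))) \<in> sections X {x \<in> pts X. \<psi> (\<phi> x) \<in> V}" by simp
qed

lemma regular_map_id [simp]: "regular_map X X (\<lambda>x. x)"
proof -
  have "{x \<in> pts X. x \<in> V} = V" if "openin (topol X) V" for V
    using openin_subset[OF that] by auto
  then show ?thesis by (auto simp: regular_map_def)
qed

lemma regular_map_cong:
  assumes X: "function_space X" and f: "regular_map X Y \<phi>" and eq: "\<And>x. x \<in> pts X \<Longrightarrow> \<psi> x = \<phi> x"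
  shows "regular_map X Y \<psi>"
proof -
  interpret function_space X by fact
  have *: "{x \<in> pts X. \<psi> x \<in> V} = {x \<in> pts X. \<phi> x \<in> V}" for V using eq by auto
  show ?thesis
    unfolding regular_map_def
  proof (intro conjI allI impI)
    show "continuous_map (topol X) (topol Y) \<psi>"
      using f eq by (auto simp: regular_map_def intro: continuous_map_eq)
    fix V g assume V: "openin (topol Y) V" "g \<in> sections Y V"
    have op: "openin (topol X) {x \<in> pts X. \<phi> x \<in> V}" using f V by (auto simp: regular_map_def continuous_map)
    have "(\<lambda>x. g (\<phi> x)) \<in> sections X {x \<in> pts X. \<phi> x \<in> V}" using f V by (auto simp: regular_map_def)
    then show "(\<lambda>x. g (\<psi> x)) \<in> sections X {x \<in> pts X. \<psi> x \<in> V}"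
      unfolding * by (rule sections_cong[OF op]) (use eq in auto)
  qed
qed

lemma regular_map_pts: "regular_map X Y \<phi> \<Longrightarrow> x \<in> pts X \<Longrightarrow> \<phi> x \<in> pts Y"
  by (auto simp: regular_map_def continuous_map)

lemma regular_map_open: "regular_map X Y \<phi> \<Longrightarrow> openin (topol Y) V \<Longrightarrow> openin (topol X) {x \<in> pts X. \<phi> x \<in> V}"
  by (auto simp: regular_map_def continuous_map)

lemma regular_map_section:
  "regular_map X Y \<phi> \<Longrightarrow> openin (topol Y) V \<Longrightarrow> g \<in> sections Y V \<Longrightarrow>
     (\<lambda>x. g (\<phi> x)) \<in> sections X {x \<in> pts X. \<phi> x \<in> V}"
  by (auto simp: regular_map_def)

lemma isomorphic_refl: "X \<cong>\<^sub>v X"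
  unfolding isomorphic_def by (intro exI[of _ "\<lambda>x. x"]) auto

lemma isomorphic_sym: "X \<cong>\<^sub>v Y \<Longrightarrow> Y \<cong>\<^sub>v X"
  unfolding isomorphic_def by blast

lemma isomorphic_trans:
  assumes "X \<cong>\<^sub>v Y" "Y \<cong>\<^sub>v Z" shows "X \<cong>\<^sub>v Z"
proof -
  obtain f f' where 1: "regular_map X Y f" "regular_map Y X f'"
    "\<forall>x \<in> pts X. f' (f x) = x" "\<forall>y \<in> pts Y. f (f' y) = y"
    using assms(1) unfolding isomorphic_def by blast
  obtain g g' where 2: "regular_map Y Z g" "regular_map Z Y g'"
    "\<forall>x \<in> pts Y. g' (g x) = x" "\<forall>y \<in> pts Z. g (g' y) = y"
    using assms(2) unfolding isomorphic_def by blast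
  show ?thesis
    unfolding isomorphic_def
  proof (intro exI conjI)
    show "regular_map X Z (\<lambda>x. g (f x))" "regular_map Z X (\<lambda>z. f' (g' z))"
      using regular_map_compose 1 2 by blast+
  qed (use 1 2 regular_map_pts[OF 1(1)] regular_map_pts[OF 2(2)] in auto)
qed

lemma topol_induced [simp]: "topol (induced X S) = subtopology (topol X) S"
  by (simp only: induced_def fspace.select_convs)

lemma sections_induced:
  "f \<in> sections (induced X S) U \<longleftrightarrow>
     (\<forall>x \<in> U. \<exists>V g. openin (topol X) V \<and> x \<in> V \<and> g \<in> sections X V \<and> (\<forall>y \<in> U \<inter> V. f y = g y))"
  by (simp only: induced_def fspace.select_convs mem_Collect_eq)

lemma induced_at:
  assumes "f \<in> sections (induced X S) U" "x \<in> U"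
  obtains V g where "openin (topol X) V" "x \<in> V" "g \<in> sections X V" "\<forall>y \<in> U \<inter> V. f y = g y"
  using bspec[OF iffD1[OF sections_induced assms(1)] assms(2)] by (elim exE conjE) (rule that)

lemma function_space_induced:
  assumes "function_space X" shows "function_space (induced X S)"
proof -
  interpret function_space X by fact
  have two: "\<exists>W p q. openin (topol X) W \<and> x \<in> W \<and> p \<in> sections X W \<and> q \<in> sections X W \<and>
      (\<forall>y \<in> U \<inter> W. f y = p y) \<and> (\<forall>y \<in> U \<inter> W. g y = q y)"
    if fg: "f \<in> sections (induced X S) U" "g \<in> sections (induced X S) U" and x: "x \<in> U" for f g U x
  proof -
    obtain V p where 1: "openin (topol X) V" "x \<in> V" "p \<in> sections X V" "\<forall>y \<in> U \<inter> V. f y = p y"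
      by (rule induced_at[OF fg(1) x])
    obtain V' q where 2: "openin (topol X) V'" "x \<in> V'" "q \<in> sections X V'" "\<forall>y \<in> U \<inter> V'. g y = q y"
      by (rule induced_at[OF fg(2) x])
    have W: "openin (topol X) (V \<inter> V')" using 1 2 by blast
    show ?thesis
      using 1 2 W sections_restrict[OF 1(1) W] sections_restrict[OF 2(1) W]
      by (intro exI[of _ "V \<inter> V'"] exI[of _ p] exI[of _ q]) auto
  qed
  show ?thesis
  proof
    fix U assume U: "openin (topol (induced X S)) U"
    then obtain U' where U': "openin (topol X) U'" "U = U' \<inter> S"
      by (auto simp: openin_subtopology)
    show "g \<in> sections (induced X S) U" if "f \<in> sections (induced X S) U" "\<And>x. x \<in> U \<Longrightarrow> g x = f x" for f g
      using that by (simp add: sections_induced)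
    show "f \<in> sections (induced X S) V"
      if "openin (topol (induced X S)) V" and VU: "V \<subseteq> U" and fU: "f \<in> sections (induced X S) U" for V f
      unfolding sections_induced
    proof
      fix x assume "x \<in> V"
      then have xU: "x \<in> U" using VU by blast
      obtain W g where "openin (topol X) W" "x \<in> W" "g \<in> sections X W" "\<forall>y \<in> U \<inter> W. f y = g y"
        by (rule induced_at[OF fU xU])
      with VU show "\<exists>W g. openin (topol X) W \<and> x \<in> W \<and> g \<in> sections X W \<and> (\<forall>y \<in> V \<inter> W. f y = g y)"
        by (intro exI[of _ W] exI[of _ g]) auto
    qed
    show "f \<in> sections (induced X S) U"
      if *: "\<And>x. x \<in> U \<Longrightarrow> \<exists>V. openin (topol (induced X S)) V \<and> x \<in> V \<and> V \<subseteq> U \<and> f \<in> sections (induced X S) V" for f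
      unfolding sections_induced
    proof
      fix x assume x: "x \<in> U"
      obtain V where V: "openin (topol (induced X S)) V" "x \<in> V" "V \<subseteq> U" "f \<in> sections (induced X S) V"
        using *[OF x] by blast
      obtain V' where V': "openin (topol X) V'" "V = V' \<inter> S"
        using V(1) by (auto simp: openin_subtopology)
      obtain W g where W: "openin (topol X) W" "x \<in> W" "g \<in> sections X W" "\<forall>y \<in> V \<inter> W. f y = g y"
        by (rule induced_at[OF V(4) V(2)])
      have o: "openin (topol X) (W \<inter> V')" using W V' by blast
      show "\<exists>V g. openin (topol X) V \<and> x \<in> V \<and> g \<in> sections X V \<and> (\<forall>y \<in> U \<inter> V. f y = g y)"
        using o W V V' U'(2) sections_restrict[OF W(1) o _ W(3)]
        by (intro exI[of _ "W \<inter> V'"] exI[of _ g]) auto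
    qed
    show "(\<lambda>_. to_ac c) \<in> sections (induced X S) U" for c
      using sections_const[OF U'(1)] U' unfolding sections_induced by blast
    fix f assume f: "f \<in> sections (induced X S) U"
    show "(\<lambda>x. f x + g x) \<in> sections (induced X S) U" if g: "g \<in> sections (induced X S) U" for g
      unfolding sections_induced
    proof
      fix x assume "x \<in> U"
      from two[OF f g this] obtain W p q where *: "openin (topol X) W" "x \<in> W" "p \<in> sections X W" "q \<in> sections X W"
        "\<forall>y \<in> U \<inter> W. f y = p y" "\<forall>y \<in> U \<inter> W. g y = q y" by blast
      then show "\<exists>V h. openin (topol X) V \<and> x \<in> V \<and> h \<in> sections X V \<and> (\<forall>y \<in> U \<inter> V. f y + g y = h y)"
        using sections_add[OF *(1,3,4)] by (intro exI[of _ W] exI[of _ "\<lambda>x. p x + q x"]) auto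
    qed
    show "(\<lambda>x. f x * g x) \<in> sections (induced X S) U" if g: "g \<in> sections (induced X S) U" for g
      unfolding sections_induced
    proof
      fix x assume "x \<in> U"
      from two[OF f g this] obtain W p q where *: "openin (topol X) W" "x \<in> W" "p \<in> sections X W" "q \<in> sections X W"
        "\<forall>y \<in> U \<inter> W. f y = p y" "\<forall>y \<in> U \<inter> W. g y = q y" by blast
      then show "\<exists>V h. openin (topol X) V \<and> x \<in> V \<and> h \<in> sections X V \<and> (\<forall>y \<in> U \<inter> V. f y * g y = h y)"
        using sections_mult[OF *(1,3,4)] by (intro exI[of _ W] exI[of _ "\<lambda>x. p x * q x"]) auto
    qed
    show "openin (topol (induced X S)) {x \<in> U. f x \<noteq> 0}"
    proof (subst openin_subopen, rule ballI)
      fix x assume x: "x \<in> {x \<in> U. f x \<noteq> 0}"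
      then have xU: "x \<in> U" by simp
      obtain V g where V: "openin (topol X) V" "x \<in> V" "g \<in> sections X V" "\<forall>y \<in> U \<inter> V. f y = g y"
        by (rule induced_at[OF f xU])
      have o: "openin (topol X) ({x \<in> V. g x \<noteq> 0} \<inter> U')" using openin_nonzero[OF V(1,3)] U' by blast
      show "\<exists>T. openin (topol (induced X S)) T \<and> x \<in> T \<and> T \<subseteq> {x \<in> U. f x \<noteq> 0}"
      proof (intro exI conjI)
        show "openin (topol (induced X S)) ({x \<in> V. g x \<noteq> 0} \<inter> U' \<inter> S)"
          using o by (auto simp: openin_subtopology)
      qed (use x V U' in auto)
    qed
    show "(\<lambda>x. inverse (f x)) \<in> sections (induced X S) {x \<in> U. f x \<noteq> 0}"
      unfolding sections_induced
    proof
      fix x assume x: "x \<in> {x \<in> U. f x \<noteq> 0}"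
      then have xU: "x \<in> U" by simp
      obtain V g where V: "openin (topol X) V" "x \<in> V" "g \<in> sections X V" "\<forall>y \<in> U \<inter> V. f y = g y"
        by (rule induced_at[OF f xU])
      show "\<exists>V g. openin (topol X) V \<and> x \<in> V \<and> g \<in> sections X V \<and>
          (\<forall>y \<in> {x \<in> U. f x \<noteq> 0} \<inter> V. inverse (f y) = g y)"
        using V x openin_nonzero[OF V(1,3)] sections_inverse[OF V(1,3)]
        by (intro exI[of _ "{x \<in> V. g x \<noteq> 0}"] exI[of _ "\<lambda>x. inverse (g x)"]) auto
    qed
  qed
qed

lemma regular_map_inclusion:
  assumes "function_space X" shows "regular_map (induced X S) X (\<lambda>x. x)"
  unfolding regular_map_def
proof (intro conjI allI impI)
  show "continuous_map (topol (induced X S)) (topol X) (\<lambda>x. x)"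
    by (simp add: continuous_map_from_subtopology)
  fix V g assume "openin (topol X) V" "g \<in> sections X V"
  then show "g \<in> sections (induced X S) {x \<in> pts (induced X S). x \<in> V}"
    unfolding sections_induced by blast
qed

lemma regular_map_into_induced:
  assumes "function_space Z" "regular_map Z X \<phi>" "\<And>z. z \<in> pts Z \<Longrightarrow> \<phi> z \<in> S"
  shows "regular_map Z (induced X S) \<phi>"
proof -
  interpret function_space Z by fact
  show ?thesis
    unfolding regular_map_def
  proof (intro conjI allI impI)
    show c: "continuous_map (topol Z) (topol (induced X S)) \<phi>"
      using assms by (auto simp: regular_map_def continuous_map_in_subtopology)
    fix V g assume V: "openin (topol (induced X S)) V" and g: "g \<in> sections (induced X S) V"
    have o: "openin (topol Z) {z \<in> pts Z. \<phi> z \<in> V}" using c V by (auto simp: continuous_map)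
    show "(\<lambda>z. g (\<phi> z)) \<in> sections Z {z \<in> pts Z. \<phi> z \<in> V}"
    proof (rule sections_glue[OF o])
      fix z assume z: "z \<in> {z \<in> pts Z. \<phi> z \<in> V}"
      then have zV: "\<phi> z \<in> V" by simp
      obtain W h where W: "openin (topol X) W" "\<phi> z \<in> W" "h \<in> sections X W" "\<forall>y \<in> V \<inter> W. g y = h y"
        by (rule induced_at[OF g zV])
      let ?T = "{z \<in> pts Z. \<phi> z \<in> V} \<inter> {z \<in> pts Z. \<phi> z \<in> W}"
      have T: "openin (topol Z) ?T" using o regular_map_open[OF assms(2) W(1)] by blast
      have "(\<lambda>z. h (\<phi> z)) \<in> sections Z ?T"
        using sections_restrict[OF regular_map_open[OF assms(2) W(1)] T _ regular_map_section[OF assms(2) W(1,3)]] by auto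
      then have "(\<lambda>z. g (\<phi> z)) \<in> sections Z ?T"
        by (rule sections_cong[OF T]) (use W in auto)
      then show "\<exists>V'. openin (topol Z) V' \<and> z \<in> V' \<and> V' \<subseteq> {z \<in> pts Z. \<phi> z \<in> V} \<and> (\<lambda>z. g (\<phi> z)) \<in> sections Z V'"
        using T z W by (intro exI[of _ ?T]) auto
    qed
  qed
qed

lemma fraction_data_zariski: "fraction_data {(S, polynomials C)}"
  by standard (auto intro: polynomials.intros)

lemma function_space_zariski: "function_space (zariski C S)"
  unfolding zariski_def by (rule fraction_data.function_space_fraction[OF fraction_data_zariski])

lemma pts_zariski [simp]: "pts (zariski C S) = S"
  unfolding zariski_def by (simp add: fraction_data.pts_fraction[OF fraction_data_zariski])

lemma polynomial_section:
  assumes "f \<in> polynomials C" "U \<subseteq> S" shows "f \<in> sections (zariski C S) U"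
  unfolding zariski_def fraction_data.sections_iff[OF fraction_data_zariski]
proof
  fix x assume "x \<in> U"
  with assms polynomials.const[of 1 C]
  show "\<exists>D A g h. (D, A) \<in> {(S, polynomials C)} \<and> g \<in> A \<and> h \<in> A \<and> x \<in> D \<and> h x \<noteq> 0 \<and>
      (\<forall>y \<in> U \<inter> D. h y \<noteq> 0 \<longrightarrow> f y = g y / h y)"
    by (intro exI[of _ S] exI[of _ "polynomials C"] exI[of _ f] exI[of _ "\<lambda>_. to_ac 1"]) auto
qed

lemma regular_map_zariski:
  assumes Z: "function_space Z" and pts: "\<And>z. z \<in> pts Z \<Longrightarrow> \<phi> z \<in> S"
    and C: "\<And>c. c \<in> C \<Longrightarrow> (\<lambda>z. c (\<phi> z)) \<in> sections Z (pts Z)"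
  shows "regular_map Z (zariski C S) \<phi>"
  unfolding zariski_def
proof (rule fraction_data.regular_map_fraction[OF fraction_data_zariski Z])
  interpret Z: function_space Z by fact
  have eq: "{z \<in> pts Z. \<phi> z \<in> S} = pts Z" using pts by auto
  fix D A assume "(D, A) \<in> {(S, polynomials C)}"
  then have [simp]: "D = S" "A = polynomials C" by auto
  show "openin (topol Z) {z \<in> pts Z. \<phi> z \<in> D}" by (simp add: eq)
  fix h assume "h \<in> A"
  then have "h \<in> polynomials C" by simp
  then show "(\<lambda>z. h (\<phi> z)) \<in> sections Z {z \<in> pts Z. \<phi> z \<in> D}"
    by (induction; simp only: eq \<open>D = S\<close>)
      (auto intro: Z.sections_const Z.sections_add Z.sections_mult C)
qed (use pts in simp)

lemma fraction_data_product:
  assumes "function_space X" "function_space Y"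
  shows "fraction_data {(U \<times> V, tensors X Y U V) | U V. openin (topol X) U \<and> openin (topol Y) V}"
proof
  interpret X: function_space X by fact
  interpret Y: function_space Y by fact
  let ?A = "{(U \<times> V, tensors X Y U V) | U V. openin (topol X) U \<and> openin (topol Y) V}"
  fix D A assume "(D, A) \<in> ?A"
  then obtain U V where DA: "D = U \<times> V" "A = tensors X Y U V" and UV: "openin (topol X) U" "openin (topol Y) V"
    by auto
  show "(\<lambda>_. to_ac c) \<in> A" for c
    using tensors.tensor[OF X.sections_const[OF UV(1), of c] Y.sections_const[OF UV(2), of 1]] by (simp add: DA)
  show "(\<lambda>x. f x + g x) \<in> A" if "f \<in> A" "g \<in> A" for f g
    using that tensors.add by (simp add: DA)
  have tm: "(\<lambda>z. s z * (f (fst z) * g (snd z))) \<in> tensors X Y U V"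
    if "s \<in> tensors X Y U V" and fg: "f \<in> sections X U" "g \<in> sections Y V" for s f g
    using that(1)
  proof induction
    case (tensor p q)
    have "(\<lambda>z. (\<lambda>x. p x * f x) (fst z) * (\<lambda>y. q y * g y) (snd z)) \<in> tensors X Y U V"
      using tensor fg UV by (intro tensors.tensor X.sections_mult Y.sections_mult)
    then show ?case by (simp add: mult_ac)
  next
    case (add s t)
    show ?case using tensors.add[OF add.IH] by (simp add: algebra_simps)
  qed
  show "(\<lambda>x. f x * g x) \<in> A" if f: "f \<in> A" and "g \<in> A" for f g
  proof -
    have "g \<in> tensors X Y U V" using that DA by simp
    then have "(\<lambda>x. f x * g x) \<in> tensors X Y U V"
    proof induction
      case (tensor p q)
      then show ?case using tm f DA by simp
    next
      case (add s t)
      show ?case using tensors.add[OF add.IH] by (simp add: algebra_simps)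
    qed
    then show ?thesis by (simp add: DA)
  qed
  fix E B assume "(E, B) \<in> ?A"
  then obtain U' V' where EB: "E = U' \<times> V'" "B = tensors X Y U' V'" and UV': "openin (topol X) U'" "openin (topol Y) V'"
    by auto
  let ?U = "U \<inter> U'" and ?V = "V \<inter> V'"
  have op: "openin (topol X) ?U" "openin (topol Y) ?V" using UV UV' by auto
  have mono: "tensors X Y U0 V0 \<subseteq> tensors X Y ?U ?V"
    if "openin (topol X) U0" "openin (topol Y) V0" "?U \<subseteq> U0" "?V \<subseteq> V0" for U0 V0
  proof
    fix s assume "s \<in> tensors X Y U0 V0"
    then show "s \<in> tensors X Y ?U ?V"
    proof induction
      case (tensor p q)
      then show ?case
        using X.sections_restrict[OF that(1) op(1) that(3)] Y.sections_restrict[OF that(2) op(2) that(4)]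
        by (intro tensors.tensor)
    qed (rule tensors.add)
  qed
  show "\<exists>C. (D \<inter> E, C) \<in> ?A \<and> A \<subseteq> C \<and> B \<subseteq> C"
    using mono[OF UV] mono[OF UV'] op
    by (intro exI[of _ "tensors X Y ?U ?V"]) (auto simp: DA EB Times_Int_Times)
qed

lemma function_space_product:
  assumes "function_space X" "function_space Y" shows "function_space (X \<times>\<^sub>v Y)"
  unfolding prod_space_def by (rule fraction_data.function_space_fraction[OF fraction_data_product[OF assms]])

lemma pts_product:
  assumes "function_space X" "function_space Y" shows "pts (X \<times>\<^sub>v Y) = pts X \<times> pts Y"
proof -
  let ?A = "{(U \<times> V, tensors X Y U V) | U V. openin (topol X) U \<and> openin (topol Y) V}"
  have "\<Union>(fst ` ?A) = pts X \<times> pts Y"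
  proof
    have "fst p \<subseteq> pts X \<times> pts Y" if "p \<in> ?A" for p
    proof -
      from that obtain U V where "fst p = U \<times> V" "openin (topol X) U" "openin (topol Y) V" by auto
      then show ?thesis by (simp add: Sigma_mono openin_subset)
    qed
    then show "\<Union>(fst ` ?A) \<subseteq> pts X \<times> pts Y" by (rule UN_least)
    have "(pts X \<times> pts Y, tensors X Y (pts X) (pts Y)) \<in> ?A" by blast
    from imageI[OF this, of fst] show "pts X \<times> pts Y \<subseteq> \<Union>(fst ` ?A)"
      by (intro Union_upper) simp
  qed
  then show ?thesis
    unfolding prod_space_def using fraction_data.pts_fraction[OF fraction_data_product[OF assms]] by simp
qed

lemma openin_product_Times:
  assumes "function_space X" "function_space Y" "openin (topol X) U" "openin (topol Y) V"
  shows "openin (topol (X \<times>\<^sub>v Y)) (U \<times> V)"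
  unfolding prod_space_def
  by (rule fraction_data.openin_domain[OF fraction_data_product[OF assms(1,2)], where A = "tensors X Y U V"])
    (use assms(3,4) in blast)

lemma tensor_section:
  assumes XY: "function_space X" "function_space Y" and UV: "openin (topol X) U" "openin (topol Y) V"
    and s: "s \<in> tensors X Y U V"
  shows "s \<in> sections (X \<times>\<^sub>v Y) (U \<times> V)"
  unfolding prod_space_def fraction_data.sections_iff[OF fraction_data_product[OF XY]]
proof
  let ?A = "{(U \<times> V, tensors X Y U V) | U V. openin (topol X) U \<and> openin (topol Y) V}"
  fix x assume x: "x \<in> U \<times> V"
  have mem: "(U \<times> V, tensors X Y U V) \<in> ?A" using UV by blast
  have one: "(\<lambda>_. to_ac 1) \<in> tensors X Y U V"
    by (rule fraction_data.const[OF fraction_data_product[OF XY] mem])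
  show "\<exists>D A g h. (D, A) \<in> ?A \<and> g \<in> A \<and> h \<in> A \<and> x \<in> D \<and> h x \<noteq> 0 \<and>
      (\<forall>y \<in> (U \<times> V) \<inter> D. h y \<noteq> 0 \<longrightarrow> s y = g y / h y)"
    by (rule exI[of _ "U \<times> V"], rule exI[of _ "tensors X Y U V"], rule exI[of _ s], rule exI[of _ "\<lambda>_. to_ac 1"])
      (use mem one s x in simp)
qed

lemma regular_map_fst:
  assumes XY: "function_space X" "function_space Y" shows "regular_map (X \<times>\<^sub>v Y) X fst"
  unfolding regular_map_def
proof (intro conjI allI impI)
  interpret X: function_space X by fact
  interpret Y: function_space Y by fact
  have eq: "{z \<in> pts (X \<times>\<^sub>v Y). fst z \<in> V} = V \<times> pts Y" if "openin (topol X) V" for V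
    using openin_subset[OF that] by (auto simp: pts_product[OF XY])
  show "continuous_map (topol (X \<times>\<^sub>v Y)) (topol X) fst"
    unfolding continuous_map
  proof (intro conjI allI impI)
    show "fst ` pts (X \<times>\<^sub>v Y) \<subseteq> pts X" by (auto simp: pts_product[OF XY])
  qed (simp only: eq openin_product_Times[OF XY _ openin_topspace])
  fix V g assume V: "openin (topol X) V" and g: "g \<in> sections X V"
  have "(\<lambda>z. g (fst z) * (\<lambda>_. to_ac 1) (snd z)) \<in> tensors X Y V (pts Y)"
    by (rule tensors.tensor[OF g Y.sections_const]) simp
  then show "(\<lambda>x. g (fst x)) \<in> sections (X \<times>\<^sub>v Y) {z \<in> pts (X \<times>\<^sub>v Y). fst z \<in> V}"
    unfolding eq[OF V] using tensor_section[OF XY V openin_topspace] by simp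
qed

lemma regular_map_snd:
  assumes XY: "function_space X" "function_space Y" shows "regular_map (X \<times>\<^sub>v Y) Y snd"
  unfolding regular_map_def
proof (intro conjI allI impI)
  interpret X: function_space X by fact
  interpret Y: function_space Y by fact
  have eq: "{z \<in> pts (X \<times>\<^sub>v Y). snd z \<in> V} = pts X \<times> V" if "openin (topol Y) V" for V
    using openin_subset[OF that] by (auto simp: pts_product[OF XY])
  show "continuous_map (topol (X \<times>\<^sub>v Y)) (topol Y) snd"
    unfolding continuous_map
  proof (intro conjI allI impI)
    show "snd ` pts (X \<times>\<^sub>v Y) \<subseteq> pts Y" by (auto simp: pts_product[OF XY])
  qed (simp only: eq openin_product_Times[OF XY openin_topspace])
  fix V g assume V: "openin (topol Y) V" and g: "g \<in> sections Y V"
  have "(\<lambda>z. (\<lambda>_. to_ac 1) (fst z) * g (snd z)) \<in> tensors X Y (pts X) V"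
    by (rule tensors.tensor[OF X.sections_const g]) simp
  then show "(\<lambda>x. g (snd x)) \<in> sections (X \<times>\<^sub>v Y) {z \<in> pts (X \<times>\<^sub>v Y). snd z \<in> V}"
    unfolding eq[OF V] using tensor_section[OF XY openin_topspace V] by simp
qed

lemma regular_map_Pair:
  assumes fs: "function_space Z" "function_space X" "function_space Y"
    and f: "regular_map Z X f" and g: "regular_map Z Y g"
  shows "regular_map Z (X \<times>\<^sub>v Y) (\<lambda>z. (f z, g z))"
  unfolding prod_space_def
proof (rule fraction_data.regular_map_fraction[OF fraction_data_product[OF fs(2,3)] fs(1)])
  interpret Z: function_space Z by fact
  let ?A = "{(U \<times> V, tensors X Y U V) | U V. openin (topol X) U \<and> openin (topol Y) V}"
  have mem: "(pts X \<times> pts Y, tensors X Y (pts X) (pts Y)) \<in> ?A" by blast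
  show "(f z, g z) \<in> \<Union>(fst ` ?A)" if "z \<in> pts Z" for z
    using imageI[OF mem, of fst] regular_map_pts[OF f that] regular_map_pts[OF g that]
    by (intro UnionI[of "pts X \<times> pts Y"]) simp_all
  fix D A assume "(D, A) \<in> ?A"
  then obtain U V where DA: "D = U \<times> V" "A = tensors X Y U V" and UV: "openin (topol X) U" "openin (topol Y) V"
    by auto
  have eq: "{z \<in> pts Z. (f z, g z) \<in> U \<times> V} = {z \<in> pts Z. f z \<in> U} \<inter> {z \<in> pts Z. g z \<in> V}" by auto
  have o: "openin (topol Z) {z \<in> pts Z. f z \<in> U}" "openin (topol Z) {z \<in> pts Z. g z \<in> V}"
    using regular_map_open f g UV by blast+
  then have op: "openin (topol Z) ({z \<in> pts Z. f z \<in> U} \<inter> {z \<in> pts Z. g z \<in> V})" by blast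
  show "openin (topol Z) {z \<in> pts Z. (f z, g z) \<in> D}"
    unfolding DA eq by (rule op)
  fix h assume "h \<in> A"
  then have "h \<in> tensors X Y U V" using DA by simp
  then show "(\<lambda>z. h (f z, g z)) \<in> sections Z {z \<in> pts Z. (f z, g z) \<in> D}"
    unfolding DA eq
  proof induction
    case (tensor p q)
    have "(\<lambda>z. p (f z)) \<in> sections Z ({z \<in> pts Z. f z \<in> U} \<inter> {z \<in> pts Z. g z \<in> V})"
      by (rule Z.sections_restrict[OF o(1) op _ regular_map_section[OF f UV(1) tensor(1)]]) blast
    moreover have "(\<lambda>z. q (g z)) \<in> sections Z ({z \<in> pts Z. f z \<in> U} \<inter> {z \<in> pts Z. g z \<in> V})"
      by (rule Z.sections_restrict[OF o(2) op _ regular_map_section[OF g UV(2) tensor(2)]]) blast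
    ultimately show ?case using Z.sections_mult[OF op] by simp
  next
    case (add s t)
    then show ?case using Z.sections_add[OF op] by simp
  qed
qed

lemma isomorphicI:
  assumes "regular_map X Y \<phi>" "regular_map Y X \<psi>"
    "\<And>x. x \<in> pts X \<Longrightarrow> \<psi> (\<phi> x) = x" "\<And>y. y \<in> pts Y \<Longrightarrow> \<phi> (\<psi> y) = y"
  shows "X \<cong>\<^sub>v Y"
  using assms unfolding isomorphic_def by blast

lemma isomorphicE:
  assumes "X \<cong>\<^sub>v Y"
  obtains \<phi> \<psi> where "regular_map X Y \<phi>" "regular_map Y X \<psi>"
    "\<And>x. x \<in> pts X \<Longrightarrow> \<psi> (\<phi> x) = x" "\<And>y. y \<in> pts Y \<Longrightarrow> \<phi> (\<psi> y) = y"
proof -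
  from assms obtain \<phi> \<psi> where *: "regular_map X Y \<phi>" "regular_map Y X \<psi>"
    "\<forall>x \<in> pts X. \<psi> (\<phi> x) = x" "\<forall>y \<in> pts Y. \<phi> (\<psi> y) = y"
    unfolding isomorphic_def by blast
  show thesis by (rule that[OF *(1,2)]) (use * in auto)
qed

lemma isomorphic_product:
  assumes fs: "function_space X" "function_space Y" "function_space X'" "function_space Y'"
    and "X \<cong>\<^sub>v X'" "Y \<cong>\<^sub>v Y'"
  shows "X \<times>\<^sub>v Y \<cong>\<^sub>v X' \<times>\<^sub>v Y'"
proof -
  obtain f f' where f: "regular_map X X' f" "regular_map X' X f'"
    "\<And>x. x \<in> pts X \<Longrightarrow> f' (f x) = x" "\<And>y. y \<in> pts X' \<Longrightarrow> f (f' y) = y"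
    using isomorphicE[OF assms(5)] by blast
  obtain g g' where g: "regular_map Y Y' g" "regular_map Y' Y g'"
    "\<And>x. x \<in> pts Y \<Longrightarrow> g' (g x) = x" "\<And>y. y \<in> pts Y' \<Longrightarrow> g (g' y) = y"
    using isomorphicE[OF assms(6)] by blast
  note fst = regular_map_fst[OF fs(1,2)] regular_map_fst[OF fs(3,4)]
  note snd = regular_map_snd[OF fs(1,2)] regular_map_snd[OF fs(3,4)]
  show ?thesis
  proof (rule isomorphicI)
    show "regular_map (X \<times>\<^sub>v Y) (X' \<times>\<^sub>v Y') (\<lambda>z. (f (fst z), g (snd z)))"
      using fs f g fst snd
      by (intro regular_map_Pair function_space_product regular_map_compose[OF fst(1)] regular_map_compose[OF snd(1)])
    show "regular_map (X' \<times>\<^sub>v Y') (X \<times>\<^sub>v Y) (\<lambda>z. (f' (fst z), g' (snd z)))"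
      using fs f g fst snd
      by (intro regular_map_Pair function_space_product regular_map_compose[OF fst(2)] regular_map_compose[OF snd(2)])
  qed (use f g in \<open>auto simp: pts_product fs\<close>)
qed

lemma product_commute:
  assumes fs: "function_space X" "function_space Y" shows "X \<times>\<^sub>v Y \<cong>\<^sub>v Y \<times>\<^sub>v X"
proof (rule isomorphicI)
  show "regular_map (X \<times>\<^sub>v Y) (Y \<times>\<^sub>v X) (\<lambda>z. (snd z, fst z))" "regular_map (Y \<times>\<^sub>v X) (X \<times>\<^sub>v Y) (\<lambda>z. (snd z, fst z))"
    by (intro regular_map_Pair function_space_product regular_map_fst regular_map_snd fs)+
qed auto

lemma product_assoc:
  assumes fs: "function_space X" "function_space Y" "function_space Z"
  shows "(X \<times>\<^sub>v Y) \<times>\<^sub>v Z \<cong>\<^sub>v X \<times>\<^sub>v (Y \<times>\<^sub>v Z)"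
proof -
  note fs' = function_space_product fs
  have 1: "regular_map ((X \<times>\<^sub>v Y) \<times>\<^sub>v Z) X (\<lambda>z. fst (fst z))" "regular_map ((X \<times>\<^sub>v Y) \<times>\<^sub>v Z) Y (\<lambda>z. snd (fst z))"
    using regular_map_compose[OF regular_map_fst regular_map_fst] regular_map_compose[OF regular_map_fst regular_map_snd] fs'
    by blast+
  have 2: "regular_map (X \<times>\<^sub>v (Y \<times>\<^sub>v Z)) Y (\<lambda>z. fst (snd z))" "regular_map (X \<times>\<^sub>v (Y \<times>\<^sub>v Z)) Z (\<lambda>z. snd (snd z))"
    using regular_map_compose[OF regular_map_snd regular_map_fst] regular_map_compose[OF regular_map_snd regular_map_snd] fs'
    by blast+
  show ?thesis
  proof (rule isomorphicI)
    show "regular_map ((X \<times>\<^sub>v Y) \<times>\<^sub>v Z) (X \<times>\<^sub>v (Y \<times>\<^sub>v Z)) (\<lambda>z. (fst (fst z), (snd (fst z), snd z)))"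
      by (intro regular_map_Pair 1 regular_map_snd fs')
    show "regular_map (X \<times>\<^sub>v (Y \<times>\<^sub>v Z)) ((X \<times>\<^sub>v Y) \<times>\<^sub>v Z) (\<lambda>z. ((fst z, fst (snd z)), snd (snd z)))"
      by (intro regular_map_Pair 2 regular_map_fst fs')
  qed auto
qed

lemma induced_product:
  assumes fs: "function_space X" "function_space Y"
  shows "induced (X \<times>\<^sub>v Y) (S \<times> T) \<cong>\<^sub>v induced X S \<times>\<^sub>v induced Y T"
proof -
  note fs' = function_space_product function_space_induced fs
  have 1: "regular_map (induced (X \<times>\<^sub>v Y) (S \<times> T)) (induced X S \<times>\<^sub>v induced Y T) (\<lambda>z. (fst z, snd z))"
    by (intro regular_map_Pair regular_map_into_induced fs' regular_map_compose[OF regular_map_inclusion regular_map_fst]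
        regular_map_compose[OF regular_map_inclusion regular_map_snd]) auto
  have 2: "regular_map (induced X S \<times>\<^sub>v induced Y T) (X \<times>\<^sub>v Y) (\<lambda>z. (fst z, snd z))"
    by (intro regular_map_Pair fs' regular_map_compose[OF regular_map_fst regular_map_inclusion]
        regular_map_compose[OF regular_map_snd regular_map_inclusion])
  have 3: "regular_map (induced X S \<times>\<^sub>v induced Y T) (induced (X \<times>\<^sub>v Y) (S \<times> T)) (\<lambda>z. (fst z, snd z))"
    by (rule regular_map_into_induced[OF _ 2]) (auto intro: fs' simp: pts_product[OF function_space_induced[OF fs(1)] function_space_induced[OF fs(2)]])
  show ?thesis by (rule isomorphicI[OF 1 3]) auto
qed

lemma induced_whole:
  assumes fs: "function_space X" and S: "pts X \<subseteq> S" shows "induced X S \<cong>\<^sub>v X"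
  by (rule isomorphicI[OF regular_map_inclusion[OF fs] regular_map_into_induced[OF fs regular_map_id]]) (use S in auto)

lemma isomorphic_induced:
  assumes fs: "function_space X" "function_space Y" and f: "regular_map X Y f" and g: "regular_map Y X g"
    and gf: "\<And>x. x \<in> pts X \<Longrightarrow> g (f x) = x" and fg: "\<And>y. y \<in> pts Y \<Longrightarrow> f (g y) = y"
    and ST: "\<And>x. x \<in> pts X \<Longrightarrow> f x \<in> T \<longleftrightarrow> x \<in> S"
  shows "induced X S \<cong>\<^sub>v induced Y T"
proof (rule isomorphicI)
  show "regular_map (induced X S) (induced Y T) f"
    using regular_map_into_induced[OF function_space_induced[OF fs(1)] regular_map_compose[OF regular_map_inclusion[OF fs(1)] f]] ST
    by auto
  have "g y \<in> S" if "y \<in> pts Y" "y \<in> T" for y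
    using ST[of "g y"] fg[OF that(1)] regular_map_pts[OF g that(1)] that by simp
  then show "regular_map (induced Y T) (induced X S) g"
    using regular_map_into_induced[OF function_space_induced[OF fs(2)] regular_map_compose[OF regular_map_inclusion[OF fs(2)] g]]
    by auto
qed (use gf fg in auto)

lemma function_space_affine_space: "function_space (affine_space n)"
  unfolding affine_space_def by (rule function_space_zariski)

lemma pts_affine_space [simp]: "pts (affine_space n) = {x. length x = n}"
  unfolding affine_space_def by simp

lemma polynomial_pullback:
  assumes f: "regular_map Z (zariski C S) \<phi>" and p: "p \<in> polynomials C"
  shows "(\<lambda>z. p (\<phi> z)) \<in> sections Z (pts Z)"
proof -
  have "(\<lambda>z. p (\<phi> z)) \<in> sections Z {z \<in> pts Z. \<phi> z \<in> S}"
    using regular_map_section[OF f _ polynomial_section[OF p order_refl]] openin_topspace[of "topol (zariski C S)"]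
    by (simp del: openin_topspace)
  moreover have "{z \<in> pts Z. \<phi> z \<in> S} = pts Z" using regular_map_pts[OF f] by auto
  ultimately show ?thesis by simp
qed

lemma coordinate_pullback:
  assumes "regular_map Z (affine_space n) \<phi>" "i < n"
  shows "(\<lambda>z. \<phi> z ! i) \<in> sections Z (pts Z)"
  using assms(1) unfolding affine_space_def
  by (rule polynomial_pullback) (use assms(2) in \<open>auto intro!: polynomials.coord simp: coords_def\<close>)

lemma regular_map_affine_space:
  assumes "function_space Z" "\<And>z. z \<in> pts Z \<Longrightarrow> length (\<phi> z) = n"
    and "\<And>i. i < n \<Longrightarrow> (\<lambda>z. \<phi> z ! i) \<in> sections Z (pts Z)"
  shows "regular_map Z (affine_space n) \<phi>"
  unfolding affine_space_def
  by (rule regular_map_zariski[OF assms(1)]) (use assms in \<open>auto simp: coords_def\<close>)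

lemma polynomials_substitute:
  assumes "p \<in> polynomials C" and "\<And>c. c \<in> C \<Longrightarrow> (\<lambda>z. c (\<phi> z)) \<in> polynomials C'"
  shows "(\<lambda>z. p (\<phi> z)) \<in> polynomials C'"
  using assms(1) by induction (auto intro: polynomials.intros assms(2))

lemma affine_variety_isomorphic: "X \<cong>\<^sub>v Y \<Longrightarrow> affine_variety Y \<Longrightarrow> affine_variety X"
  unfolding affine_variety_def using isomorphic_trans by blast

lemma affine_variety_product:
  fixes X :: "('k::field, 'a) fspace" and Y :: "('k, 'b) fspace"
  assumes fs: "function_space X" "function_space Y" and "affine_variety X" "affine_variety Y"
  shows "affine_variety (X \<times>\<^sub>v Y)"
proof -
  obtain n P where P: "P \<subseteq> polynomials (coords n)" and X: "X \<cong>\<^sub>v induced (affine_space n) (zero_set n P)"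
    using assms(3) unfolding affine_variety_def by blast
  obtain m Q where Q: "Q \<subseteq> polynomials (coords m)" and Y: "Y \<cong>\<^sub>v induced (affine_space m) (zero_set m Q)"
    using assms(4) unfolding affine_variety_def by blast
  let ?A = "induced (affine_space n) (zero_set n P)" and ?B = "induced (affine_space m) (zero_set m Q)"
  let ?d = "\<lambda>z. map (\<lambda>i. z ! (n + i)) [0..<m]"
  define R where "R = (\<lambda>p z. p (take n z)) ` P \<union> (\<lambda>q z. q (?d z)) ` Q"
  let ?C = "induced (affine_space (n + m)) (zero_set (n + m) R)"
  have d: "?d z = drop n z" if "length z = n + m" for z :: "'k alg_closure list"
    using that by (intro nth_equalityI) auto
  have coordI: "(\<lambda>z. z ! i) \<in> polynomials (coords k :: ('k alg_closure list \<Rightarrow> 'k alg_closure) set)" if "i < k" for i k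
    using that by (intro polynomials.coord) (auto simp: coords_def)
  have "(\<lambda>z. p (take n z)) \<in> polynomials (coords (n + m))" if "p \<in> polynomials (coords n)"
    for p :: "'k alg_closure list \<Rightarrow> 'k alg_closure"
  proof (rule polynomials_substitute[where \<phi> = "take n", OF that])
    fix c :: "'k alg_closure list \<Rightarrow> _" assume "c \<in> coords n"
    then obtain i where "i < n" "c = (\<lambda>x. x ! i)" by (auto simp: coords_def)
    then show "(\<lambda>z. c (take n z)) \<in> polynomials (coords (n + m))" using coordI[of i "n + m"] by simp
  qed
  moreover have "(\<lambda>z. q (?d z)) \<in> polynomials (coords (n + m))" if "q \<in> polynomials (coords m)"
    for q :: "'k alg_closure list \<Rightarrow> 'k alg_closure"
  proof (rule polynomials_substitute[where \<phi> = ?d, OF that])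
    fix c :: "'k alg_closure list \<Rightarrow> _" assume "c \<in> coords m"
    then obtain i where "i < m" "c = (\<lambda>x. x ! i)" by (auto simp: coords_def)
    then show "(\<lambda>z. c (?d z)) \<in> polynomials (coords (n + m))" using coordI[of "n + i" "n + m"] by simp
  qed
  ultimately have R: "R \<subseteq> polynomials (coords (n + m))"
    unfolding R_def using P Q by blast
  note fs' = function_space_induced function_space_affine_space function_space_product
  have A: "regular_map (?A \<times>\<^sub>v ?B) (affine_space n) fst"
    by (intro regular_map_compose[OF regular_map_fst regular_map_inclusion] fs')
  have B: "regular_map (?A \<times>\<^sub>v ?B) (affine_space m) snd"
    by (intro regular_map_compose[OF regular_map_snd regular_map_inclusion] fs')
  have AB: "length (fst z) = n" "length (snd z) = m" if "z \<in> pts (?A \<times>\<^sub>v ?B)" for z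
    using that regular_map_pts[OF A that] regular_map_pts[OF B that] by auto
  interpret AB: function_space "?A \<times>\<^sub>v ?B" by (intro fs')
  have 1: "regular_map (?A \<times>\<^sub>v ?B) (affine_space (n + m)) (\<lambda>z. fst z @ snd z)"
    unfolding affine_space_def[of "n + m"]
  proof (rule regular_map_zariski)
    show "function_space (?A \<times>\<^sub>v ?B)" by (intro fs')
    show "fst z @ snd z \<in> {x. length x = n + m}" if "z \<in> pts (?A \<times>\<^sub>v ?B)" for z
      using AB[OF that] by simp
    fix c :: "'k alg_closure list \<Rightarrow> _" assume "c \<in> coords (n + m)"
    then obtain i where i: "i < n + m" "c = (\<lambda>x. x ! i)" by (auto simp: coords_def)
    show "(\<lambda>z. c (fst z @ snd z)) \<in> sections (?A \<times>\<^sub>v ?B) (pts (?A \<times>\<^sub>v ?B))"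
    proof (cases "i < n")
      case True
      have "(\<lambda>z. fst z ! i) \<in> sections (?A \<times>\<^sub>v ?B) (pts (?A \<times>\<^sub>v ?B))"
        by (rule coordinate_pullback[OF A True])
      then show ?thesis
        by (rule AB.sections_cong[OF openin_topspace]) (use AB True in \<open>simp add: i nth_append\<close>)
    next
      case False
      then have "i - n < m" using i by simp
      have "(\<lambda>z. snd z ! (i - n)) \<in> sections (?A \<times>\<^sub>v ?B) (pts (?A \<times>\<^sub>v ?B))"
        by (rule coordinate_pullback[OF B \<open>i - n < m\<close>])
      then show ?thesis
        by (rule AB.sections_cong[OF openin_topspace]) (use AB False in \<open>simp add: i nth_append\<close>)
    qed
  qed
  have zero: "fst z \<in> zero_set n P" "snd z \<in> zero_set m Q" if "z \<in> pts (?A \<times>\<^sub>v ?B)" for z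
    using that by (auto simp: pts_product fs')
  have fwd: "regular_map (?A \<times>\<^sub>v ?B) ?C (\<lambda>z. fst z @ snd z)"
  proof (rule regular_map_into_induced[OF _ 1])
    show "function_space (?A \<times>\<^sub>v ?B)" by (intro fs')
    fix z assume z: "z \<in> pts (?A \<times>\<^sub>v ?B)"
    have "?d (fst z @ snd z) = snd z" using d[of "fst z @ snd z"] AB[OF z] by simp
    then show "fst z @ snd z \<in> zero_set (n + m) R"
      using zero[OF z] AB[OF z] by (auto simp: zero_set_def R_def)
  qed
  have len: "length z = n + m" if "z \<in> pts ?C" for z using that by simp
  have tk: "regular_map (affine_space (n + m)) (affine_space n) (take n :: 'k alg_closure list \<Rightarrow> _)"
    by (rule regular_map_affine_space[OF function_space_affine_space])
      (use coordinate_pullback[OF regular_map_id, of _ "n + m", where 'a = 'k] in auto)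
  have dr: "regular_map (affine_space (n + m)) (affine_space m) (?d :: 'k alg_closure list \<Rightarrow> _)"
    by (rule regular_map_affine_space[OF function_space_affine_space])
      (use coordinate_pullback[OF regular_map_id, of _ "n + m", where 'a = 'k] in auto)
  have zC: "take n z \<in> zero_set n P" "?d z \<in> zero_set m Q" if "z \<in> pts ?C" for z
    using that by (auto simp: zero_set_def R_def)
  have bA: "regular_map ?C ?A (take n)"
    by (rule regular_map_into_induced[OF _ regular_map_compose[OF regular_map_inclusion tk]]) (use zC in \<open>auto intro: fs'\<close>)
  have bB: "regular_map ?C ?B ?d"
    by (rule regular_map_into_induced[OF _ regular_map_compose[OF regular_map_inclusion dr]]) (use zC in \<open>auto intro: fs'\<close>)
  have bwd: "regular_map ?C (?A \<times>\<^sub>v ?B) (\<lambda>z. (take n z, ?d z))"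
    by (intro regular_map_Pair fs' bA bB)
  have "?A \<times>\<^sub>v ?B \<cong>\<^sub>v ?C"
  proof (rule isomorphicI[OF fwd bwd])
    show "(take n (fst z @ snd z), ?d (fst z @ snd z)) = z" if "z \<in> pts (?A \<times>\<^sub>v ?B)" for z
      using AB[OF that] d[of "fst z @ snd z"] by simp
    show "fst (take n z, ?d z) @ snd (take n z, ?d z) = z" if "z \<in> pts ?C" for z
      using d[OF len[OF that]] by simp
  qed
  then have "affine_variety (?A \<times>\<^sub>v ?B)" unfolding affine_variety_def using R by blast
  then show ?thesis
    by (rule affine_variety_isomorphic[rotated]) (intro isomorphic_product fs fs' X Y)
qed

lemma variety_function_space: "variety X \<Longrightarrow> function_space X"
  by (simp add: variety_def)

lemma variety_separated: "variety X \<Longrightarrow> closedin (topol (X \<times>\<^sub>v X)) {(x, x) | x. x \<in> pts X}"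
  by (simp add: variety_def)

lemma regular_map_closed:
  "regular_map X Y \<phi> \<Longrightarrow> closedin (topol Y) C \<Longrightarrow> closedin (topol X) {x \<in> pts X. \<phi> x \<in> C}"
  unfolding regular_map_def by (elim conjE) (rule closedin_continuous_map_preimage)

lemma variety_product:
  assumes "variety X" "variety Y" shows "variety (X \<times>\<^sub>v Y)"
  unfolding variety_def
proof (intro conjI)
  note fsX = variety_function_space[OF assms(1)] and fsY = variety_function_space[OF assms(2)]
  show fs: "function_space (X \<times>\<^sub>v Y)" by (rule function_space_product[OF fsX fsY])
  obtain \<U> where U: "finite \<U>" "\<Union>\<U> = pts X" "\<And>U. U \<in> \<U> \<Longrightarrow> openin (topol X) U \<and> affine_variety (induced X U)"
    using assms(1) unfolding variety_def by blast
  obtain \<V> where V: "finite \<V>" "\<Union>\<V> = pts Y" "\<And>V. V \<in> \<V> \<Longrightarrow> openin (topol Y) V \<and> affine_variety (induced Y V)"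
    using assms(2) unfolding variety_def by blast
  let ?W = "(\<lambda>(U, V). U \<times> V) ` (\<U> \<times> \<V>)"
  show "\<exists>\<W>. finite \<W> \<and> \<Union>\<W> = pts (X \<times>\<^sub>v Y) \<and>
      (\<forall>W \<in> \<W>. openin (topol (X \<times>\<^sub>v Y)) W \<and> affine_variety (induced (X \<times>\<^sub>v Y) W))"
  proof (intro exI conjI ballI)
    show "finite ?W" using U V by simp
    show "\<Union>?W = pts (X \<times>\<^sub>v Y)"
      unfolding pts_product[OF fsX fsY] U(2)[symmetric] V(2)[symmetric] by auto
    fix W assume "W \<in> ?W"
    then obtain A B where W: "W = A \<times> B" "A \<in> \<U>" "B \<in> \<V>" by auto
    show "openin (topol (X \<times>\<^sub>v Y)) W" using W U V openin_product_Times[OF fsX fsY] by simp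
    show "affine_variety (induced (X \<times>\<^sub>v Y) W)"
      unfolding W(1)
      by (rule affine_variety_isomorphic[OF induced_product[OF fsX fsY] affine_variety_product])
        (use W U V function_space_induced fsX fsY in auto)
  qed
  let ?P = "X \<times>\<^sub>v Y"
  let ?a = "\<lambda>z. (fst (fst z), fst (snd z))" and ?b = "\<lambda>z. (snd (fst z), snd (snd z))"
  note fs' = fs fsX fsY function_space_product
  have a: "regular_map (?P \<times>\<^sub>v ?P) (X \<times>\<^sub>v X) ?a"
    by (intro regular_map_Pair fs' regular_map_compose[OF regular_map_fst[OF fs fs] regular_map_fst]
        regular_map_compose[OF regular_map_snd[OF fs fs] regular_map_fst])
  have b: "regular_map (?P \<times>\<^sub>v ?P) (Y \<times>\<^sub>v Y) ?b"
    by (intro regular_map_Pair fs' regular_map_compose[OF regular_map_fst[OF fs fs] regular_map_snd]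
        regular_map_compose[OF regular_map_snd[OF fs fs] regular_map_snd])
  have cl: "closedin (topol (?P \<times>\<^sub>v ?P)) {z \<in> pts (?P \<times>\<^sub>v ?P). ?a z \<in> {(x, x) | x. x \<in> pts X}}"
    "closedin (topol (?P \<times>\<^sub>v ?P)) {z \<in> pts (?P \<times>\<^sub>v ?P). ?b z \<in> {(x, x) | x. x \<in> pts Y}}"
    using regular_map_closed[OF a variety_separated[OF assms(1)]] regular_map_closed[OF b variety_separated[OF assms(2)]]
    by simp_all
  have "{(x, x) | x. x \<in> pts ?P} = {z \<in> pts (?P \<times>\<^sub>v ?P). ?a z \<in> {(x, x) | x. x \<in> pts X}} \<inter>
      {z \<in> pts (?P \<times>\<^sub>v ?P). ?b z \<in> {(x, x) | x. x \<in> pts Y}}"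
    by (auto simp: pts_product fs')
  then show "closedin (topol (?P \<times>\<^sub>v ?P)) {(x, x) | x. x \<in> pts ?P}"
    using closedin_Int[OF cl] by simp
qed

lemma variety_isomorphic:
  assumes "X \<cong>\<^sub>v Y" "variety X" and fsY: "function_space Y" shows "variety Y"
  unfolding variety_def
proof (intro conjI)
  note fsX = variety_function_space[OF assms(2)]
  obtain f g where f: "regular_map X Y f" and g: "regular_map Y X g"
    and gf: "\<And>x. x \<in> pts X \<Longrightarrow> g (f x) = x" and fg: "\<And>y. y \<in> pts Y \<Longrightarrow> f (g y) = y"
    using isomorphicE[OF assms(1)] by blast
  show "function_space Y" by fact
  obtain \<U> where U: "finite \<U>" "\<Union>\<U> = pts X" "\<And>U. U \<in> \<U> \<Longrightarrow> openin (topol X) U \<and> affine_variety (induced X U)"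
    using assms(2) unfolding variety_def by blast
  show "\<exists>\<V>. finite \<V> \<and> \<Union>\<V> = pts Y \<and> (\<forall>V \<in> \<V>. openin (topol Y) V \<and> affine_variety (induced Y V))"
  proof (intro exI conjI ballI)
    let ?V = "(\<lambda>U. {y \<in> pts Y. g y \<in> U}) ` \<U>"
    show "finite ?V" using U by simp
    have "y \<in> \<Union>?V" if "y \<in> pts Y" for y
      using regular_map_pts[OF g that] that unfolding U(2)[symmetric] by blast
    then show "\<Union>?V = pts Y" by blast
    fix V assume "V \<in> ?V"
    then obtain U0 where V: "V = {y \<in> pts Y. g y \<in> U0}" "U0 \<in> \<U>" by auto
    show "openin (topol Y) V" unfolding V(1) using regular_map_open[OF g] U(3)[OF V(2)] by blast
    have "f y \<in> V \<longleftrightarrow> y \<in> U0" if "y \<in> pts X" for y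
      using that gf[OF that] regular_map_pts[OF f that] V(1) by auto
    with isomorphic_induced[OF fsX fsY f g gf fg] have "induced X U0 \<cong>\<^sub>v induced Y V"
      by blast
    then show "affine_variety (induced Y V)"
      using affine_variety_isomorphic isomorphic_sym U(3)[OF V(2)] by blast
  qed
  let ?a = "\<lambda>z. (g (fst z), g (snd z))"
  have a: "regular_map (Y \<times>\<^sub>v Y) (X \<times>\<^sub>v X) ?a"
    by (intro regular_map_Pair fsX fsY function_space_product regular_map_compose[OF regular_map_fst[OF fsY fsY] g]
        regular_map_compose[OF regular_map_snd[OF fsY fsY] g])
  have cl: "closedin (topol (Y \<times>\<^sub>v Y)) {z \<in> pts (Y \<times>\<^sub>v Y). ?a z \<in> {(x, x) | x. x \<in> pts X}}"
    using regular_map_closed[OF a variety_separated[OF assms(2)]] .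
  have "x = y" if "x \<in> pts Y" "y \<in> pts Y" "g x = g y" for x y
    using arg_cong[OF that(3), of f] unfolding fg[OF that(1)] fg[OF that(2)] .
  then have "{z \<in> pts (Y \<times>\<^sub>v Y). ?a z \<in> {(x, x) | x. x \<in> pts X}} = {(x, x) | x. x \<in> pts Y}"
    using regular_map_pts[OF g] by (auto simp: pts_product fsY)
  with cl show "closedin (topol (Y \<times>\<^sub>v Y)) {(x, x) | x. x \<in> pts Y}" by simp
qed

lemma variety_point: "variety (affine_space 0 :: ('k::field, 'k alg_closure list) fspace)"
  unfolding variety_def
proof (intro conjI)
  let ?X = "affine_space 0 :: ('k, 'k alg_closure list) fspace"
  show fs: "function_space ?X" by (rule function_space_affine_space)
  have "affine_variety (induced ?X {[]})"
    unfolding affine_variety_def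
    by (intro exI[of _ 0] exI[of _ "{}"]) (simp add: isomorphic_refl zero_set_def)
  moreover have "openin (topol ?X) {[]}"
    using openin_topspace[of "topol ?X"] by (simp del: openin_topspace)
  ultimately show "\<exists>\<U>. finite \<U> \<and> \<Union>\<U> = pts ?X \<and> (\<forall>U \<in> \<U>. openin (topol ?X) U \<and> affine_variety (induced ?X U))"
    by (intro exI[of _ "{{[]}}"]) simp
  have "{(x, x) | x. x \<in> pts ?X} = pts (?X \<times>\<^sub>v ?X)" by (auto simp: pts_product fs)
  then show "closedin (topol (?X \<times>\<^sub>v ?X)) {(x, x) | x. x \<in> pts ?X}" by simp
qed

lemma product_point:
  assumes fs: "function_space X" shows "affine_space 0 \<times>\<^sub>v X \<cong>\<^sub>v X"
proof (rule isomorphicI)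
  show "regular_map (affine_space 0 \<times>\<^sub>v X) X snd" by (intro regular_map_snd function_space_affine_space fs)
  have "regular_map X (affine_space 0) (\<lambda>_. [])"
    unfolding affine_space_def by (rule regular_map_zariski[OF fs]) (auto simp: coords_def)
  then show "regular_map X (affine_space 0 \<times>\<^sub>v X) (\<lambda>x. ([], x))"
    by (intro regular_map_Pair function_space_affine_space fs regular_map_id)
qed (auto simp: pts_product fs function_space_affine_space)

definition transport :: "('a \<Rightarrow> 'b) \<Rightarrow> ('k::field, 'a) fspace \<Rightarrow> ('k, 'b) fspace" where
  "transport e X = \<lparr>
     topol = pullback_topology (e ` pts X) (inv_into (pts X) e) (topol X),
     sections = (\<lambda>U. {f. (\<lambda>x. f (e x)) \<in> sections X {x \<in> pts X. e x \<in> U}})\<rparr>"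

lemma openin_transport:
  assumes e: "inj_on e (pts X)"
  shows "openin (topol (transport e X)) U \<longleftrightarrow> U \<subseteq> e ` pts X \<and> openin (topol X) {x \<in> pts X. e x \<in> U}"
proof -
  let ?i = "inv_into (pts X) e"
  have 1: "{x \<in> pts X. e x \<in> ?i -` V \<inter> e ` pts X} = V" if "openin (topol X) V" for V
    using openin_subset[OF that] by (auto simp: e dest: inj_onD[OF e])
  have 2: "U = ?i -` {x \<in> pts X. e x \<in> U} \<inter> e ` pts X" if "U \<subseteq> e ` pts X"
    using that by (auto simp: e)
  show ?thesis
  proof
    assume "openin (topol (transport e X)) U"
    then obtain V where "openin (topol X) V" "U = ?i -` V \<inter> e ` pts X"
      by (auto simp: transport_def openin_pullback_topology)
    then show "U \<subseteq> e ` pts X \<and> openin (topol X) {x \<in> pts X. e x \<in> U}" using 1 by simp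
  next
    assume "U \<subseteq> e ` pts X \<and> openin (topol X) {x \<in> pts X. e x \<in> U}"
    then show "openin (topol (transport e X)) U"
      using 2 unfolding transport_def openin_pullback_topology fspace.select_convs by blast
  qed
qed

lemma sections_transport:
  "f \<in> sections (transport e X) U \<longleftrightarrow> (\<lambda>x. f (e x)) \<in> sections X {x \<in> pts X. e x \<in> U}"
  by (simp only: transport_def fspace.select_convs mem_Collect_eq)

lemma pts_transport: "inj_on e (pts X) \<Longrightarrow> pts (transport e X) = e ` pts X"
  by (auto simp: transport_def topspace_pullback_topology)

lemma function_space_transport:
  assumes e: "inj_on e (pts X)" and "function_space X" shows "function_space (transport e X)"
proof -
  interpret X: function_space X by fact
  let ?T = "transport e X" and ?p = "\<lambda>U. {x \<in> pts X. e x \<in> U}"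
  show ?thesis
  proof
    fix U assume U: "openin (topol ?T) U"
    then have oU: "openin (topol X) (?p U)" and sU: "U \<subseteq> e ` pts X" by (simp_all add: openin_transport[OF e])
    show "g \<in> sections ?T U" if "f \<in> sections ?T U" "\<And>x. x \<in> U \<Longrightarrow> g x = f x" for f g
      using that X.sections_cong[OF oU] unfolding sections_transport by simp
    show "f \<in> sections ?T V" if "openin (topol ?T) V" "V \<subseteq> U" "f \<in> sections ?T U" for V f
    proof -
      have "openin (topol X) (?p V)" "?p V \<subseteq> ?p U" using that by (auto simp: openin_transport[OF e])
      then show ?thesis using X.sections_restrict[OF oU] that(3) unfolding sections_transport by blast
    qed
    show "f \<in> sections ?T U"
      if *: "\<And>x. x \<in> U \<Longrightarrow> \<exists>V. openin (topol ?T) V \<and> x \<in> V \<and> V \<subseteq> U \<and> f \<in> sections ?T V" for f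
      unfolding sections_transport
    proof (rule X.sections_glue[OF oU])
      fix x assume "x \<in> ?p U"
      then have "x \<in> pts X" "e x \<in> U" by auto
      then obtain V where V: "openin (topol ?T) V" "e x \<in> V" "V \<subseteq> U" "f \<in> sections ?T V"
        using * by blast
      show "\<exists>V. openin (topol X) V \<and> x \<in> V \<and> V \<subseteq> ?p U \<and> (\<lambda>x. f (e x)) \<in> sections X V"
      proof (intro exI conjI)
        show "openin (topol X) (?p V)" using V by (simp add: openin_transport[OF e])
        show "(\<lambda>x. f (e x)) \<in> sections X (?p V)" using V by (simp add: sections_transport)
      qed (use V \<open>x \<in> pts X\<close> in auto)
    qed
    show "(\<lambda>_. to_ac c) \<in> sections ?T U" for c
      unfolding sections_transport by (rule X.sections_const[OF oU])
    fix f assume f: "f \<in> sections ?T U"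
    show "(\<lambda>x. f x + g x) \<in> sections ?T U" "(\<lambda>x. f x * g x) \<in> sections ?T U" if "g \<in> sections ?T U" for g
      using f that X.sections_add[OF oU] X.sections_mult[OF oU] unfolding sections_transport by blast+
    have eq: "?p {x \<in> U. f x \<noteq> 0} = {x \<in> ?p U. f (e x) \<noteq> 0}" by auto
    show "openin (topol ?T) {x \<in> U. f x \<noteq> 0}"
      using X.openin_nonzero[OF oU f[unfolded sections_transport]] sU
      unfolding openin_transport[OF e] eq by blast
    show "(\<lambda>x. inverse (f x)) \<in> sections ?T {x \<in> U. f x \<noteq> 0}"
      unfolding sections_transport eq by (rule X.sections_inverse[OF oU f[unfolded sections_transport]])
  qed
qed

lemma isomorphic_transport:
  assumes e: "inj_on e (pts X)" and "function_space X" shows "X \<cong>\<^sub>v transport e X"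
proof -
  interpret X: function_space X by fact
  let ?T = "transport e X" and ?i = "inv_into (pts X) e"
  have "regular_map X ?T e"
    unfolding regular_map_def continuous_map
    by (auto simp: pts_transport[OF e] openin_transport[OF e] sections_transport)
  moreover have "regular_map ?T X ?i"
    unfolding regular_map_def continuous_map
  proof (intro conjI allI impI)
    show "?i ` pts ?T \<subseteq> pts X" by (auto simp: pts_transport[OF e] e)
    fix V assume V: "openin (topol X) V"
    have eq: "{x \<in> pts X. e x \<in> {y \<in> pts ?T. ?i y \<in> V}} = V"
      using openin_subset[OF V] by (auto simp: pts_transport[OF e] e dest: inj_onD[OF e])
    show "openin (topol ?T) {y \<in> pts ?T. ?i y \<in> V}"
      unfolding openin_transport[OF e] eq using V by (auto simp: pts_transport[OF e])
    fix g assume "g \<in> sections X V"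
    then show "(\<lambda>y. g (?i y)) \<in> sections ?T {y \<in> pts ?T. ?i y \<in> V}"
      unfolding sections_transport eq by (rule X.sections_cong[OF V]) (use openin_subset[OF V] e in auto)
  qed
  ultimately show ?thesis
    by (rule isomorphicI) (auto simp: pts_transport[OF e] e)
qed

text \<open>
  Points of type \<open>'k alg_closure list\<close> suffice for all isomorphism classes of varieties: \<open>X\<close> is covered by finitely
  many affine charts, and the algebraic closure is infinite. The injection \<open>encode\<close> keeps products inside this type.
\<close>

fun encode :: "'k::field alg_closure list \<times> 'k alg_closure list \<Rightarrow> 'k alg_closure list" where
  "encode (xs, ys) = replicate (length xs) 1 @ 0 # xs @ ys"

lemma inj_encode: "inj encode"
proof (rule injI)
  have tw: "length (takeWhile (\<lambda>x. x = 1) (encode z)) = length (fst z)" for z :: "'k::field alg_closure list \<times> 'k alg_closure list"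
    by (cases z) (simp add: takeWhile_append)
  fix z w :: "'k::field alg_closure list \<times> 'k alg_closure list" assume eq: "encode z = encode w"
  then have "length (fst z) = length (fst w)" using tw by metis
  with eq show "z = w" by (cases z; cases w) simp
qed


section \<open>The Grothendieck ring of varieties\<close>

typedef (overloaded) 'k variety = "{X :: ('k::field, 'k alg_closure list) fspace. variety X}"
  morphisms space_of Variety
  using variety_point by blast

setup_lifting type_definition_variety

lemma variety_space_of: "variety (space_of X)"
  using space_of[of X] by simp

lemma function_space_space_of: "function_space (space_of X)"
  by (rule variety_function_space[OF variety_space_of])

quotient_type (overloaded) 'k iso_class = "'k::field variety" / "\<lambda>X Y. space_of X \<cong>\<^sub>v space_of Y"
  by (rule equivpI) (auto intro: reflpI sympI transpI isomorphic_refl isomorphic_sym isomorphic_trans)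

definition product_list :: "('k::field, 'k alg_closure list) fspace \<Rightarrow> ('k, 'k alg_closure list) fspace \<Rightarrow> ('k, 'k alg_closure list) fspace" where
  "product_list X Y = transport encode (X \<times>\<^sub>v Y)"

lemma isomorphic_product_list:
  assumes "function_space X" "function_space Y" shows "X \<times>\<^sub>v Y \<cong>\<^sub>v product_list X Y"
  unfolding product_list_def
  by (rule isomorphic_transport[OF inj_on_subset[OF inj_encode subset_UNIV] function_space_product[OF assms]])

lemma variety_product_list:
  assumes "variety X" "variety Y" shows "variety (product_list X Y)"
proof (rule variety_isomorphic[OF isomorphic_product_list variety_product[OF assms]])
  show "function_space (product_list X Y)"
    unfolding product_list_def using assms
    by (intro function_space_transport inj_on_subset[OF inj_encode subset_UNIV] function_space_product variety_function_space)
qed (use assms variety_function_space in auto)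

lift_definition product_variety :: "'k::field variety \<Rightarrow> 'k variety \<Rightarrow> 'k variety" is product_list
  by (rule variety_product_list)

lift_definition point_variety :: "'k::field variety" is "affine_space 0"
  by (rule variety_point)

lemma product_variety: "space_of X \<times>\<^sub>v space_of Y \<cong>\<^sub>v space_of (product_variety X Y)"
  by (simp add: product_variety.rep_eq isomorphic_product_list function_space_space_of)

lemma product_variety_cong:
  assumes "space_of X \<cong>\<^sub>v space_of X'" "space_of Y \<cong>\<^sub>v space_of Y'"
  shows "space_of (product_variety X Y) \<cong>\<^sub>v space_of (product_variety X' Y')"
  using isomorphic_trans[OF isomorphic_sym[OF product_variety] isomorphic_trans[OF isomorphic_product product_variety]]
    assms function_space_space_of by blast

text \<open>
  The commutative monoid of isomorphism classes under the product of varieties is written additively, because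
  this is what turns the free abelian group \<open>'k iso_class \<Rightarrow>\<^sub>0 int\<close> into its monoid ring in
  \<^theory>\<open>HOL-Library.Poly_Mapping\<close>: there \<open>frag_of [X] * frag_of [Y] = frag_of [X \<times> Y]\<close>, and \<open>1 = frag_of [Spec k]\<close>.
\<close>

instantiation iso_class :: (field) comm_monoid_add
begin

lift_definition zero_iso_class :: "'a iso_class" is point_variety .

lift_definition plus_iso_class :: "'a iso_class \<Rightarrow> 'a iso_class \<Rightarrow> 'a iso_class" is product_variety
  by (rule product_variety_cong)

instance
proof
  note fs = function_space_space_of function_space_product
  show "a + b + c = a + (b + c)" for a b c :: "'a iso_class"
  proof transfer
    fix X Y Z :: "'a variety"
    have "space_of (product_variety (product_variety X Y) Z) \<cong>\<^sub>v (space_of X \<times>\<^sub>v space_of Y) \<times>\<^sub>v space_of Z"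
      by (intro isomorphic_trans[OF isomorphic_sym[OF product_variety]] isomorphic_product fs
          isomorphic_sym[OF product_variety] isomorphic_refl)
    moreover have "space_of X \<times>\<^sub>v (space_of Y \<times>\<^sub>v space_of Z) \<cong>\<^sub>v space_of (product_variety X (product_variety Y Z))"
      by (intro isomorphic_trans[OF _ product_variety] isomorphic_product fs product_variety isomorphic_refl)
    ultimately show "space_of (product_variety (product_variety X Y) Z) \<cong>\<^sub>v space_of (product_variety X (product_variety Y Z))"
      by (rule isomorphic_trans[OF _ isomorphic_trans[OF product_assoc[OF fs(1) fs(1) fs(1)]]])
  qed
  show "a + b = b + a" for a b :: "'a iso_class"
    by transfer (rule isomorphic_trans[OF isomorphic_sym[OF product_variety] isomorphic_trans[OF product_commute[OF fs(1) fs(1)] product_variety]])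
  show "0 + a = a" for a :: "'a iso_class"
  proof transfer
    fix X :: "'a variety"
    have "space_of point_variety \<times>\<^sub>v space_of X \<cong>\<^sub>v space_of X"
      unfolding point_variety.rep_eq by (rule product_point[OF fs(1)])
    then show "space_of (product_variety point_variety X) \<cong>\<^sub>v space_of X"
      by (rule isomorphic_trans[OF isomorphic_sym[OF product_variety]])
  qed
qed

end

text \<open>The subgroup generated by the scissor relations; it is an ideal by \<open>scissor_relations_mult\<close>.\<close>

inductive_set scissor_relations :: "('k::field iso_class \<Rightarrow>\<^sub>0 int) set" where
  scissor: "closedin (topol (space_of X)) C \<Longrightarrow>
     space_of Z \<cong>\<^sub>v induced (space_of X) C \<Longrightarrow> space_of U \<cong>\<^sub>v induced (space_of X) (pts (space_of X) - C) \<Longrightarrow>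
     frag_of (abs_iso_class X) - (frag_of (abs_iso_class Z) + frag_of (abs_iso_class U)) \<in> scissor_relations"
| zero: "0 \<in> scissor_relations"
| diff: "a \<in> scissor_relations \<Longrightarrow> b \<in> scissor_relations \<Longrightarrow> a - b \<in> scissor_relations"

lemma frag_of_mult: "frag_of a * frag_of b = frag_of (a + b)"
  by (simp add: mult_single)

lemma scissor_relations_mult:
  assumes "a \<in> scissor_relations" shows "a * b \<in> scissor_relations"
  using assms
proof induction
  case (scissor X C Z U)
  have "Poly_Mapping.keys b \<subseteq> UNIV" by simp
  then show ?case
  proof (induction b rule: frag_induction)
    case zero
    then show ?case by (simp add: scissor_relations.zero)
  next
    case (one y)
    obtain Y where y: "y = abs_iso_class Y" using Quotient_abs_rep[OF Quotient_iso_class, of y] by metis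
    have abs_prod: "abs_iso_class V + abs_iso_class Y = abs_iso_class (product_variety V Y)" for V
      by (rule plus_iso_class.abs_eq)
    let ?X = "space_of X" and ?Y = "space_of Y"
    note fs = function_space_space_of function_space_induced function_space_product
    obtain f g where f: "regular_map (?X \<times>\<^sub>v ?Y) (space_of (product_variety X Y)) f"
      and g: "regular_map (space_of (product_variety X Y)) (?X \<times>\<^sub>v ?Y) g"
      and gf: "\<And>x. x \<in> pts (?X \<times>\<^sub>v ?Y) \<Longrightarrow> g (f x) = x"
      and fg: "\<And>y. y \<in> pts (space_of (product_variety X Y)) \<Longrightarrow> f (g y) = y"
      using isomorphicE[OF product_variety[of X Y]] by blast
    let ?P = "space_of (product_variety X Y)"
    define D where "D = {z \<in> pts ?P. g z \<in> {w \<in> pts (?X \<times>\<^sub>v ?Y). fst w \<in> C}}"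
    have closed: "closedin (topol ?P) D"
      unfolding D_def by (intro regular_map_closed[OF g] regular_map_closed[OF regular_map_fst] fs scissor)
    have piece: "space_of (product_variety V Y) \<cong>\<^sub>v induced ?P E"
      if V: "space_of V \<cong>\<^sub>v induced ?X S" and E: "\<And>x. x \<in> pts (?X \<times>\<^sub>v ?Y) \<Longrightarrow> f x \<in> E \<longleftrightarrow> x \<in> S \<times> pts ?Y" for V S E
    proof -
      have 1: "space_of V \<times>\<^sub>v ?Y \<cong>\<^sub>v induced ?X S \<times>\<^sub>v induced ?Y (pts ?Y)"
        by (intro isomorphic_product fs V isomorphic_sym[OF induced_whole]) simp
      have 2: "induced ?X S \<times>\<^sub>v induced ?Y (pts ?Y) \<cong>\<^sub>v induced (?X \<times>\<^sub>v ?Y) (S \<times> pts ?Y)"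
        by (intro isomorphic_sym[OF induced_product] fs)
      have 3: "induced (?X \<times>\<^sub>v ?Y) (S \<times> pts ?Y) \<cong>\<^sub>v induced ?P E"
        by (rule isomorphic_induced[OF _ _ f g gf fg E]) (intro fs)+
      show ?thesis
        by (rule isomorphic_trans[OF isomorphic_sym[OF product_variety]
              isomorphic_trans[OF 1 isomorphic_trans[OF 2 3]]])
    qed
    have fD: "f x \<in> D \<longleftrightarrow> x \<in> C \<times> pts ?Y" if "x \<in> pts (?X \<times>\<^sub>v ?Y)" for x
      unfolding D_def using gf[OF that] regular_map_pts[OF f that] that
      by (cases x) (auto simp: pts_product function_space_space_of)
    have "f x \<in> pts ?P - D \<longleftrightarrow> x \<in> (pts ?X - C) \<times> pts ?Y" if "x \<in> pts (?X \<times>\<^sub>v ?Y)" for x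
      using fD[OF that] regular_map_pts[OF f that] that
      by (cases x) (auto simp: pts_product function_space_space_of)
    from scissor_relations.scissor[OF closed piece[OF scissor(2) fD] piece[OF scissor(3) this]]
    show ?case
      by (simp add: y left_diff_distrib distrib_right frag_of_mult abs_prod)
  next
    case (diff a b)
    then show ?case by (simp add: right_diff_distrib scissor_relations.diff)
  qed
qed (auto simp: left_diff_distrib intro: scissor_relations.intros)

lemma scissor_relations_uminus: "a \<in> scissor_relations \<Longrightarrow> - a \<in> scissor_relations"
  using scissor_relations.diff[OF scissor_relations.zero, of a] by simp

lemma scissor_relations_add: "a \<in> scissor_relations \<Longrightarrow> b \<in> scissor_relations \<Longrightarrow> a + b \<in> scissor_relations"
  using scissor_relations.diff[OF _ scissor_relations_uminus, of a b] by simp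

quotient_type (overloaded) 'k K0 = "'k::field iso_class \<Rightarrow>\<^sub>0 int" / "\<lambda>a b. a - b \<in> scissor_relations"
proof (rule equivpI)
  show "reflp (\<lambda>a b :: 'k iso_class \<Rightarrow>\<^sub>0 int. a - b \<in> scissor_relations)"
    by (simp add: reflpI scissor_relations.zero)
  show "symp (\<lambda>a b :: 'k iso_class \<Rightarrow>\<^sub>0 int. a - b \<in> scissor_relations)"
    by (rule sympI) (drule scissor_relations_uminus, simp)
  show "transp (\<lambda>a b :: 'k iso_class \<Rightarrow>\<^sub>0 int. a - b \<in> scissor_relations)"
    by (rule transpI) (drule (1) scissor_relations_add, simp)
qed

text \<open>The class \<open>comm_ring_1\<close> would require a proof that the ring is not the zero ring.\<close>

instantiation K0 :: (field) "{comm_ring, comm_monoid_mult}"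
begin

lift_definition zero_K0 :: "'a K0" is 0 .

lift_definition one_K0 :: "'a K0" is 1 .

lift_definition plus_K0 :: "'a K0 \<Rightarrow> 'a K0 \<Rightarrow> 'a K0" is "(+)"
  by (drule (1) scissor_relations_add) (simp add: algebra_simps)

lift_definition uminus_K0 :: "'a K0 \<Rightarrow> 'a K0" is uminus
  by (drule scissor_relations_uminus) (simp add: algebra_simps)

lift_definition minus_K0 :: "'a K0 \<Rightarrow> 'a K0 \<Rightarrow> 'a K0" is "(-)"
  by (drule (1) scissor_relations.diff) (simp add: algebra_simps)

lift_definition times_K0 :: "'a K0 \<Rightarrow> 'a K0 \<Rightarrow> 'a K0" is "(*)"
proof -
  fix a a' b b' :: "'a iso_class \<Rightarrow>\<^sub>0 int"
  assume "a - a' \<in> scissor_relations" "b - b' \<in> scissor_relations"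
  then have "(a - a') * b + (b - b') * a' \<in> scissor_relations"
    by (intro scissor_relations_add scissor_relations_mult)
  also have "(a - a') * b + (b - b') * a' = a * b - a' * b'" by (simp add: algebra_simps)
  finally show "a * b - a' * b' \<in> scissor_relations" .
qed

instance
  by standard (transfer; simp add: algebra_simps scissor_relations.zero)+

end

instance K0 :: (field) numeral ..

lemma abs_K0_scissor:
  assumes "closedin (topol (space_of X)) C"
    and "space_of Z \<cong>\<^sub>v induced (space_of X) C" "space_of U \<cong>\<^sub>v induced (space_of X) (pts (space_of X) - C)"
  shows "abs_K0 (frag_of (abs_iso_class X)) = abs_K0 (frag_of (abs_iso_class Z)) + abs_K0 (frag_of (abs_iso_class U))"
  unfolding plus_K0.abs_eq K0.abs_eq_iff by (rule scissor_relations.scissor[OF assms])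

lemma abs_K0_product:
  "abs_K0 (frag_of (abs_iso_class X)) * abs_K0 (frag_of (abs_iso_class Y)) =
     abs_K0 (frag_of (abs_iso_class (product_variety X Y)))"
  by (simp add: times_K0.abs_eq frag_of_mult plus_iso_class.abs_eq)

lemma abs_K0_point: "abs_K0 (frag_of (abs_iso_class point_variety)) = 1"
  by (simp add: one_K0.abs_eq zero_iso_class.abs_eq[symmetric])

definition virtual_class :: "('k::field, 'a) fspace \<Rightarrow> 'k K0" where
  "virtual_class X = abs_K0 (frag_of (abs_iso_class (SOME V. space_of V \<cong>\<^sub>v X)))"

lemma virtual_class_eq:
  assumes "space_of V \<cong>\<^sub>v X" shows "virtual_class X = abs_K0 (frag_of (abs_iso_class V))"
proof -
  have "space_of (SOME V. space_of V \<cong>\<^sub>v X) \<cong>\<^sub>v X"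
    using assms by (rule someI)
  from isomorphic_trans[OF this isomorphic_sym[OF assms]] have "abs_iso_class (SOME V. space_of V \<cong>\<^sub>v X) = abs_iso_class V" by (simp only: iso_class.abs_eq_iff)
  then show ?thesis by (simp only: virtual_class_def)
qed


section \<open>Representation and character varieties of non-orientable surfaces\<close>

definition matrix_tuples :: "nat \<Rightarrow> ('k::field, ('k alg_closure^'n::finite^'n) list) fspace" where
  "matrix_tuples r = zariski {\<lambda>As. As ! i $ a $ b | i a b. i < r} {As. length As = r}"

text \<open>
  A linear algebraic group \<open>G\<close> over \<open>k\<close> is given by its \<open>K\<close>-points, a \<open>k\<close>-locally closed set of matrices.
  Homomorphisms from the group \<open>\<langle>a\<^sub>1, \<dots>, a\<^sub>r | a\<^sub>1\<^sup>2 \<cdots> a\<^sub>r\<^sup>2 = 1\<rangle>\<close> to \<open>G\<close> are identified with the images of the generators.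
\<close>

definition representation_variety ::
  "('k::field alg_closure^'n::finite^'n) set \<Rightarrow> nat \<Rightarrow> ('k, ('k alg_closure^'n^'n) list) fspace" where
  "representation_variety G r = induced (matrix_tuples r)
     {As. length As = r \<and> set As \<subseteq> G \<and> foldr (\<lambda>A B. A ** A ** B) As (mat 1) = mat 1}"

text \<open>
  The spectrum of a \<open>k\<close>-algebra \<open>A\<close> of \<open>K\<close>-valued functions on \<open>S\<close>: its \<open>K\<close>-points are the \<open>k\<close>-algebra homomorphisms
  from \<open>A\<close> to \<open>K\<close>. Functions that agree on \<open>S\<close> represent the same element of the algebra.
\<close>

definition algebra_homs :: "'a set \<Rightarrow> ('a \<Rightarrow> 'k::field alg_closure) set \<Rightarrow> (('a \<Rightarrow> 'k alg_closure) \<Rightarrow> 'k alg_closure) set" where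
  "algebra_homs S A = {\<phi> \<in> extensional A.
     (\<forall>f \<in> A. \<forall>g \<in> A. (\<forall>x \<in> S. f x = g x) \<longrightarrow> \<phi> f = \<phi> g) \<and>
     (\<forall>c. \<phi> (\<lambda>_. to_ac c) = to_ac c) \<and>
     (\<forall>f \<in> A. \<forall>g \<in> A. \<phi> (\<lambda>x. f x + g x) = \<phi> f + \<phi> g \<and> \<phi> (\<lambda>x. f x * g x) = \<phi> f * \<phi> g)}"

definition Spec :: "'a set \<Rightarrow> ('a \<Rightarrow> 'k::field alg_closure) set \<Rightarrow> ('k, ('a \<Rightarrow> 'k alg_closure) \<Rightarrow> 'k alg_closure) fspace" where
  "Spec S A = zariski {\<lambda>\<phi>. \<phi> f | f. f \<in> A} (algebra_homs S A)"

text \<open>Invariance is tested on \<open>K\<close>-points, not on \<open>k\<close>-points, of the group.\<close>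

definition invariant_sections :: "('k::field, 'a) fspace \<Rightarrow> ('g \<Rightarrow> 'a \<Rightarrow> 'a) \<Rightarrow> 'g set \<Rightarrow> ('a \<Rightarrow> 'k alg_closure) set" where
  "invariant_sections X act G = {f \<in> sections X (pts X). \<forall>g \<in> G. \<forall>x \<in> pts X. f (act g x) = f x}"

definition GIT_quotient ::
  "('k::field, 'a) fspace \<Rightarrow> ('g \<Rightarrow> 'a \<Rightarrow> 'a) \<Rightarrow> 'g set \<Rightarrow> ('k, ('a \<Rightarrow> 'k alg_closure) \<Rightarrow> 'k alg_closure) fspace" where
  "GIT_quotient X act G = Spec (pts X) (invariant_sections X act G)"

definition conjugate :: "'a::semiring_1^'n::finite^'n \<Rightarrow> ('a^'n^'n) list \<Rightarrow> ('a^'n^'n) list" where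
  "conjugate g As = map (\<lambda>A. g ** A ** matrix_inv g) As"

definition character_variety ::
  "('k::field alg_closure^'n::finite^'n) set \<Rightarrow> nat \<Rightarrow>
     ('k, (('k alg_closure^'n^'n) list \<Rightarrow> 'k alg_closure) \<Rightarrow> 'k alg_closure) fspace" where
  "character_variety G r = GIT_quotient (representation_variety G r) conjugate G"

definition AGL1 :: "('k::field alg_closure^2^2) set" where
  "AGL1 = {vector [vector [x, y], vector [0, 1]] | x y. x \<noteq> 0}"


end

theory Submission
  imports Defs
begin

text \<open>
  A tuple of matrices with entries \<open>x\<^sub>i, y\<^sub>i\<close> is a representation iff \<open>(x\<^sub>1 \<cdots> x\<^sub>r)\<^sup>2 = 1\<close> and \<open>y\<close> is in the
  kernel of a linear form with coefficients \<open>c\<^sub>i(x) = x\<^sub>1\<^sup>2 \<cdots> x\<^sub>i\<^sub>-\<^sub>1\<^sup>2 (1 + x\<^sub>i)\<close>. The \<open>x\<close> form two copies of a torus of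
  dimension \<open>r - 1\<close>. Over the locus where \<open>x\<^sub>j = -1\<close> for \<open>j < m\<close> but \<open>x\<^sub>m \<noteq> -1\<close> the equation can be solved for \<open>y\<^sub>m\<close>, so
  the fibration is trivial with fibre of dimension \<open>r - 1\<close>; over the remaining point \<open>(-1, \<dots>, -1)\<close> the fibre is the
  whole \<open>r\<close>-dimensional space, which gives the correction term. Conjugation can scale \<open>y\<close> towards \<open>0\<close>, so invariant
  functions depend on \<open>x\<close> only, and the character variety is the space of the \<open>x\<close>.
\<close>

section \<open>Regular functions\<close>

context function_space
begin

lemma sections_uminus: "openin (topol X) U \<Longrightarrow> f \<in> sections X U \<Longrightarrow> (\<lambda>x. - f x) \<in> sections X U"
  using sections_mult[OF _ sections_const[of U "-1"], of f] by simp

lemma sections_diff: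
  "openin (topol X) U \<Longrightarrow> f \<in> sections X U \<Longrightarrow> g \<in> sections X U \<Longrightarrow> (\<lambda>x. f x - g x) \<in> sections X U"
  using sections_add[OF _ _ sections_uminus, of U f g] by simp

lemma sections_one: "openin (topol X) U \<Longrightarrow> (\<lambda>_. 1) \<in> sections X U"
  and sections_zero: "openin (topol X) U \<Longrightarrow> (\<lambda>_. 0) \<in> sections X U"
  using sections_const[of U 1] sections_const[of U 0] by simp_all

lemma sections_sum:
  assumes "openin (topol X) U" "\<And>i. i \<in> I \<Longrightarrow> f i \<in> sections X U"
  shows "(\<lambda>x. \<Sum>i\<in>I. f i x) \<in> sections X U"
  using assms(2)
  by (induction I rule: infinite_finite_induct) (auto intro: sections_zero[OF assms(1)] sections_add[OF assms(1)])

lemma sections_prod: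
  assumes "openin (topol X) U" "\<And>i. i \<in> I \<Longrightarrow> f i \<in> sections X U"
  shows "(\<lambda>x. \<Prod>i\<in>I. f i x) \<in> sections X U"
  using assms(2)
  by (induction I rule: infinite_finite_induct) (auto intro: sections_one[OF assms(1)] sections_mult[OF assms(1)])

lemma sections_power:
  assumes "openin (topol X) U" "f \<in> sections X U" shows "(\<lambda>x. f x ^ m) \<in> sections X U"
  using sections_prod[OF assms(1), of "{..<m}" "\<lambda>_. f"] assms(2) by simp

lemma sections_inverse':
  assumes U: "openin (topol X) U" and f: "f \<in> sections X U" and nz: "\<And>x. x \<in> U \<Longrightarrow> f x \<noteq> 0"
  shows "(\<lambda>x. inverse (f x)) \<in> sections X U"
proof -
  have "{x \<in> U. f x \<noteq> 0} = U" using nz by auto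
  with sections_inverse[OF U f] show ?thesis by simp
qed

lemmas global_sections =
  sections_zero[OF openin_topspace] sections_one[OF openin_topspace] sections_const[OF openin_topspace]
  sections_add[OF openin_topspace] sections_mult[OF openin_topspace] sections_uminus[OF openin_topspace]
  sections_diff[OF openin_topspace] sections_sum[OF openin_topspace] sections_prod[OF openin_topspace]
  sections_power[OF openin_topspace] sections_inverse'[OF openin_topspace]

lemma closedin_zeros: "f \<in> sections X (pts X) \<Longrightarrow> closedin (topol X) {x \<in> pts X. f x = 0}"
proof -
  assume "f \<in> sections X (pts X)"
  then have "openin (topol X) {x \<in> pts X. f x \<noteq> 0}" by (rule openin_nonzero[OF openin_topspace])
  moreover have "pts X - {x \<in> pts X. f x = 0} = {x \<in> pts X. f x \<noteq> 0}" by auto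
  ultimately show ?thesis by (auto simp: closedin_def)
qed

text \<open>If \<open>f x \<noteq> f y\<close>, the nonvanishing set of
  \<open>f (fst z) - f (snd z)\<close> is an open neighbourhood of \<open>(x, y)\<close> that misses
  the diagonal.\<close>

lemma separated_if_sections_separate_points:
  assumes sep: "\<And>x y. x \<in> pts X \<Longrightarrow> y \<in> pts X \<Longrightarrow> x \<noteq> y \<Longrightarrow> \<exists>f \<in> sections X (pts X). f x \<noteq> f y"
  shows "closedin (topol (X \<times>\<^sub>v X)) {(x, x) | x. x \<in> pts X}"
proof -
  note fs = function_space_axioms
  interpret XX: function_space "X \<times>\<^sub>v X" by (rule function_space_product[OF fs fs])
  have "openin (topol (X \<times>\<^sub>v X)) (pts (X \<times>\<^sub>v X) - {(x, x) | x. x \<in> pts X})"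
  proof (subst openin_subopen, rule ballI)
    fix z assume z: "z \<in> pts (X \<times>\<^sub>v X) - {(x, x) | x. x \<in> pts X}"
    obtain x y where xy: "z = (x, y)" by (cases z)
    have "x \<in> pts X" "y \<in> pts X" "x \<noteq> y" using z by (auto simp: xy pts_product[OF fs fs])
    then obtain f where f: "f \<in> sections X (pts X)" "f x \<noteq> f y" using sep by blast
    have "(\<lambda>z. f (fst z)) \<in> sections (X \<times>\<^sub>v X) {z \<in> pts (X \<times>\<^sub>v X). fst z \<in> pts X}"
      "(\<lambda>z. f (snd z)) \<in> sections (X \<times>\<^sub>v X) {z \<in> pts (X \<times>\<^sub>v X). snd z \<in> pts X}"
      by (intro regular_map_section[OF regular_map_fst] regular_map_section[OF regular_map_snd] fs f(1) openin_topspace)+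
    moreover have "{z \<in> pts (X \<times>\<^sub>v X). fst z \<in> pts X} = pts (X \<times>\<^sub>v X)"
      "{z \<in> pts (X \<times>\<^sub>v X). snd z \<in> pts X} = pts (X \<times>\<^sub>v X)" by (auto simp: pts_product[OF fs fs])
    ultimately have "(\<lambda>z. f (fst z) - f (snd z)) \<in> sections (X \<times>\<^sub>v X) (pts (X \<times>\<^sub>v X))"
      by (simp add: XX.global_sections)
    from XX.openin_nonzero[OF openin_topspace this]
    show "\<exists>T. openin (topol (X \<times>\<^sub>v X)) T \<and> z \<in> T \<and> T \<subseteq> pts (X \<times>\<^sub>v X) - {(x, x) | x. x \<in> pts X}"
      using f(2) z xy by (intro exI conjI) auto
  qed
  moreover have "{(x, x) | x. x \<in> pts X} \<subseteq> pts (X \<times>\<^sub>v X)" by (auto simp: pts_product[OF fs fs])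
  ultimately show ?thesis by (simp add: closedin_def)
qed

end

section \<open>Subspaces and the algebra of polynomial functions\<close>

lemma polynomial_section_induced:
  assumes "p \<in> polynomials C"
  shows "p \<in> sections (induced (zariski C S) T) (pts (induced (zariski C S) T))"
  by (rule polynomial_pullback[OF regular_map_inclusion[OF function_space_zariski] assms])

lemma induced_induced:
  assumes fs: "function_space X" shows "induced (induced X S) T \<cong>\<^sub>v induced X (S \<inter> T)"
proof (rule isomorphicI)
  note fs' = function_space_induced fs
  show "regular_map (induced (induced X S) T) (induced X (S \<inter> T)) (\<lambda>x. x)"
    by (intro regular_map_into_induced regular_map_compose[OF regular_map_inclusion regular_map_inclusion] fs') auto
  show "regular_map (induced X (S \<inter> T)) (induced (induced X S) T) (\<lambda>x. x)"
    by (intro regular_map_into_induced regular_map_inclusion fs') auto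
qed auto

lemma polynomials_uminus: "p \<in> polynomials C \<Longrightarrow> (\<lambda>x. - p x) \<in> polynomials C"
  using polynomials.mult[OF polynomials.const[of "-1"], of p C] by simp

lemma polynomials_diff: "p \<in> polynomials C \<Longrightarrow> q \<in> polynomials C \<Longrightarrow> (\<lambda>x. p x - q x) \<in> polynomials C"
  using polynomials.add[OF _ polynomials_uminus, of p C q] by simp

lemma polynomials_one: "(\<lambda>_. 1) \<in> polynomials C" and polynomials_zero: "(\<lambda>_. 0) \<in> polynomials C"
  using polynomials.const[of 1 C] polynomials.const[of 0 C] by simp_all

lemma polynomials_sum: "(\<And>i. i \<in> I \<Longrightarrow> p i \<in> polynomials C) \<Longrightarrow> (\<lambda>x. \<Sum>i\<in>I. p i x) \<in> polynomials C"
  by (induction I rule: infinite_finite_induct) (auto intro: polynomials_zero polynomials.add)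

lemma polynomials_prod: "(\<And>i. i \<in> I \<Longrightarrow> p i \<in> polynomials C) \<Longrightarrow> (\<lambda>x. \<Prod>i\<in>I. p i x) \<in> polynomials C"
  by (induction I rule: infinite_finite_induct) (auto intro: polynomials_one polynomials.mult)

lemma polynomials_power: "p \<in> polynomials C \<Longrightarrow> (\<lambda>x. p x ^ m) \<in> polynomials C"
  using polynomials_prod[of "{..<m}" "\<lambda>_. p" C] by simp

lemma polynomials_coord: "i < n \<Longrightarrow> (\<lambda>x. x ! i) \<in> polynomials (coords n)"
  by (rule polynomials.coord) (auto simp: coords_def)

lemma polynomials_take:
  assumes "p \<in> polynomials (coords n)" "n \<le> m" shows "(\<lambda>z. p (take n z)) \<in> polynomials (coords m)"
proof (rule polynomials_substitute[OF assms(1)])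
  fix c :: "'a alg_closure list \<Rightarrow> 'a alg_closure" assume "c \<in> coords n"
  then obtain i where "i < n" "c = (\<lambda>x. x ! i)" by (auto simp: coords_def)
  then show "(\<lambda>z. c (take n z)) \<in> polynomials (coords m)" using polynomials_coord[of i m] assms(2) by simp
qed

section \<open>Locally closed subsets of affine space\<close>

abbreviation locus_space :: "nat \<Rightarrow> 'k::field alg_closure list set \<Rightarrow> ('k, 'k alg_closure list) fspace" where
  "locus_space n S \<equiv> induced (affine_space n) S"

text \<open>A closed set minus one hypersurface. Cutting it by a polynomial, as in the scissor
  relation, leaves two sets of the same kind, and each of them is an affine variety.\<close>

definition affine_locus :: "nat \<Rightarrow> 'k::field alg_closure list set \<Rightarrow> bool" where
  "affine_locus n S \<longleftrightarrow>
     (\<exists>P \<subseteq> polynomials (coords n). \<exists>h \<in> polynomials (coords n). S = {x \<in> zero_set n P. h x \<noteq> 0})"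

lemma affine_locus_length: "affine_locus n S \<Longrightarrow> x \<in> S \<Longrightarrow> length x = n"
  by (auto simp: affine_locus_def zero_set_def)

lemma affine_locus_UNIV: "affine_locus n {x. length x = n}"
  unfolding affine_locus_def zero_set_def
  by (intro exI[of _ "{}"] bexI[of _ "\<lambda>_. 1"] conjI) (auto intro: polynomials_one)

lemma affine_locus_zero:
  assumes "affine_locus n S" "p \<in> polynomials (coords n)" shows "affine_locus n {x \<in> S. p x = 0}"
proof -
  obtain P h where "P \<subseteq> polynomials (coords n)" "h \<in> polynomials (coords n)" "S = {x \<in> zero_set n P. h x \<noteq> 0}"
    using assms(1) unfolding affine_locus_def by blast
  with assms(2) show ?thesis
    unfolding affine_locus_def by (intro exI[of _ "insert p P"] bexI[of _ h]) (auto simp: zero_set_def)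
qed

lemma affine_locus_nonzero:
  assumes "affine_locus n S" "p \<in> polynomials (coords n)" shows "affine_locus n {x \<in> S. p x \<noteq> 0}"
proof -
  obtain P h where "P \<subseteq> polynomials (coords n)" "h \<in> polynomials (coords n)" "S = {x \<in> zero_set n P. h x \<noteq> 0}"
    using assms(1) unfolding affine_locus_def by blast
  with assms(2) show ?thesis
    unfolding affine_locus_def
    by (intro exI[of _ P] bexI[of _ "\<lambda>x. h x * p x"] conjI polynomials.mult) (auto simp: zero_set_def)
qed

lemma affine_locus_all_zero:
  assumes "affine_locus n S" "\<And>i. i < (m::nat) \<Longrightarrow> p i \<in> polynomials (coords n)"
  shows "affine_locus n {x \<in> S. \<forall>i<m. p i x = 0}"
  using assms(2)
proof (induction m)
  case (Suc m)
  have "affine_locus n {x \<in> {x \<in> S. \<forall>i<m. p i x = 0}. p m x = 0}"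
    by (intro affine_locus_zero Suc) auto
  moreover have "{x \<in> {x \<in> S. \<forall>i<m. p i x = 0}. p m x = 0} = {x \<in> S. \<forall>i<Suc m. p i x = 0}"
    by (auto simp: less_Suc_eq)
  ultimately show ?case by simp
qed (use assms(1) in simp)

lemma affine_locus_cylinder:
  assumes "affine_locus n S" shows "affine_locus (n + m) {z. length z = n + m \<and> take n z \<in> S}"
proof -
  obtain P h where P: "P \<subseteq> polynomials (coords n)" and h: "h \<in> polynomials (coords n)"
    and S: "S = {x \<in> zero_set n P. h x \<noteq> 0}"
    using assms unfolding affine_locus_def by blast
  have "(\<lambda>p z. p (take n z)) ` P \<subseteq> polynomials (coords (n + m))"
    using P polynomials_take[of _ n "n + m"] by auto
  moreover have "(\<lambda>z. h (take n z)) \<in> polynomials (coords (n + m))"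
    by (rule polynomials_take[OF h]) simp
  ultimately show ?thesis
    unfolding affine_locus_def
    by (intro exI[of _ "(\<lambda>p z. p (take n z)) ` P"] bexI[of _ "\<lambda>z. h (take n z)"] conjI)
      (auto simp: S zero_set_def)
qed

section \<open>Locus spaces as varieties\<close>

lemma function_space_locus_space: "function_space (locus_space n S)"
  by (intro function_space_induced function_space_affine_space)

lemma regular_map_locus_space:
  assumes "function_space Z" "\<And>z. z \<in> pts Z \<Longrightarrow> \<phi> z \<in> T" "\<And>z. z \<in> pts Z \<Longrightarrow> length (\<phi> z) = n"
    and "\<And>i. i < n \<Longrightarrow> (\<lambda>z. \<phi> z ! i) \<in> sections Z (pts Z)"
  shows "regular_map Z (locus_space n T) \<phi>"
  by (intro regular_map_into_induced regular_map_affine_space assms)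

lemma polynomial_section_locus_space:
  "p \<in> polynomials (coords n) \<Longrightarrow> p \<in> sections (locus_space n S) (pts (locus_space n S))"
  unfolding affine_space_def by (rule polynomial_section_induced)

lemma coordinate_section: "i < n \<Longrightarrow> (\<lambda>x. x ! i) \<in> sections (locus_space n S) (pts (locus_space n S))"
  by (intro polynomial_section_locus_space polynomials_coord)

text \<open>The trick of Rabinowitsch: the locus is the graph of \<open>1 / h\<close>, a closed set in one more variable.\<close>

lemma affine_variety_locus:
  assumes "affine_locus n S" shows "affine_variety (locus_space n S)"
proof -
  obtain P h where P: "P \<subseteq> polynomials (coords n)" and h: "h \<in> polynomials (coords n)"
    and S: "S = {x \<in> zero_set n P. h x \<noteq> 0}"
    using assms unfolding affine_locus_def by blast
  define Q where "Q = insert (\<lambda>z. h (take n z) * z ! n - 1) ((\<lambda>p z. p (take n z)) ` P)"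
  have take: "(\<lambda>z. p (take n z)) \<in> polynomials (coords (Suc n))" if "p \<in> polynomials (coords n)" for p
    using that by (rule polynomials_take) simp
  have Q: "Q \<subseteq> polynomials (coords (Suc n))"
  proof -
    have "(\<lambda>z. h (take n z) * z ! n - 1) \<in> polynomials (coords (Suc n))"
      by (intro polynomials_diff polynomials.mult take[OF h] polynomials_coord polynomials_one) simp
    then show ?thesis using P take by (auto simp: Q_def)
  qed
  interpret S: function_space "locus_space n S" by (rule function_space_locus_space)
  let ?Q = "locus_space (Suc n) (zero_set (Suc n) Q)"
  have "locus_space n S \<cong>\<^sub>v ?Q"
  proof (rule isomorphicI)
    show "regular_map (locus_space n S) ?Q (\<lambda>x. x @ [inverse (h x)])"
    proof (rule regular_map_locus_space[OF function_space_locus_space])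
      fix i assume i: "i < Suc n"
      show "(\<lambda>x. (x @ [inverse (h x)]) ! i) \<in> sections (locus_space n S) (pts (locus_space n S))"
      proof (cases "i = n")
        case True
        have "(\<lambda>x. inverse (h x)) \<in> sections (locus_space n S) (pts (locus_space n S))"
          using polynomial_section_locus_space[OF h] by (intro S.global_sections) (auto simp: S)
        then show ?thesis
          by (rule S.sections_cong[OF openin_topspace]) (auto simp: nth_append True)
      next
        case False
        with i have "i < n" by simp
        from coordinate_section[OF this] show ?thesis
          by (rule S.sections_cong[OF openin_topspace]) (use \<open>i < n\<close> in \<open>auto simp: nth_append\<close>)
      qed
    qed (auto simp: S Q_def zero_set_def nth_append)
    show "regular_map ?Q (locus_space n S) (take n)"
    proof (rule regular_map_locus_space[OF function_space_locus_space])
      fix i assume "i < n"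
      with coordinate_section[of i "Suc n"]
      show "(\<lambda>z. take n z ! i) \<in> sections ?Q (pts ?Q)" by simp
    qed (auto simp: S Q_def zero_set_def)
    show "take n z @ [inverse (h (take n z))] = z" if "z \<in> pts ?Q" for z
    proof -
      have z: "length z = Suc n" "h (take n z) * z ! n = 1" using that by (auto simp: zero_set_def Q_def)
      then have "inverse (h (take n z)) = z ! n" by (simp add: inverse_unique)
      then show ?thesis using z(1) by (metis lessI take_Suc_conv_app_nth take_all_iff order_refl)
    qed
  qed auto
  then show ?thesis unfolding affine_variety_def using Q by blast
qed

text \<open>The space is its own single affine chart, and the coordinate functions separate points,
  which yields separatedness.\<close>

lemma variety_locus_space:
  assumes "affine_locus n S" shows "variety (locus_space n S)"
  unfolding variety_def
proof (intro conjI)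
  show fs: "function_space (locus_space n S)" by (rule function_space_locus_space)
  have "induced (locus_space n S) (pts (locus_space n S)) \<cong>\<^sub>v locus_space n S"
    by (rule induced_whole[OF fs order_refl])
  from affine_variety_isomorphic[OF this affine_variety_locus[OF assms]]
  show "\<exists>\<U>. finite \<U> \<and> \<Union>\<U> = pts (locus_space n S) \<and>
      (\<forall>U \<in> \<U>. openin (topol (locus_space n S)) U \<and> affine_variety (induced (locus_space n S) U))"
    by (intro exI[of _ "{pts (locus_space n S)}"]) (simp del: topol_induced)
  have "\<exists>f \<in> sections (locus_space n S) (pts (locus_space n S)). f x \<noteq> f y"
    if "x \<in> pts (locus_space n S)" "y \<in> pts (locus_space n S)" "x \<noteq> y" for x y
  proof -
    have "length x = n" "length y = n" using that by auto
    with that(3) obtain i where "i < n" "x ! i \<noteq> y ! i" using nth_equalityI by metis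
    then show ?thesis using coordinate_section[of i n S] by (intro bexI)
  qed
  then show "closedin (topol (locus_space n S \<times>\<^sub>v locus_space n S)) {(x, x) |x. x \<in> pts (locus_space n S)}"
    by (rule function_space.separated_if_sections_separate_points[OF fs])
qed


section \<open>Virtual classes\<close>

text \<open>The choice in \<open>virtual_class\<close> ranges over the varieties isomorphic to the
  given space, and these coincide for \<open>X\<close> and \<open>Y\<close>. The point types may
  differ, so matrix tuples and algebra homomorphisms can be traded for coordinate lists.\<close>

lemma virtual_class_cong:
  assumes "X \<cong>\<^sub>v Y" shows "virtual_class X = virtual_class Y"
proof -
  have "space_of V \<cong>\<^sub>v X \<longleftrightarrow> space_of V \<cong>\<^sub>v Y" for V :: "'a variety"
    by (rule iffI) (erule isomorphic_trans, rule assms isomorphic_sym[OF assms])+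
  then show ?thesis by (simp add: virtual_class_def)
qed

lemma space_of_Variety: "variety X \<Longrightarrow> space_of (Variety X) = X"
  by (simp add: Variety_inverse)

lemma virtual_class_variety: "variety X \<Longrightarrow> virtual_class X = abs_K0 (frag_of (abs_iso_class (Variety X)))"
  by (rule virtual_class_eq) (simp add: space_of_Variety isomorphic_refl)

lemma virtual_class_product:
  fixes X Y :: "('k::field, 'k alg_closure list) fspace"
  assumes "variety X" "variety Y"
  shows "virtual_class (X \<times>\<^sub>v Y) = virtual_class X * virtual_class Y"
proof -
  have "space_of (product_variety (Variety X) (Variety Y)) \<cong>\<^sub>v X \<times>\<^sub>v Y"
    using isomorphic_sym[OF product_variety[of "Variety X" "Variety Y"]] assms by (simp add: space_of_Variety)
  from virtual_class_eq[OF this] show ?thesis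
    using assms by (simp add: virtual_class_variety abs_K0_product)
qed

lemma virtual_class_point: "virtual_class (affine_space 0) = 1"
proof -
  have "space_of point_variety \<cong>\<^sub>v affine_space 0" by (simp add: point_variety.rep_eq isomorphic_refl)
  from virtual_class_eq[OF this] show ?thesis by (simp add: abs_K0_point)
qed

text \<open>Zero set and complement are again loci in the same affine space, so every later cut is
  made by naming one polynomial.\<close>

lemma virtual_class_scissor:
  assumes S: "affine_locus n S" and p: "p \<in> polynomials (coords n)"
  shows "virtual_class (locus_space n S) =
    virtual_class (locus_space n {x \<in> S. p x = 0}) + virtual_class (locus_space n {x \<in> S. p x \<noteq> 0})"
proof -
  let ?C = "{x \<in> S. p x = 0}" and ?U = "{x \<in> S. p x \<noteq> 0}"
  note v = variety_locus_space[OF S] variety_locus_space[OF affine_locus_zero[OF S p]]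
    variety_locus_space[OF affine_locus_nonzero[OF S p]]
  note fs = function_space_locus_space
  \<comment> \<open>The scissor relation wants the pieces as subspaces of the locus; a subspace of a
    subspace is the subspace on the intersection.\<close>
  have piece: "space_of (Variety (locus_space n T)) \<cong>\<^sub>v induced (space_of (Variety (locus_space n S))) D"
    if "variety (locus_space n T)" "S \<inter> D = T" for T D
    using isomorphic_sym[OF induced_induced[OF function_space_affine_space, of n S D]] that v
    by (simp add: space_of_Variety)
  have C: "S \<inter> {x \<in> pts (locus_space n S). p x = 0} = ?C" and U: "S \<inter> (pts (locus_space n S) - {x \<in> pts (locus_space n S). p x = 0}) = ?U"
    using affine_locus_length[OF S] by auto
  have "closedin (topol (locus_space n S)) {x \<in> pts (locus_space n S). p x = 0}"
    by (rule function_space.closedin_zeros[OF fs polynomial_section_locus_space[OF p]])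
  then have "abs_K0 (frag_of (abs_iso_class (Variety (locus_space n S)))) =
      abs_K0 (frag_of (abs_iso_class (Variety (locus_space n ?C)))) +
      abs_K0 (frag_of (abs_iso_class (Variety (locus_space n ?U))))"
    by (rule abs_K0_scissor[of "Variety (locus_space n S)", unfolded space_of_Variety[OF v(1)],
          OF _ piece[unfolded space_of_Variety[OF v(1)], OF v(2) C] piece[unfolded space_of_Variety[OF v(1)], OF v(3) U]])
  then show ?thesis using v by (simp add: virtual_class_variety)
qed

text \<open>Concatenating lists and splitting after \<open>n\<close> entries are inverse, and
  regular because each entry of the result is a coordinate of the argument.\<close>

lemma locus_space_Times:
  "locus_space (n + m) {z. length z = n + m \<and> take n z \<in> S \<and> drop n z \<in> T} \<cong>\<^sub>v locus_space n S \<times>\<^sub>v locus_space m T"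
    (is "?Z \<cong>\<^sub>v ?X \<times>\<^sub>v ?Y")
proof (rule isomorphicI)
  note fs = function_space_locus_space function_space_product
  interpret Z: function_space ?Z by (rule fs)
  interpret P: function_space "?X \<times>\<^sub>v ?Y" by (intro fs)
  have pts: "z \<in> pts (?X \<times>\<^sub>v ?Y) \<longleftrightarrow> fst z \<in> S \<and> snd z \<in> T \<and> length (fst z) = n \<and> length (snd z) = m" for z
    by (cases z) (auto simp: pts_product fs)
  show "regular_map ?Z (?X \<times>\<^sub>v ?Y) (\<lambda>z. (take n z, drop n z))"
  proof (intro regular_map_Pair regular_map_locus_space fs)
    fix i assume "i < n"
    then show "(\<lambda>z. take n z ! i) \<in> sections ?Z (pts ?Z)" using coordinate_section[of i "n + m"] by simp
  next
    fix i assume "i < m"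
    then have "(\<lambda>z. z ! (n + i)) \<in> sections ?Z (pts ?Z)" by (intro coordinate_section) simp
    then show "(\<lambda>z. drop n z ! i) \<in> sections ?Z (pts ?Z)"
      by (rule Z.sections_cong[OF openin_topspace]) auto
  qed auto
  have X: "regular_map (?X \<times>\<^sub>v ?Y) (affine_space n) fst" and Y: "regular_map (?X \<times>\<^sub>v ?Y) (affine_space m) snd"
    by (intro regular_map_compose[OF regular_map_fst regular_map_inclusion]
        regular_map_compose[OF regular_map_snd regular_map_inclusion] fs function_space_affine_space)+
  show "regular_map (?X \<times>\<^sub>v ?Y) ?Z (\<lambda>z. fst z @ snd z)"
  proof (intro regular_map_locus_space fs)
    fix i assume i: "i < n + m"
    show "(\<lambda>z. (fst z @ snd z) ! i) \<in> sections (?X \<times>\<^sub>v ?Y) (pts (?X \<times>\<^sub>v ?Y))"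
    proof (cases "i < n")
      case True
      show ?thesis
        by (rule P.sections_cong[OF openin_topspace coordinate_pullback[OF X True]])
          (use True in \<open>auto simp: pts nth_append\<close>)
    next
      case False
      with i have "i - n < m" by simp
      from coordinate_pullback[OF Y this] show ?thesis
        by (rule P.sections_cong[OF openin_topspace]) (use False in \<open>auto simp: pts nth_append\<close>)
    qed
  qed (auto simp: pts)
  show "(take n (fst z @ snd z), drop n (fst z @ snd z)) = z" if "z \<in> pts (?X \<times>\<^sub>v ?Y)" for z
    using that by (cases z) (simp add: pts)
qed auto

lemma virtual_class_Times:
  assumes "affine_locus n S" "affine_locus m T"
  shows "virtual_class (locus_space (n + m) {z. length z = n + m \<and> take n z \<in> S \<and> drop n z \<in> T}) =
    virtual_class (locus_space n S) * virtual_class (locus_space m T)"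
  unfolding virtual_class_cong[OF locus_space_Times] by (intro virtual_class_product variety_locus_space assms)

text \<open>Coordinates in the image of \<open>k\<close> make the constant map with value
  \<open>x\<close> regular over \<open>k\<close>; it is inverse to the map to the one-point
  space.\<close>

lemma virtual_class_singleton:
  assumes x: "length x = n" "set x \<subseteq> range to_ac"
  shows "virtual_class (locus_space n {x}) = 1"
proof -
  interpret A: function_space "affine_space 0" by (rule function_space_affine_space)
  have "locus_space n {x} \<cong>\<^sub>v affine_space 0"
  proof (rule isomorphicI)
    show "regular_map (locus_space n {x}) (affine_space 0) (\<lambda>_. [])"
      by (rule regular_map_affine_space[OF function_space_locus_space]) auto
    show "regular_map (affine_space 0) (locus_space n {x}) (\<lambda>_. x)"
    proof (rule regular_map_locus_space[OF function_space_affine_space])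
      fix i assume "i < n"
      then have "x ! i \<in> range to_ac" using x nth_mem by blast
      then show "(\<lambda>_. x ! i) \<in> sections (affine_space 0) (pts (affine_space 0))"
        using A.global_sections(3) by auto
    qed (use x in auto)
  qed auto
  from virtual_class_cong[OF this] show ?thesis by (simp add: virtual_class_point)
qed

section \<open>Classes of affine spaces, coordinate hyperplanes and tori\<close>

lemma virtual_class_zero: "virtual_class (locus_space 1 {[0]}) = 1"
proof (rule virtual_class_singleton)
  show "set [0] \<subseteq> range to_ac" using rangeI[of to_ac "0 :: 'a"] by simp
qed simp

lemma virtual_class_whole: "virtual_class (locus_space n {x. length x = n}) = virtual_class (affine_space n)"
  by (intro virtual_class_cong induced_whole function_space_affine_space) simp

lemma virtual_class_affine_space_add:
  "virtual_class (affine_space (n + m) :: ('k::field, _) fspace) = virtual_class (affine_space n) * virtual_class (affine_space m)"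
proof -
  have "{z :: 'k alg_closure list. length z = n + m \<and> take n z \<in> {x. length x = n} \<and> drop n z \<in> {x. length x = m}} = {z. length z = n + m}"
    by auto
  then show ?thesis
    using virtual_class_Times[OF affine_locus_UNIV[of n, where 'a = 'k] affine_locus_UNIV[of m]]
    by (simp only: virtual_class_whole)
qed

lemma virtual_class_affine_space: "virtual_class (affine_space n) = virtual_class (affine_space 1) ^ n"
proof (induction n)
  case (Suc n)
  show ?case
    using virtual_class_affine_space_add[of 1 n, where 'k = 'a] by (simp only: plus_1_eq_Suc power_Suc Suc)
qed (simp add: virtual_class_point)

text \<open>With \<open>m\<close> coordinates after the one at \<open>i\<close>, the hyperplane is
  the product of affine \<open>i\<close>-space, the origin of the line, and affine
  \<open>m\<close>-space.\<close>

lemma virtual_class_hyperplane: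
  assumes i: "i < n"
  shows "virtual_class (locus_space n {x :: 'k::field alg_closure list. length x = n \<and> x ! i = 0}) = virtual_class (affine_space 1) ^ (n - 1)"
proof -
  define m where "m = n - Suc i"
  have n: "n = i + (1 + m)" using i by (simp add: m_def)
  let ?U = "\<lambda>n. {x :: 'k alg_closure list. length x = n}"
  let ?W = "{x :: 'k alg_closure list. length x = 1 + m \<and> take 1 x \<in> {[0]} \<and> drop 1 x \<in> ?U m}"
  have W: "?W = {x \<in> ?U (1 + m). x ! 0 = 0}"
  proof -
    have "x \<in> ?W \<longleftrightarrow> x \<in> {x \<in> ?U (1 + m). x ! 0 = 0}" for x by (cases x) auto
    then show ?thesis by blast
  qed
  have lW: "affine_locus (1 + m) ?W"
    unfolding W by (intro affine_locus_zero affine_locus_UNIV polynomials_coord) simp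
  have pt: "{x \<in> ?U 1. x ! 0 = 0} = {[0]}"
    by (auto simp: length_Suc_conv nth_Cons')
  have l0: "affine_locus 1 {[0 :: 'k alg_closure]}"
    unfolding pt[symmetric] by (intro affine_locus_zero affine_locus_UNIV polynomials_coord) simp
  have H: "{x :: 'k alg_closure list. length x = n \<and> x ! i = 0} =
      {z. length z = i + (1 + m) \<and> take i z \<in> ?U i \<and> drop i z \<in> ?W}"
    unfolding W n by auto
  have "virtual_class (locus_space n {x :: 'k alg_closure list. length x = n \<and> x ! i = 0}) =
      virtual_class (locus_space (i + (1 + m)) {z. length z = i + (1 + m) \<and> take i z \<in> ?U i \<and> drop i z \<in> ?W})"
    by (subst H, subst n) (rule refl)
  also have "\<dots> = virtual_class (locus_space i (?U i)) *
      (virtual_class (locus_space 1 {[0 :: 'k alg_closure]}) * virtual_class (locus_space m (?U m)))"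
    by (simp only: virtual_class_Times[OF affine_locus_UNIV lW] virtual_class_Times[OF l0 affine_locus_UNIV])
  also have "\<dots> = virtual_class (affine_space 1) ^ i * (1 * virtual_class (affine_space 1) ^ m)"
    by (simp only: virtual_class_zero virtual_class_whole virtual_class_affine_space[of i] virtual_class_affine_space[of m])
  finally show ?thesis by (simp add: n power_add)
qed

text \<open>The torus is a power of the punctured line. Both claims go through one induction because
  the product formula needs its factors to be affine loci.\<close>

lemma virtual_class_torus:
  "affine_locus n {x :: 'k::field alg_closure list. length x = n \<and> (\<forall>i<n. x ! i \<noteq> 0)} \<and>
   virtual_class (locus_space n {x :: 'k::field alg_closure list. length x = n \<and> (\<forall>i<n. x ! i \<noteq> 0)}) =
     (virtual_class (affine_space 1) - 1) ^ n"
proof (induction n)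
  case 0
  have "{x :: 'k alg_closure list. length x = 0 \<and> (\<forall>i<0. x ! i \<noteq> 0)} = {x. length x = 0}" by auto
  then show ?case by (simp only: affine_locus_UNIV virtual_class_whole virtual_class_point power_0 simp_thms)
next
  case (Suc n)
  let ?U = "{x :: 'k alg_closure list. length x = 1}"
  let ?G = "{x \<in> ?U. x ! 0 \<noteq> 0}"
  have p: "(\<lambda>x. x ! 0) \<in> polynomials (coords 1)" by (rule polynomials_coord) simp
  have G: "affine_locus 1 ?G" by (intro affine_locus_nonzero affine_locus_UNIV p)
  have pt: "{x \<in> ?U. x ! 0 = 0} = {[0]}"
    by (auto simp: length_Suc_conv nth_Cons')
  \<comment> \<open>The punctured line is the line minus a point, by the scissor relation at the
    origin.\<close>
  then have cG: "virtual_class (locus_space 1 ?G) = virtual_class (affine_space 1) - 1"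
    using virtual_class_scissor[OF affine_locus_UNIV[where 'a = 'k] p] unfolding pt
    by (simp add: virtual_class_zero[unfolded One_nat_def] virtual_class_whole)
  let ?T = "\<lambda>n. {x :: 'k alg_closure list. length x = n \<and> (\<forall>i<n. x ! i \<noteq> 0)}"
  have T: "?T (Suc n) = {z. length z = 1 + n \<and> take 1 z \<in> ?G \<and> drop 1 z \<in> ?T n}"
  proof -
    have "x \<in> ?T (Suc n) \<longleftrightarrow> x \<in> {z. length z = 1 + n \<and> take 1 z \<in> ?G \<and> drop 1 z \<in> ?T n}" for x
      by (cases x) (auto simp: All_less_Suc2)
    then show ?thesis by blast
  qed
  \<comment> \<open>One polynomial, the product of the coordinates, expresses that none of them
    vanishes.\<close>
  have "?T (Suc n) = {x \<in> {x. length x = Suc n}. (\<Prod>i<Suc n. x ! i) \<noteq> 0}"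
    by (auto simp del: prod.lessThan_Suc)
  also have "affine_locus (Suc n) \<dots>"
    by (intro affine_locus_nonzero affine_locus_UNIV polynomials_prod polynomials_coord) simp
  finally have "affine_locus (Suc n) (?T (Suc n))" .
  moreover have "virtual_class (locus_space (Suc n) (?T (Suc n))) = (virtual_class (affine_space 1) - 1) ^ Suc n"
    using virtual_class_Times[OF G conjunct1[OF Suc]] conjunct2[OF Suc] cG unfolding T by simp
  ultimately show ?case ..
qed


section \<open>The kernel of a linear form\<close>

text \<open>Points \<open>(x, y)\<close> with \<open>x\<close> in \<open>S\<close> and
  \<open>y\<close> in the kernel of the linear form with coefficients \<open>c i x\<close>. The
  fibre is a hyperplane where some coefficient is nonzero and all of \<open>m\<close>-space where
  all vanish.\<close>

definition kernel_bundle ::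
  "nat \<Rightarrow> nat \<Rightarrow> (nat \<Rightarrow> 'k::field alg_closure list \<Rightarrow> 'k alg_closure) \<Rightarrow> 'k alg_closure list set \<Rightarrow> 'k alg_closure list set" where
  "kernel_bundle n m c S =
     {z. length z = n + m \<and> take n z \<in> S \<and> (\<Sum>i<m. c i (take n z) * z ! (n + i)) = 0}"

lemma affine_locus_kernel_bundle:
  assumes S: "affine_locus n S" and c: "\<And>i. i < m \<Longrightarrow> c i \<in> polynomials (coords n)"
  shows "affine_locus (n + m) (kernel_bundle n m c S)"
proof -
  have "kernel_bundle n m c S =
      {z \<in> {z. length z = n + m \<and> take n z \<in> S}. (\<Sum>i<m. c i (take n z) * z ! (n + i)) = 0}"
    by (auto simp: kernel_bundle_def)
  also have "affine_locus (n + m) \<dots>"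
    by (intro affine_locus_zero affine_locus_cylinder S polynomials_sum polynomials.mult polynomials_take[OF c]
        polynomials_coord) auto
  finally show ?thesis .
qed

text \<open>Where the \<open>k\<close>-th coefficient does not vanish, the equation can be solved for the \<open>k\<close>-th variable.\<close>

lemma virtual_class_kernel_bundle:
  fixes S :: "'k::field alg_closure list set"
  assumes S: "affine_locus n S" and k: "k < m" and c: "\<And>i. i < m \<Longrightarrow> c i \<in> polynomials (coords n)"
    and nz: "\<And>x. x \<in> S \<Longrightarrow> c k x \<noteq> 0"
  shows "virtual_class (locus_space (n + m) (kernel_bundle n m c S)) =
    virtual_class (locus_space n S) * virtual_class (affine_space 1) ^ (m - 1)"
proof -
  let ?H = "{y :: 'k alg_closure list. length y = m \<and> y ! k = 0}"
  let ?X = "locus_space (n + m) (kernel_bundle n m c S)"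
  let ?Y = "locus_space (n + m) {z. length z = n + m \<and> take n z \<in> S \<and> drop n z \<in> ?H}"
  \<comment> \<open>\<open>s\<close> omits the \<open>k\<close>-th term, so neither \<open>s\<close>
    nor the solution \<open>t\<close> depends on the entry that the isomorphism overwrites: one
    direction stores \<open>0\<close> there, the other restores \<open>t z\<close>.\<close>
  define s where "s = (\<lambda>z :: 'k alg_closure list. \<Sum>i\<in>{..<m} - {k}. c i (take n z) * z ! (n + i))"
  define t where "t = (\<lambda>z. - (inverse (c k (take n z)) * s z))"
  interpret X: function_space ?X by (rule function_space_locus_space)
  interpret Y: function_space ?Y by (rule function_space_locus_space)
  have s_update: "s (z[n + k := a]) = s z" for z a
    unfolding s_def by (rule sum.cong) auto
  have t_update: "t (z[n + k := a]) = t z" for z a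
    by (simp add: t_def s_update)
  have split: "(\<Sum>i<m. c i (take n z) * z ! (n + i)) = c k (take n z) * z ! (n + k) + s z" for z
    unfolding s_def using k by (intro sum.remove) auto
  have kernel: "(\<Sum>i<m. c i (take n z) * z ! (n + i)) = 0 \<longleftrightarrow> z ! (n + k) = t z" if "take n z \<in> S" for z
    using nz[OF that] unfolding split t_def by (auto simp: field_simps add_eq_0_iff2)
  have "?X \<cong>\<^sub>v ?Y"
  proof (rule isomorphicI)
    show "regular_map ?X ?Y (\<lambda>z. z[n + k := 0])"
    proof (rule regular_map_locus_space[OF function_space_locus_space])
      fix i assume i: "i < n + m"
      show "(\<lambda>z. z[n + k := 0] ! i) \<in> sections ?X (pts ?X)"
      proof (cases "i = n + k")
        case True
        show ?thesis
          by (rule X.sections_cong[OF openin_topspace X.global_sections(1)]) (use True k in auto)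
      next
        case False
        with coordinate_section[OF i] show ?thesis by simp
      qed
    qed (use k in \<open>auto simp: kernel_bundle_def\<close>)
    show "regular_map ?Y ?X (\<lambda>z. z[n + k := t z])"
    proof (rule regular_map_locus_space[OF function_space_locus_space])
      fix i assume i: "i < n + m"
      have p: "(\<lambda>z. c i (take n z)) \<in> sections ?Y (pts ?Y)" if "i < m" for i
        by (intro polynomial_section_locus_space polynomials_take c that) simp
      show "(\<lambda>z. z[n + k := t z] ! i) \<in> sections ?Y (pts ?Y)"
      proof (cases "i = n + k")
        case True
        have "t \<in> sections ?Y (pts ?Y)"
          unfolding t_def s_def by (intro Y.global_sections p coordinate_section k) (use nz in auto)
        then show ?thesis
          by (rule Y.sections_cong[OF openin_topspace]) (use True k in auto)
      next
        case False
        with coordinate_section[OF i] show ?thesis by simp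
      qed
    next
      fix z assume "z \<in> pts ?Y"
      then have "length z = n + m" "take n z \<in> S" by auto
      then show "z[n + k := t z] \<in> kernel_bundle n m c S"
        using kernel[of "z[n + k := t z]"] k by (simp add: kernel_bundle_def t_update)
    qed auto
    show "(z[n + k := 0])[n + k := t (z[n + k := 0])] = z" if "z \<in> pts ?X" for z
    proof -
      have "t z = z ! (n + k)" using that kernel[of z] by (auto simp: kernel_bundle_def)
      then show ?thesis by (simp add: t_update)
    qed
    show "(z[n + k := t z])[n + k := 0] = z" if "z \<in> pts ?Y" for z
    proof -
      have "z ! (n + k) = 0" using that by auto
      then show ?thesis by (metis list_update_id list_update_overwrite)
    qed
  qed
  from virtual_class_cong[OF this] have "virtual_class ?X = virtual_class ?Y" .
  also have "\<dots> = virtual_class (locus_space n S) * virtual_class (locus_space m ?H)"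
  proof (rule virtual_class_Times[OF S])
    have "?H = {y \<in> {y. length y = m}. y ! k = 0}" by auto
    also have "affine_locus m \<dots>" by (intro affine_locus_zero affine_locus_UNIV polynomials_coord k)
    finally show "affine_locus m ?H" .
  qed
  finally show ?thesis by (simp add: virtual_class_hyperplane[OF k])
qed


section \<open>The representation variety in coordinates\<close>

text \<open>Coefficient of the translation part at \<open>i\<close> in the upper right entry of the
  product of squares: the square of \<open>(x, y)\<close> is \<open>(x^2, (1 + x) y)\<close>, and
  the multipliers of the preceding squares scale it. Indices start at 0.\<close>

definition translation_coeff :: "nat \<Rightarrow> 'a::comm_ring_1 list \<Rightarrow> 'a" where
  "translation_coeff i x = (\<Prod>j<i. (x ! j)\<^sup>2) * (1 + x ! i)"

text \<open>The base of the fibration, given by the upper left entry of the product of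
  squares.\<close>

definition square_one_locus :: "nat \<Rightarrow> 'a::comm_ring_1 list set" where
  "square_one_locus r = {x. length x = r \<and> (\<Prod>j<r. (x ! j)\<^sup>2) = 1}"

text \<open>Over a field all \<open>x ! j\<close> with \<open>j < r\<close> are nonzero on the base,
  so for \<open>m \<le> r\<close> these are the points at which the first \<open>m\<close>
  coefficients vanish.\<close>

definition stratum :: "nat \<Rightarrow> nat \<Rightarrow> 'a::comm_ring_1 list set" where
  "stratum r m = {x \<in> square_one_locus r. \<forall>j<m. x ! j = - 1}"

lemma translation_coeff_polynomial: "i < r \<Longrightarrow> translation_coeff i \<in> polynomials (coords r)"
  unfolding translation_coeff_def
  by (intro polynomials.mult polynomials.add polynomials_prod polynomials_power polynomials_coord polynomials_one) simp_all

lemma square_one_nonzero: "x \<in> square_one_locus r \<Longrightarrow> j < r \<Longrightarrow> x ! j \<noteq> (0 :: 'a::field)"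
  unfolding square_one_locus_def
  by (metis (mono_tags, lifting) finite_lessThan lessThan_iff mem_Collect_eq prod_zero zero_neq_one zero_power2)

lemma affine_locus_square_one: "affine_locus r (square_one_locus r)"
proof -
  have "square_one_locus r = {x \<in> {x :: 'a alg_closure list. length x = r}. (\<Prod>j<r. (x ! j)\<^sup>2) - 1 = 0}"
    by (auto simp: square_one_locus_def)
  also have "affine_locus r \<dots>"
    by (intro affine_locus_zero affine_locus_UNIV polynomials_diff polynomials_prod polynomials_power polynomials_coord
        polynomials_one) simp
  finally show ?thesis .
qed

lemma polynomials_plus_one: "i < n \<Longrightarrow> (\<lambda>x. x ! i + 1) \<in> polynomials (coords n)"
  by (intro polynomials.add polynomials_coord polynomials_one)

lemma affine_locus_stratum:
  assumes "m \<le> r" shows "affine_locus r (stratum r m)"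
proof -
  have "stratum r m = {x \<in> square_one_locus r. \<forall>j<m. x ! j + 1 = 0}"
    by (auto simp: stratum_def add_eq_0_iff2)
  also have "affine_locus r \<dots>"
    by (intro affine_locus_all_zero affine_locus_square_one polynomials_plus_one) (use assms in simp)
  finally show ?thesis .
qed

lemma stratum_Suc: "stratum r (Suc m) = {x \<in> stratum r m. x ! m + 1 = 0}"
  by (auto simp: stratum_def less_Suc_eq add_eq_0_iff2)

lemma stratum_top: "stratum r r = {replicate r (- 1)}"
proof -
  have "x = replicate r (- 1)" if "x \<in> stratum r r" for x :: "'a list"
    using that by (intro nth_equalityI) (auto simp: stratum_def square_one_locus_def)
  moreover have "replicate r (- 1) \<in> stratum r r"
    by (auto simp: stratum_def square_one_locus_def)
  ultimately show ?thesis by blast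
qed

abbreviation rep_locus :: "nat \<Rightarrow> 'k::field alg_closure list set \<Rightarrow> 'k alg_closure list set" where
  "rep_locus r \<equiv> kernel_bundle r r translation_coeff"

lemma minus_one_in_range_to_ac: "- 1 \<in> range to_ac"
  using rangeI[of to_ac "- 1"] by simp

text \<open>Passing from \<open>Suc m\<close> to \<open>m\<close> adds to the base the part
  \<open>?G\<close> where coefficient \<open>m\<close> is nonzero, and adds the class of
  \<open>?G\<close> times \<open>q ^ (r - 1)\<close> upstairs. So the class upstairs minus
  \<open>q ^ (r - 1)\<close> times that of the base does not depend on \<open>m\<close>; at
  \<open>m = r\<close> it is \<open>q ^ r - q ^ (r - 1)\<close>.\<close>

lemma virtual_class_rep_locus_stratum:
  fixes q :: "'k::field K0"
  assumes r: "r > 0" and m: "m \<le> r" and q: "q = virtual_class (affine_space 1)"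
  shows "virtual_class (locus_space (r + r) (rep_locus r (stratum r m))) =
    q ^ (r - 1) * (virtual_class (locus_space r (stratum r m :: 'k alg_closure list set)) - 1) + q ^ r"
  using m
proof (induction m rule: inc_induct)
  case base
  have S: "affine_locus r (stratum r r :: 'k alg_closure list set)" by (rule affine_locus_stratum) simp
  have one: "virtual_class (locus_space r (stratum r r :: 'k alg_closure list set)) = 1"
    unfolding stratum_top by (rule virtual_class_singleton) (use minus_one_in_range_to_ac in auto)
  \<comment> \<open>Every coefficient has the factor \<open>1 + (- 1)\<close> at this point, so the
    fibre is the full \<open>r\<close>-space.\<close>
  have "(\<Sum>i<r. translation_coeff i (replicate r (- 1)) * z ! (r + i)) = 0" for z :: "'k alg_closure list"
    by (simp add: translation_coeff_def)
  then have "rep_locus r (stratum r r :: 'k alg_closure list set) = {z. length z = r + r \<and> take r z \<in> stratum r r \<and> drop r z \<in> {y. length y = r}}"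
    by (auto simp: kernel_bundle_def stratum_top)
  then have "virtual_class (locus_space (r + r) (rep_locus r (stratum r r :: 'k alg_closure list set))) = q ^ r"
    using virtual_class_Times[OF S affine_locus_UNIV] one
    by (simp only: virtual_class_whole virtual_class_affine_space[of r] q mult_1)
  with one show ?case by simp
next
  case (step m)
  note m = \<open>m < r\<close>
  let ?F = "stratum r m :: 'k alg_closure list set"
  let ?G = "{x \<in> ?F. x ! m + 1 \<noteq> 0}"
  have F: "affine_locus r ?F" by (rule affine_locus_stratum) (use m in simp)
  have G: "affine_locus r ?G" by (intro affine_locus_nonzero F polynomials_plus_one m)
  \<comment> \<open>The cutting polynomial involves only \<open>x\<close>, so cutting the bundle
    amounts to cutting its base.\<close>
  have cut: "{z \<in> rep_locus r ?F. z ! m + 1 = 0} = rep_locus r (stratum r (Suc m))"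
    "{z \<in> rep_locus r ?F. z ! m + 1 \<noteq> 0} = rep_locus r ?G"
    using m by (auto simp: kernel_bundle_def stratum_Suc)
  have nz: "translation_coeff m x \<noteq> 0" if "x \<in> ?G" for x
  proof -
    have "x \<in> square_one_locus r" "1 + x ! m \<noteq> 0" using that by (auto simp: stratum_def add.commute)
    then show ?thesis using square_one_nonzero[of x r] m by (auto simp: translation_coeff_def)
  qed
  have "virtual_class (locus_space (r + r) (rep_locus r ?F)) =
      virtual_class (locus_space (r + r) (rep_locus r (stratum r (Suc m) :: 'k alg_closure list set))) +
      virtual_class (locus_space (r + r) (rep_locus r ?G))"
    unfolding cut[symmetric]
    by (intro virtual_class_scissor affine_locus_kernel_bundle F translation_coeff_polynomial polynomials_plus_one) (use m in auto)
  also have "virtual_class (locus_space (r + r) (rep_locus r ?G)) = virtual_class (locus_space r ?G) * q ^ (r - 1)"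
    unfolding q by (rule virtual_class_kernel_bundle[where c = translation_coeff, OF G m translation_coeff_polynomial nz])
  also have "virtual_class (locus_space r ?F) =
      virtual_class (locus_space r (stratum r (Suc m) :: 'k alg_closure list set)) + virtual_class (locus_space r ?G)"
    unfolding stratum_Suc by (intro virtual_class_scissor F polynomials_plus_one m)
  then have "virtual_class (locus_space r ?G) = virtual_class (locus_space r ?F) - virtual_class (locus_space r (stratum r (Suc m) :: 'k alg_closure list set))"
    by simp
  finally show ?case unfolding step.IH by (simp add: algebra_simps)
qed

text \<open>The last coordinate is \<open>e\<close> divided by the product of the others, so
  dropping it is an isomorphism onto an \<open>n\<close>-dimensional torus. That \<open>e\<close>
  comes from \<open>k\<close> makes the inverse regular over \<open>k\<close>.\<close>

lemma virtual_class_prod_eq: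
  fixes e :: "'k::field alg_closure"
  assumes e: "e \<in> range to_ac" "e \<noteq> 0"
  shows "virtual_class (locus_space (Suc n) {x. length x = Suc n \<and> (\<Prod>j<Suc n. x ! j) = e}) =
    (virtual_class (affine_space 1 :: ('k, _) fspace) - 1) ^ n"
proof -
  let ?X = "locus_space (Suc n) {x. length x = Suc n \<and> (\<Prod>j<Suc n. x ! j) = e}"
  let ?Y = "locus_space n {x :: 'k alg_closure list. length x = n \<and> (\<forall>i<n. x ! i \<noteq> 0)}"
  let ?p = "\<lambda>x :: 'k alg_closure list. \<Prod>j<n. x ! j"
  interpret X: function_space ?X by (rule function_space_locus_space)
  interpret Y: function_space ?Y by (rule function_space_locus_space)
  have "?X \<cong>\<^sub>v ?Y"
  proof (rule isomorphicI)
    show "regular_map ?X ?Y (take n)"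
    proof (rule regular_map_locus_space[OF function_space_locus_space])
      fix i assume "i < n"
      then show "(\<lambda>x. take n x ! i) \<in> sections ?X (pts ?X)"
        using coordinate_section[of i "Suc n"] by simp
    qed (use e(2) in auto)
    show "regular_map ?Y ?X (\<lambda>x. x @ [e * inverse (?p x)])"
    proof (rule regular_map_locus_space[OF function_space_locus_space])
      fix i assume i: "i < Suc n"
      show "(\<lambda>x. (x @ [e * inverse (?p x)]) ! i) \<in> sections ?Y (pts ?Y)"
      proof (cases "i = n")
        case True
        have "(\<lambda>x. e * inverse (?p x)) \<in> sections ?Y (pts ?Y)"
        proof -
          have "?p \<in> sections ?Y (pts ?Y)"
            by (intro Y.global_sections(9) coordinate_section) simp
          then have "(\<lambda>x. inverse (?p x)) \<in> sections ?Y (pts ?Y)"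
            by (rule Y.global_sections(11)) auto
          moreover have "(\<lambda>_. e) \<in> sections ?Y (pts ?Y)" using e(1) Y.global_sections(3) by auto
          ultimately show ?thesis by (rule Y.global_sections(5)[rotated])
        qed
        then show ?thesis
          by (rule Y.sections_cong[OF openin_topspace]) (auto simp: nth_append True)
      next
        case False
        with i have "i < n" by simp
        from coordinate_section[OF this] show ?thesis
          by (rule Y.sections_cong[OF openin_topspace]) (use \<open>i < n\<close> in \<open>auto simp: nth_append\<close>)
      qed
    qed (auto simp: nth_append)
    show "take n x @ [e * inverse (?p (take n x))] = x" if "x \<in> pts ?X" for x
    proof -
      have x: "length x = Suc n" "?p x * x ! n = e" using that by auto
      then have "?p x \<noteq> 0" using e(2) by auto
      with x(2) have "e * inverse (?p x) = x ! n" by (auto simp: field_simps)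
      then have "e * inverse (?p (take n x)) = x ! n" by simp
      then show ?thesis using x(1) by (metis lessI take_Suc_conv_app_nth take_all_iff order_refl)
    qed
  qed auto
  from virtual_class_cong[OF this] show ?thesis by (simp only: virtual_class_torus)
qed

text \<open>The product of the coordinates squares to \<open>1\<close>, so it is \<open>1\<close> or
  \<open>- 1\<close>. These values differ, and each contributes a torus of dimension
  \<open>r - 1\<close>.\<close>

lemma virtual_class_square_one_locus:
  assumes "CHAR('k::field) \<noteq> 2" "r > 0"
  shows "virtual_class (locus_space r (square_one_locus r :: 'k alg_closure list set)) =
    2 * (virtual_class (affine_space 1) - 1) ^ (r - 1)"
proof -
  obtain n where r: "r = Suc n" using assms(2) by (cases r) auto
  let ?T = "square_one_locus r :: 'k alg_closure list set"
  let ?p = "\<lambda>x :: 'k alg_closure list. (\<Prod>j<r. x ! j)"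
  \<comment> \<open>A divisor of 2 other than 2 is 1, and characteristic 1 would force
    \<open>1 = 0\<close>.\<close>
  have "(2 :: 'k) \<noteq> 0"
  proof
    assume "(2 :: 'k) = 0"
    then have "CHAR('k) dvd 2" using of_nat_eq_0_iff_char_dvd[of 2, where 'a = 'k] by simp
    moreover from this have "CHAR('k) \<le> 2" "CHAR('k) \<noteq> 0" using dvd_imp_le[of "CHAR('k)" 2] by (auto intro: Nat.gr0I)
    ultimately have "CHAR('k) = 1" using assms(1) by linarith
    then have "of_nat 1 = (0 :: 'k)" by (subst of_nat_eq_0_iff_char_dvd) simp
    then show False by simp
  qed
  then have "(2 :: 'k alg_closure) \<noteq> 0" by (metis to_ac_eq_0_iff to_ac_numeral)
  then have ne: "(1 :: 'k alg_closure) \<noteq> - 1" by (metis add.right_inverse one_add_one)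
  have T: "?T = {x. length x = r \<and> (?p x)\<^sup>2 = 1}"
    by (simp add: square_one_locus_def prod_power_distrib)
  have "{x \<in> ?T. ?p x - 1 = 0} = {x. length x = r \<and> ?p x = 1}"
    "{x \<in> ?T. ?p x - 1 \<noteq> 0} = {x. length x = r \<and> ?p x = - 1}"
    using ne unfolding T by (auto simp: power2_eq_1_iff)
  moreover have "virtual_class (locus_space r ?T) =
      virtual_class (locus_space r {x \<in> ?T. ?p x - 1 = 0}) + virtual_class (locus_space r {x \<in> ?T. ?p x - 1 \<noteq> 0})"
    by (intro virtual_class_scissor affine_locus_square_one polynomials_diff polynomials_prod polynomials_coord
        polynomials_one) simp
  ultimately have "virtual_class (locus_space r ?T) =
      (virtual_class (affine_space 1) - 1) ^ n + (virtual_class (affine_space 1) - 1) ^ n"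
    using virtual_class_prod_eq[of "1 :: 'k alg_closure" n] virtual_class_prod_eq[of "- 1 :: 'k alg_closure" n]
      minus_one_in_range_to_ac[where 'a = 'k] rangeI[of to_ac "1 :: 'k"]
    unfolding r by simp
  then show ?thesis by (simp add: r distrib_right flip: one_add_one)
qed


section \<open>Retracts\<close>

text \<open>A section is a fraction only near \<open>x\<close>. Multiplying numerator and
  denominator by a polynomial whose nonvanishing set lies in that neighbourhood makes the fraction
  valid wherever the new denominator is nonzero.\<close>

lemma local_fraction:
  assumes f: "f \<in> sections (induced (zariski C S) T) (pts (induced (zariski C S) T))"
    and x: "x \<in> S" "x \<in> T"
  obtains p h where "p \<in> polynomials C" "h \<in> polynomials C" "h x \<noteq> 0"
    "\<And>y. y \<in> S \<Longrightarrow> y \<in> T \<Longrightarrow> h y \<noteq> 0 \<Longrightarrow> f y = p y / h y"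
proof -
  note fd = fraction_data_zariski[of S C]
  have "x \<in> pts (induced (zariski C S) T)" using x by simp
  from induced_at[OF f this] obtain V g where V: "openin (topol (zariski C S)) V" "x \<in> V"
    and g: "g \<in> sections (zariski C S) V" and fg: "\<forall>y \<in> pts (induced (zariski C S) T) \<inter> V. f y = g y"
    by blast
  obtain p h where p: "p \<in> polynomials C" and h: "h \<in> polynomials C" "h x \<noteq> 0"
    and gp: "\<forall>y \<in> V \<inter> S. h y \<noteq> 0 \<longrightarrow> g y = p y / h y"
    by (rule fraction_data.section_at[OF fd g[unfolded zariski_def] V(2)]) auto
  obtain k where k: "k \<in> polynomials C" "k x \<noteq> 0" "{y \<in> S. k y \<noteq> 0} \<subseteq> V"
    using V unfolding zariski_def fraction_data.openin_iff[OF fd] by auto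
  show thesis
  proof (rule that)
    show "(\<lambda>y. p y * k y) \<in> polynomials C" "(\<lambda>y. h y * k y) \<in> polynomials C"
      using p h k by (auto intro: polynomials.mult)
    show "h x * k x \<noteq> 0" using h k by simp
    show "f y = p y * k y / (h y * k y)" if "y \<in> S" "y \<in> T" "h y * k y \<noteq> 0" for y
      using that k(3) fg gp by auto
  qed
qed

text \<open>
  If \<open>f\<close> equals \<open>p / h\<close> where \<open>h\<close> does not vanish, then \<open>h (h f - p) = 0\<close> everywhere. Hence a homomorphism that
  does not kill \<open>h\<close> has to map \<open>f\<close> to the value of \<open>p / h\<close>, and no Nullstellensatz is needed.
\<close>

lemma Spec_retract:
  fixes X :: "('k::field, 'a) fspace"
  assumes X: "function_space X" and P: "P \<subseteq> polynomials (coords n)"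
    and \<pi>: "regular_map X (locus_space n (zero_set n P)) \<pi>" and \<sigma>: "regular_map (locus_space n (zero_set n P)) X \<sigma>"
    and \<pi>\<sigma>: "\<And>x. x \<in> zero_set n P \<Longrightarrow> \<pi> (\<sigma> x) = x"
  shows "Spec (pts X) {f \<in> sections X (pts X). \<forall>z \<in> pts X. f z = f (\<sigma> (\<pi> z))} \<cong>\<^sub>v locus_space n (zero_set n P)"
proof -
  let ?Z = "zero_set n P"
  let ?T = "locus_space n ?Z"
  \<comment> \<open>Functions that factor through the retraction; composition with
    \<open>\<sigma>\<close> and with \<open>\<pi>\<close> identifies them with the regular functions
    on \<open>?Z\<close>.\<close>
  define A where "A = {f \<in> sections X (pts X). \<forall>z \<in> pts X. f z = f (\<sigma> (\<pi> z))}"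
  define \<xi> where "\<xi> = (\<lambda>i z. \<pi> z ! i)"
  interpret X: function_space X by fact
  interpret T: function_space ?T by (rule function_space_locus_space)
  have pts_T: "pts ?T = ?Z" by (auto simp: zero_set_def)
  have \<sigma>_pts: "\<sigma> x \<in> pts X" if "x \<in> ?Z" for x
    using regular_map_pts[OF \<sigma>, of x] that unfolding pts_T .
  have \<pi>_pts: "\<pi> z \<in> ?Z" if "z \<in> pts X" for z
    using regular_map_pts[OF \<pi> that] unfolding pts_T .
  have A_const: "(\<lambda>_. to_ac c) \<in> A" for c
    by (simp add: A_def X.global_sections)
  have A_add: "(\<lambda>z. f z + g z) \<in> A" and A_mult: "(\<lambda>z. f z * g z) \<in> A" if "f \<in> A" "g \<in> A" for f g
    using that unfolding A_def by (auto intro: X.global_sections)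
  have A_\<xi>: "\<xi> i \<in> A" if "i < n" for i
    using coordinate_pullback[OF regular_map_compose[OF \<pi> regular_map_inclusion[OF function_space_affine_space]] that]
    by (simp add: A_def \<xi>_def \<pi>\<sigma> \<pi>_pts)
  have A_section: "(\<lambda>x. f (\<sigma> x)) \<in> sections ?T (pts ?T)" if "f \<in> A" for f
  proof -
    have "(\<lambda>x. f (\<sigma> x)) \<in> sections ?T {x \<in> pts ?T. \<sigma> x \<in> pts X}"
      using that by (intro regular_map_section[OF \<sigma>]) (auto simp: A_def)
    moreover have "{x \<in> pts ?T. \<sigma> x \<in> pts X} = pts ?T" using \<sigma>_pts unfolding pts_T by auto
    ultimately show ?thesis by simp
  qed
  have A_polynomial: "(\<lambda>z. p (\<pi> z)) \<in> A" if "p \<in> polynomials (coords n)" for p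
    using that
  proof induction
    case (coord c)
    then show ?case using A_\<xi> by (auto simp: coords_def \<xi>_def)
  qed (auto intro: A_const A_add A_mult)
  \<comment> \<open>The inverse maps between \<open>?Z\<close> and the spectrum: \<open>ev x\<close>
    evaluates at \<open>\<sigma> x\<close>, restricted to \<open>A\<close> so as to be extensional,
    and \<open>pt\<close> reads off the values on the pulled back coordinates
    \<open>\<xi> i\<close>.\<close>
  define ev where "ev = (\<lambda>x. restrict (\<lambda>f. f (\<sigma> x)) A)"
  define pt where "pt = (\<lambda>\<phi> :: ('a \<Rightarrow> 'k alg_closure) \<Rightarrow> 'k alg_closure. map (\<lambda>i. \<phi> (\<xi> i)) [0..<n])"
  have hom_polynomial: "\<phi> (\<lambda>z. p (\<pi> z)) = p (pt \<phi>)"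
    if \<phi>: "\<phi> \<in> algebra_homs (pts X) A" and p: "p \<in> polynomials (coords n)" for \<phi> p
    using p
  proof induction
    case (coord c)
    then obtain i where "i < n" "c = (\<lambda>x. x ! i)" by (auto simp: coords_def)
    then show ?case by (simp add: pt_def \<xi>_def)
  qed (use \<phi> A_polynomial in \<open>auto simp: algebra_homs_def\<close>)
  have hom_cong: "\<phi> f = \<phi> g"
    if "\<phi> \<in> algebra_homs (pts X) A" "f \<in> A" "g \<in> A" "\<And>z. z \<in> pts X \<Longrightarrow> f z = g z" for \<phi> f g
    using that unfolding algebra_homs_def by blast
  have pt_Z: "pt \<phi> \<in> ?Z" if \<phi>: "\<phi> \<in> algebra_homs (pts X) A" for \<phi>
  proof -
    have "p (pt \<phi>) = 0" if p: "p \<in> P" for p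
    proof -
      have pC: "p \<in> polynomials (coords n)" using p P by blast
      have "p (\<pi> z) = to_ac 0" if "z \<in> pts X" for z
        using \<pi>_pts[OF that] p by (simp add: zero_set_def)
      then have "\<phi> (\<lambda>z. p (\<pi> z)) = \<phi> (\<lambda>_. to_ac 0)"
        by (rule hom_cong[OF \<phi> A_polynomial[OF pC] A_const])
      also have "\<dots> = 0" using \<phi> by (simp add: algebra_homs_def del: to_ac_0)
      finally show ?thesis using hom_polynomial[OF \<phi> pC] by simp
    qed
    then show ?thesis by (simp add: zero_set_def pt_def)
  qed
  \<comment> \<open>The fraction is taken near \<open>pt \<phi>\<close>, so that
    \<open>\<phi>\<close> does not kill the denominator: its value there is
    \<open>h (pt \<phi>)\<close>.\<close>
  have hom_eq: "\<phi> f = f (\<sigma> (pt \<phi>))" if \<phi>: "\<phi> \<in> algebra_homs (pts X) A" and f: "f \<in> A" for \<phi> f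
  proof -
    have x: "pt \<phi> \<in> {x. length x = n}" "pt \<phi> \<in> ?Z" using pt_Z[OF \<phi>] by (auto simp: zero_set_def)
    obtain p h where p: "p \<in> polynomials (coords n)" and h: "h \<in> polynomials (coords n)" "h (pt \<phi>) \<noteq> 0"
      and fp: "\<And>y. y \<in> {x. length x = n} \<Longrightarrow> y \<in> ?Z \<Longrightarrow> h y \<noteq> 0 \<Longrightarrow> f (\<sigma> y) = p y / h y"
      using local_fraction[OF A_section[OF f, unfolded affine_space_def] x] by blast
    let ?h = "\<lambda>z. h (\<pi> z)" and ?p = "\<lambda>z. p (\<pi> z)"
    note mem = A_polynomial[OF h(1)] A_polynomial[OF p] f A_mult[OF A_polynomial[OF h(1)] f]
    have "?h z * (?h z * f z) = ?h z * ?p z" if z: "z \<in> pts X" for z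
    proof (cases "?h z = 0")
      case False
      have "f z = f (\<sigma> (\<pi> z))" using f z by (simp add: A_def)
      also have "\<dots> = ?p z / ?h z" using fp[of "\<pi> z"] \<pi>_pts[OF z] False by (simp add: zero_set_def)
      finally show ?thesis using False by simp
    qed simp
    then have "\<phi> (\<lambda>z. ?h z * (?h z * f z)) = \<phi> (\<lambda>z. ?h z * ?p z)"
      by (rule hom_cong[OF \<phi> A_mult[OF mem(1,4)] A_mult[OF mem(1,2)]])
    moreover have mult: "\<phi> (\<lambda>z. g z * k z) = \<phi> g * \<phi> k" if "g \<in> A" "k \<in> A" for g k
      using \<phi> that unfolding algebra_homs_def by blast
    ultimately have "h (pt \<phi>) * (h (pt \<phi>) * \<phi> f) = h (pt \<phi>) * p (pt \<phi>)"
      by (simp add: mult[OF mem(1,4)] mult[OF mem(1,2)] mult[OF mem(1,3)] hom_polynomial[OF \<phi>] h p)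
    then have "\<phi> f = p (pt \<phi>) / h (pt \<phi>)" using h(2) by (simp add: field_simps)
    then show ?thesis using fp[OF x h(2)] by simp
  qed
  have ev_hom: "ev x \<in> algebra_homs (pts X) A" if "x \<in> ?Z" for x
    using \<sigma>_pts[OF that] A_const A_add A_mult by (auto simp: algebra_homs_def ev_def)
  let ?C = "{\<lambda>\<phi> :: ('a \<Rightarrow> 'k alg_closure) \<Rightarrow> 'k alg_closure. \<phi> f | f. f \<in> A}"
  have "Spec (pts X) A \<cong>\<^sub>v ?T"
  proof (rule isomorphicI)
    show "regular_map (Spec (pts X) A) ?T pt"
      unfolding Spec_def
    proof (rule regular_map_locus_space[OF function_space_zariski])
      fix i assume "i < n"
      then have "(\<lambda>\<phi>. \<phi> (\<xi> i)) \<in> polynomials ?C"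
        using A_\<xi> by (intro polynomials.coord) auto
      from polynomial_section[OF this order_refl, of "algebra_homs (pts X) A"] \<open>i < n\<close>
      show "(\<lambda>\<phi>. pt \<phi> ! i) \<in> sections (zariski ?C (algebra_homs (pts X) A))
          (pts (zariski ?C (algebra_homs (pts X) A)))"
        by (simp add: pt_def)
    qed (use pt_Z in \<open>auto simp: pt_def\<close>)
    show "regular_map ?T (Spec (pts X) A) ev"
      unfolding Spec_def
    proof (rule regular_map_zariski[OF function_space_locus_space])
      show "ev x \<in> algebra_homs (pts X) A" if "x \<in> pts ?T" for x using that unfolding pts_T by (rule ev_hom)
      fix c assume "c \<in> ?C"
      then obtain f where "f \<in> A" "c = (\<lambda>\<phi>. \<phi> f)" by blast
      with A_section show "(\<lambda>x. c (ev x)) \<in> sections ?T (pts ?T)" by (simp add: ev_def)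
    qed
    show "ev (pt \<phi>) = \<phi>" if "\<phi> \<in> pts (Spec (pts X) A)" for \<phi>
    proof -
      have \<phi>: "\<phi> \<in> algebra_homs (pts X) A" using that by (simp add: Spec_def)
      then have "\<phi> \<in> extensional A" by (simp add: algebra_homs_def)
      with hom_eq[OF \<phi>] show ?thesis unfolding ev_def by (auto simp: fun_eq_iff extensional_def)
    qed
    show "pt (ev x) = x" if "x \<in> pts ?T" for x
    proof -
      have x: "x \<in> ?Z" "length x = n" using that by auto
      have "ev x (\<xi> i) = x ! i" if "i < n" for i
        using A_\<xi>[OF that] \<pi>\<sigma>[OF x(1)] by (simp add: ev_def) (simp add: \<xi>_def)
      then show ?thesis by (intro nth_equalityI) (simp_all add: pt_def x)
    qed
  qed
  then show ?thesis by (simp only: A_def)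
qed

section \<open>Functions along curves with polynomial coordinates\<close>

lemma infinite_UNIV_alg_closed: "infinite (UNIV :: 'a::alg_closed_field set)"
proof
  assume fin: "finite (UNIV :: 'a set)"
  \<comment> \<open>If the field is finite, \<open>?P\<close> vanishes everywhere; then
    \<open>?P + 1\<close> has positive degree but no root.\<close>
  let ?P = "\<Prod>a\<in>UNIV. [:- a, 1 :: 'a:]"
  have "Polynomial.degree ?P = CARD('a)" by (subst degree_prod_sum_eq) auto
  moreover have "CARD('a) > 0" using fin by (simp add: card_gt_0_iff)
  ultimately have "Polynomial.degree (?P + 1) > 0" by (subst degree_add_eq_left) auto
  from alg_closed_imp_poly_has_root[OF this] obtain x where "poly (?P + 1) x = 0" by blast
  moreover have "poly ?P x = 0" unfolding poly_prod using fin by (intro prod_zero) (auto intro!: bexI[of _ x])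
  ultimately show False by simp
qed

lemma polynomial_curve:
  fixes p :: "'a \<Rightarrow> 'k::field alg_closure"
  assumes "p \<in> polynomials C" and "\<And>c. c \<in> C \<Longrightarrow> \<exists>Q. \<forall>t. c (\<gamma> t) = poly Q t"
  shows "\<exists>Q. \<forall>t. p (\<gamma> t) = poly Q t"
  using assms(1)
proof induction
  case (const c)
  show ?case by (intro exI[of _ "[:to_ac c:]"]) simp
next
  case (add f g)
  then show ?case by (metis poly_add)
next
  case (mult f g)
  then show ?case by (metis poly_mult)
qed (rule assms(2))

text \<open>Near \<open>0\<close> the function is \<open>P / H\<close> along the curve, and \<open>P = v H\<close> holds at infinitely many points.\<close>

lemma section_constant_on_curve:
  fixes f :: "'a \<Rightarrow> 'k::field alg_closure"
  assumes f: "f \<in> sections (induced (zariski C S) T) (pts (induced (zariski C S) T))"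
    and \<gamma>: "\<And>t. \<gamma> t \<in> S \<inter> T" and C: "\<And>c. c \<in> C \<Longrightarrow> \<exists>Q. \<forall>t. c (\<gamma> t) = poly Q t"
    and const: "\<And>t. t \<noteq> 0 \<Longrightarrow> f (\<gamma> t) = v"
  shows "f (\<gamma> 0) = v"
proof -
  obtain p h where p: "p \<in> polynomials C" and h: "h \<in> polynomials C" "h (\<gamma> 0) \<noteq> 0"
    and fp: "\<And>y. y \<in> S \<Longrightarrow> y \<in> T \<Longrightarrow> h y \<noteq> 0 \<Longrightarrow> f y = p y / h y"
    using local_fraction[OF f, of "\<gamma> 0"] \<gamma> by blast
  obtain P where P: "\<And>t. p (\<gamma> t) = poly P t" using polynomial_curve[where \<gamma> = \<gamma>, OF p] C by blast
  obtain H where H: "\<And>t. h (\<gamma> t) = poly H t" using polynomial_curve[where \<gamma> = \<gamma>, OF h(1)] C by blast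
  let ?Q = "(P - Polynomial.smult v H) * ([:0, 1:] * H)"
  have "poly ?Q t = 0" for t
    using fp[of "\<gamma> t"] \<gamma>[of t] const[of t] by (cases "poly H t = 0 \<or> t = 0") (auto simp: P H field_simps)
  then have "{t. poly ?Q t = 0} = UNIV" by blast
  with poly_roots_finite[of ?Q] have "?Q = 0"
    using infinite_UNIV_alg_closed[where 'a = "'k alg_closure"] by argo
  moreover have "H \<noteq> 0" using h(2) H by auto
  ultimately have "P = Polynomial.smult v H" by simp
  then have "p (\<gamma> 0) = v * h (\<gamma> 0)" by (simp add: P H)
  then show ?thesis using fp[of "\<gamma> 0"] \<gamma>[of 0] h(2) by simp
qed


section \<open>Tuples of affine transformations\<close>

definition affine_matrix :: "'a::semiring_1 \<Rightarrow> 'a \<Rightarrow> 'a^2^2" where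
  "affine_matrix x y = vector [vector [x, y], vector [0, 1]]"

lemma affine_matrix_entries [simp]:
  "affine_matrix x y $ 1 $ 1 = x" "affine_matrix x y $ 1 $ 2 = y"
  "affine_matrix x y $ 2 $ 1 = 0" "affine_matrix x y $ 2 $ 2 = 1"
  by (simp_all add: affine_matrix_def)

lemma affine_matrix_mult: "affine_matrix x y ** affine_matrix x' y' = affine_matrix (x * x') (x * y' + y)"
  by (simp add: vec_eq_iff forall_2 matrix_matrix_mult_def sum_2)

lemma mat_1_affine_matrix: "mat 1 = affine_matrix 1 0"
  by (simp add: vec_eq_iff forall_2 mat_def)

lemma affine_matrix_eq_iff: "affine_matrix x y = affine_matrix x' y' \<longleftrightarrow> x = x' \<and> y = y'"
  by (metis affine_matrix_entries(1,2))

lemma matrix_inv_affine_matrix: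
  fixes a b :: "'a::field"
  assumes "a \<noteq> 0"
  shows "matrix_inv (affine_matrix a b) = affine_matrix (inverse a) (- (inverse a * b))" (is "matrix_inv ?A = ?B")
    and "affine_matrix a b ** matrix_inv (affine_matrix a b) = mat 1"
    and "matrix_inv (affine_matrix a b) ** affine_matrix a b = mat 1"
proof -
  have AB: "?A ** ?B = mat 1" and BA: "?B ** ?A = mat 1"
    using assms by (simp_all add: affine_matrix_mult mat_1_affine_matrix affine_matrix_eq_iff flip: mult.assoc)
  \<comment> \<open>\<open>matrix_inv\<close> is a choice among two-sided inverses;
    \<open>?B\<close> shows that one exists, and uniqueness then identifies the choice.\<close>
  have inv: "?A ** matrix_inv ?A = mat 1 \<and> matrix_inv ?A ** ?A = mat 1"
    unfolding matrix_inv_def by (rule someI[of _ ?B]) (simp add: AB BA)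
  then show "?A ** matrix_inv ?A = mat 1" "matrix_inv ?A ** ?A = mat 1" by simp_all
  have "matrix_inv ?A = ?B ** (?A ** matrix_inv ?A)" by (simp add: matrix_mul_assoc BA)
  then show "matrix_inv ?A = ?B" using inv by simp
qed

lemma conjugate_affine_matrix:
  fixes a b :: "'a::field"
  assumes "a \<noteq> 0"
  shows "affine_matrix a b ** affine_matrix x y ** matrix_inv (affine_matrix a b) = affine_matrix x (a * y + b * (1 - x))"
  using assms by (simp add: matrix_inv_affine_matrix(1) affine_matrix_mult affine_matrix_eq_iff field_simps)

lemma AGL1_iff: "A \<in> AGL1 \<longleftrightarrow> A $ 1 $ 1 \<noteq> 0 \<and> A = affine_matrix (A $ 1 $ 1) (A $ 1 $ 2)"
proof
  assume "A \<in> AGL1"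
  then obtain x y where "A = affine_matrix x y" "x \<noteq> 0" by (auto simp: AGL1_def affine_matrix_def)
  then show "A $ 1 $ 1 \<noteq> 0 \<and> A = affine_matrix (A $ 1 $ 1) (A $ 1 $ 2)" by simp
qed (auto simp: AGL1_def affine_matrix_def)

lemma affine_matrix_in_AGL1: "affine_matrix x y \<in> AGL1 \<longleftrightarrow> x \<noteq> 0"
  by (simp add: AGL1_iff)

text \<open>The first \<open>r\<close> entries are the multipliers and the last \<open>r\<close> the
  translation parts, which is the layout of \<open>kernel_bundle r r\<close>.\<close>

definition affine_tuple :: "nat \<Rightarrow> 'a::semiring_1 list \<Rightarrow> ('a^2^2) list" where
  "affine_tuple r z = map (\<lambda>i. affine_matrix (z ! i) (z ! (r + i))) [0..<r]"

definition tuple_coords :: "nat \<Rightarrow> ('a^2^2) list \<Rightarrow> 'a::semiring_1 list" where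
  "tuple_coords r As = map (\<lambda>i. As ! i $ 1 $ 1) [0..<r] @ map (\<lambda>i. As ! i $ 1 $ 2) [0..<r]"

lemma length_affine_tuple [simp]: "length (affine_tuple r z) = r"
  by (simp add: affine_tuple_def)

lemma nth_affine_tuple [simp]: "i < r \<Longrightarrow> affine_tuple r z ! i = affine_matrix (z ! i) (z ! (r + i))"
  by (simp add: affine_tuple_def)

lemma length_tuple_coords [simp]: "length (tuple_coords r As) = r + r"
  by (simp add: tuple_coords_def)

lemma nth_tuple_coords [simp]:
  "i < r \<Longrightarrow> tuple_coords r As ! i = As ! i $ 1 $ 1" "i < r \<Longrightarrow> tuple_coords r As ! (r + i) = As ! i $ 1 $ 2"
  by (simp_all add: tuple_coords_def nth_append)

text \<open>Splitting off the first matrix shifts the indices of the rest, hence the induction over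
  arbitrary \<open>x\<close> and \<open>y\<close>. The first square scales the translation of the
  rest by \<open>(x 0)^2\<close>, which extends each partial product.\<close>

lemma foldr_squares_affine_matrix:
  fixes x y :: "nat \<Rightarrow> 'a::comm_ring_1"
  shows "foldr (\<lambda>A B. A ** A ** B) (map (\<lambda>i. affine_matrix (x i) (y i)) [0..<n]) (mat 1) =
    affine_matrix (\<Prod>i<n. (x i)\<^sup>2) (\<Sum>i<n. (\<Prod>j<i. (x j)\<^sup>2) * (1 + x i) * y i)"
proof (induction n arbitrary: x y)
  case 0
  show ?case by (simp add: mat_1_affine_matrix)
next
  case (Suc n)
  have "map (\<lambda>i. affine_matrix (x i) (y i)) [0..<Suc n] =
      affine_matrix (x 0) (y 0) # map (\<lambda>i. affine_matrix (x (Suc i)) (y (Suc i))) [0..<n]"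
    by (simp add: upt_conv_Cons map_Suc_upt[symmetric] del: upt_Suc)
  then show ?case
    by (simp only: foldr.simps o_apply Suc.IH affine_matrix_mult affine_matrix_eq_iff prod.lessThan_Suc_shift
        sum.lessThan_Suc_shift)
      (simp add: power2_eq_square sum_distrib_left algebra_simps)
qed

lemma foldr_squares_affine_tuple:
  fixes z :: "'a::comm_ring_1 list"
  assumes "length z = r + r"
  shows "foldr (\<lambda>A B. A ** A ** B) (affine_tuple r z) (mat 1) =
    affine_matrix (\<Prod>i<r. (take r z ! i)\<^sup>2) (\<Sum>i<r. translation_coeff i (take r z) * z ! (r + i))"
  unfolding affine_tuple_def foldr_squares_affine_matrix affine_matrix_eq_iff
  using assms by (auto intro!: prod.cong sum.cong simp: translation_coeff_def)

section \<open>Representations in coordinates\<close>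

abbreviation representations :: "nat \<Rightarrow> ('k::field alg_closure^2^2) list set" where
  "representations r \<equiv> {As. length As = r \<and> set As \<subseteq> AGL1 \<and> foldr (\<lambda>A B. A ** A ** B) As (mat 1) = mat 1}"

lemma affine_tuple_coords:
  assumes "length As = r" "set As \<subseteq> AGL1" shows "affine_tuple r (tuple_coords r As) = As"
proof (rule nth_equalityI)
  fix i assume "i < length (affine_tuple r (tuple_coords r As))"
  then have "As ! i \<in> AGL1" "i < r" using assms by auto
  then show "affine_tuple r (tuple_coords r As) ! i = As ! i" using AGL1_iff[of "As ! i"] by simp
qed (simp add: assms)

lemma affine_tuple_representation_iff:
  fixes z :: "'k::field alg_closure list"
  assumes z: "length z = r + r"
  shows "affine_tuple r z \<in> representations r \<longleftrightarrow> z \<in> rep_locus r (square_one_locus r)"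
proof -
  have "affine_tuple r z \<in> representations r \<longleftrightarrow> (\<forall>i<r. z ! i \<noteq> 0) \<and>
      foldr (\<lambda>A B. A ** A ** B) (affine_tuple r z) (mat 1) = mat 1"
    by (auto simp: affine_tuple_def affine_matrix_in_AGL1 image_subset_iff)
  also have "\<dots> \<longleftrightarrow> (\<forall>i<r. z ! i \<noteq> 0) \<and> z \<in> rep_locus r (square_one_locus r)"
    unfolding foldr_squares_affine_tuple[OF z] unfolding mat_1_affine_matrix affine_matrix_eq_iff
    using z by (simp add: kernel_bundle_def square_one_locus_def)
  \<comment> \<open>Multipliers whose squares have product \<open>1\<close> are nonzero, so
    membership in \<open>AGL1\<close> follows from the equations.\<close>
  also have "\<dots> \<longleftrightarrow> z \<in> rep_locus r (square_one_locus r)"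
    using square_one_nonzero[of "take r z" r] by (auto simp: kernel_bundle_def)
  finally show ?thesis .
qed

abbreviation rep_var :: "nat \<Rightarrow> ('k::field, ('k alg_closure^2^2) list) fspace" where
  "rep_var r \<equiv> representation_variety AGL1 r"

lemma function_space_rep_var: "function_space (rep_var r)"
  unfolding representation_variety_def matrix_tuples_def by (intro function_space_induced function_space_zariski)

lemma pts_rep_var: "pts (rep_var r) = representations r"
  by (auto simp: representation_variety_def matrix_tuples_def)

lemma matrix_entry_section: "i < r \<Longrightarrow> (\<lambda>As. As ! i $ a $ b) \<in> sections (rep_var r) (pts (rep_var r))"
  unfolding representation_variety_def matrix_tuples_def
  by (rule polynomial_section_induced, rule polynomials.coord) blast

lemma regular_map_affine_tuple:
  assumes Z: "function_space Z"
    and f: "\<And>i. i < r + r \<Longrightarrow> (\<lambda>z. f z ! i) \<in> sections Z (pts Z)"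
    and rep: "\<And>z. z \<in> pts Z \<Longrightarrow> affine_tuple r (f z) \<in> representations r"
  shows "regular_map Z (rep_var r) (\<lambda>z. affine_tuple r (f z))"
  unfolding representation_variety_def
proof (rule regular_map_into_induced[OF Z _ rep])
  interpret Z: function_space Z by fact
  show "regular_map Z (matrix_tuples r) (\<lambda>z. affine_tuple r (f z))"
    unfolding matrix_tuples_def
  proof (rule regular_map_zariski[OF Z])
    fix c assume "c \<in> {\<lambda>As :: ('a alg_closure^2^2) list. As ! i $ a $ b | i a b. i < r}"
    then obtain i a b where i: "i < r" "c = (\<lambda>As. As ! i $ a $ b)" by blast
    show "(\<lambda>z. c (affine_tuple r (f z))) \<in> sections Z (pts Z)"
      using f[of i] f[of "r + i"] i(1) exhaust_2[of a] exhaust_2[of b]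
      by (auto simp: i(2) intro: Z.global_sections)
  qed simp
qed

lemma rep_var_isomorphic: "rep_var r \<cong>\<^sub>v locus_space (r + r) (rep_locus r (square_one_locus r))"
proof (rule isomorphicI)
  let ?R = "locus_space (r + r) (rep_locus r (square_one_locus r)) :: ('a, 'a alg_closure list) fspace"
  have tc: "affine_tuple r (tuple_coords r As) = As" if "As \<in> pts (rep_var r)" for As :: "('a alg_closure^2^2) list"
    using that unfolding pts_rep_var by (intro affine_tuple_coords) auto
  show "regular_map (rep_var r) ?R (tuple_coords r)"
  proof (rule regular_map_locus_space[OF function_space_rep_var])
    show "tuple_coords r As \<in> rep_locus r (square_one_locus r)" if "As \<in> pts (rep_var r)" for As :: "('a alg_closure^2^2) list"
      using affine_tuple_representation_iff[of "tuple_coords r As" r] tc[OF that] that unfolding pts_rep_var by simp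
    fix i assume i: "i < r + r"
    show "(\<lambda>As. tuple_coords r As ! i) \<in> sections (rep_var r :: ('a, _) fspace) (pts (rep_var r))"
    proof (cases "i < r")
      case True
      then show ?thesis using matrix_entry_section[of i r 1 1] by simp
    next
      case False
      then obtain j where "i = r + j" "j < r" using i by (metis add_less_cancel_left le_Suc_ex not_less)
      then show ?thesis using matrix_entry_section[of j r 1 2] by simp
    qed
  qed simp
  show "regular_map ?R (rep_var r) (affine_tuple r)"
    by (rule regular_map_affine_tuple[OF function_space_locus_space coordinate_section])
      (use affine_tuple_representation_iff in auto)
  show "affine_tuple r (tuple_coords r As) = As" if "As \<in> pts (rep_var r)" for As :: "('a alg_closure^2^2) list"
    by (rule tc[OF that])
  show "tuple_coords r (affine_tuple r z) = z" if "z \<in> pts ?R" for z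
  proof (rule nth_equalityI)
    fix i assume "i < length (tuple_coords r (affine_tuple r z))"
    then consider "i < r" | j where "i = r + j" "j < r" by (metis add_less_cancel_left le_add_diff_inverse length_tuple_coords not_less)
    then show "tuple_coords r (affine_tuple r z) ! i = z ! i" by cases auto
  qed (use that in simp)
qed


section \<open>The character variety\<close>

text \<open>
  Conjugation by \<open>(t, 0)\<close> multiplies all \<open>y\<^sub>i\<close> by \<open>t\<close>. Hence, letting \<open>t\<close> tend to \<open>0\<close>, an invariant function does
  not depend on \<open>y\<close>.
\<close>

definition scale_translations :: "nat \<Rightarrow> 'a::semiring_1 \<Rightarrow> ('a^2^2) list \<Rightarrow> ('a^2^2) list" where
  "scale_translations r t As = map (\<lambda>i. affine_matrix (As ! i $ 1 $ 1) (t * As ! i $ 1 $ 2)) [0..<r]"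

definition multipliers :: "nat \<Rightarrow> ('a^2^2) list \<Rightarrow> 'a::semiring_1 list" where
  "multipliers r As = map (\<lambda>i. As ! i $ 1 $ 1) [0..<r]"

definition diagonal_tuple :: "nat \<Rightarrow> 'a::semiring_1 list \<Rightarrow> ('a^2^2) list" where
  "diagonal_tuple r x = affine_tuple r (x @ replicate r 0)"

lemma scale_translations_0:
  "length As = r \<Longrightarrow> scale_translations r 0 As = diagonal_tuple r (multipliers r As)"
  by (rule nth_equalityI) (simp_all add: scale_translations_def diagonal_tuple_def multipliers_def nth_append)

lemma scale_translations_coords:
  "scale_translations r t As =
    affine_tuple r (take r (tuple_coords r As) @ map (\<lambda>y. t * y) (drop r (tuple_coords r As)))"
  by (rule nth_equalityI) (simp_all add: scale_translations_def nth_append)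

lemma representation_coords:
  assumes "As \<in> representations r"
  shows "tuple_coords r As \<in> rep_locus r (square_one_locus r)"
proof -
  have "affine_tuple r (tuple_coords r As) = As" using assms by (intro affine_tuple_coords) auto
  then show ?thesis using affine_tuple_representation_iff[of "tuple_coords r As" r] assms by simp
qed

text \<open>The equation for the translation parts is linear and homogeneous, so it survives scaling
  even by \<open>t = 0\<close>, where the scaling is no longer a conjugation.\<close>

lemma scale_translations_representation:
  fixes As :: "('k::field alg_closure^2^2) list"
  assumes "As \<in> representations r" shows "scale_translations r t As \<in> representations r"
proof -
  let ?z = "tuple_coords r As"
  have z: "?z \<in> rep_locus r (square_one_locus r)" by (rule representation_coords[OF assms])
  have "(\<Sum>i<r. translation_coeff i (take r ?z) * (t * ?z ! (r + i))) = t * (\<Sum>i<r. translation_coeff i (take r ?z) * ?z ! (r + i))"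
    by (simp only: sum_distrib_left mult.left_commute)
  then have "take r ?z @ map (\<lambda>y. t * y) (drop r ?z) \<in> rep_locus r (square_one_locus r)"
    using z by (simp add: kernel_bundle_def nth_append)
  then show ?thesis
    unfolding scale_translations_coords by (subst affine_tuple_representation_iff) auto
qed

lemma conjugate_tuple:
  fixes As :: "('k::field alg_closure^2^2) list"
  assumes As: "As \<in> representations r" and a: "a \<noteq> 0"
  shows "conjugate (affine_matrix a b) As =
    map (\<lambda>i. affine_matrix (As ! i $ 1 $ 1) (a * As ! i $ 1 $ 2 + b * (1 - As ! i $ 1 $ 1))) [0..<r]"
proof (rule nth_equalityI)
  fix i assume "i < length (conjugate (affine_matrix a b) As)"
  then have i: "i < r" using As by (simp add: conjugate_def)
  then have "As ! i \<in> AGL1" using As by auto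
  then have "As ! i = affine_matrix (As ! i $ 1 $ 1) (As ! i $ 1 $ 2)" by (simp add: AGL1_iff)
  then show "conjugate (affine_matrix a b) As ! i =
      map (\<lambda>i. affine_matrix (As ! i $ 1 $ 1) (a * As ! i $ 1 $ 2 + b * (1 - As ! i $ 1 $ 1))) [0..<r] ! i"
    using conjugate_affine_matrix[OF a, of b "As ! i $ 1 $ 1" "As ! i $ 1 $ 2"] i As by (simp add: conjugate_def)
qed (use As in \<open>simp add: conjugate_def\<close>)

text \<open>The factors \<open>h ** g\<close> between neighbouring matrices cancel.\<close>

lemma foldr_squares_conjugate:
  fixes g h :: "'a::semiring_1^'n^'n"
  assumes "g ** h = mat 1" "h ** g = mat 1"
  shows "foldr (\<lambda>A B. A ** A ** B) (map (\<lambda>A. g ** A ** h) As) (mat 1) =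
    g ** foldr (\<lambda>A B. A ** A ** B) As (mat 1) ** h"
proof (induction As)
  case Nil
  show ?case by (simp add: assms)
next
  case (Cons A As)
  have hg: "h ** (g ** B) = B" for B :: "'a^'n^'n" by (simp add: matrix_mul_assoc assms)
  show ?case by (simp add: Cons.IH[unfolded matrix_mul_assoc[symmetric]] matrix_mul_assoc[symmetric] hg)
qed

lemma conjugate_AGL1:
  assumes As: "As \<in> representations r" and g: "g \<in> AGL1"
  shows "conjugate g As \<in> representations r" "multipliers r (conjugate g As) = multipliers r As"
proof -
  obtain a b where g: "g = affine_matrix a b" "a \<noteq> 0"
    using g AGL1_iff by blast
  have inv: "g ** matrix_inv g = mat 1" "matrix_inv g ** g = mat 1"
    using matrix_inv_affine_matrix(2,3)[OF g(2)] by (simp_all only: g(1))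
  have "As ! i $ 1 $ 1 \<noteq> 0" if "i < r" for i
  proof -
    have "As ! i \<in> AGL1" using As that by auto
    then show ?thesis by (simp add: AGL1_iff)
  qed
  then have "set (conjugate g As) \<subseteq> AGL1"
    unfolding g(1) conjugate_tuple[OF As g(2)] by (auto simp: affine_matrix_in_AGL1)
  then show "conjugate g As \<in> representations r"
    using As foldr_squares_conjugate[OF inv, of As] inv by (simp add: conjugate_def)
  show "multipliers r (conjugate g As) = multipliers r As"
    unfolding g(1) conjugate_tuple[OF As g(2)] by (simp add: multipliers_def)
qed

text \<open>Brings the invariants into the form treated by \<open>Spec_retract\<close>, with
  \<open>multipliers\<close> as \<open>\<pi>\<close> and \<open>diagonal_tuple\<close> as
  \<open>\<sigma>\<close>. For the converse inclusion, functions of the multipliers are invariant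
  because conjugation preserves these.\<close>

lemma invariant_sections_rep_var:
  "invariant_sections (rep_var r) conjugate AGL1 =
    {f \<in> sections (rep_var r :: ('k::field, _) fspace) (pts (rep_var r)). \<forall>As \<in> pts (rep_var r). f As = f (diagonal_tuple r (multipliers r As))}"
    (is "?I = ?J")
proof (intro equalityI subsetI)
  fix f assume f: "f \<in> ?I"
  then have fs: "f \<in> sections (rep_var r) (pts (rep_var r))" by (simp add: invariant_sections_def)
  have "f As = f (diagonal_tuple r (multipliers r As))" if "As \<in> pts (rep_var r)" for As
  proof -
    have As: "As \<in> representations r" using that unfolding pts_rep_var .
    \<comment> \<open>For \<open>t \<noteq> 0\<close> the scaled tuples are conjugates of
      \<open>As\<close>, so \<open>f\<close> is constant on them; \<open>t = 0\<close> gives the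
      diagonal tuple.\<close>
    have "f (scale_translations r 0 As) = f As"
    proof (rule section_constant_on_curve[OF fs[unfolded representation_variety_def matrix_tuples_def]])
      fix t
      show "scale_translations r t As \<in> {As. length As = r} \<inter> representations r"
        using scale_translations_representation[OF As, of t] by auto
      show "f (scale_translations r t As) = f As" if "t \<noteq> 0"
      proof -
        have "scale_translations r t As = conjugate (affine_matrix t 0) As"
          using conjugate_tuple[OF As that, of 0] by (simp add: scale_translations_def)
        moreover have "affine_matrix t 0 \<in> AGL1" using that by (simp add: affine_matrix_in_AGL1)
        ultimately show ?thesis using f \<open>As \<in> pts (rep_var r)\<close> by (simp add: invariant_sections_def)
      qed
    next
      fix c assume "c \<in> {\<lambda>As :: ('k alg_closure^2^2) list. As ! i $ a $ b | i a b. i < r}"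
      then obtain i a b where i: "i < r" "c = (\<lambda>As. As ! i $ a $ b)" by blast
      have "\<exists>Q. \<forall>t. affine_matrix x (t * y) $ a $ b = poly Q t" for x y :: "'k alg_closure"
      proof -
        \<comment> \<open>Along the curve only the upper right entry varies, linearly in
          \<open>t\<close>.\<close>
        have "\<forall>t. affine_matrix x (t * y) $ a $ b = poly (if a = 1 then if b = 1 then [:x:] else [:0, y:] else if b = 1 then 0 else 1) t"
          using exhaust_2[of a] exhaust_2[of b] by auto
        then show ?thesis by blast
      qed
      then show "\<exists>Q. \<forall>t. c (scale_translations r t As) = poly Q t"
        using i by (simp add: scale_translations_def)
    qed
    then show ?thesis using scale_translations_0[of As r] As by simp
  qed
  with fs show "f \<in> ?J" by blast
next
  fix f assume f: "f \<in> ?J"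
  have "f (conjugate g As) = f As" if "g \<in> AGL1" "As \<in> pts (rep_var r)" for g As
  proof -
    have As: "As \<in> representations r" using that(2) unfolding pts_rep_var .
    have "conjugate g As \<in> pts (rep_var r)" unfolding pts_rep_var by (rule conjugate_AGL1(1)[OF As that(1)])
    then have "f (conjugate g As) = f (diagonal_tuple r (multipliers r (conjugate g As)))" using f by blast
    also have "\<dots> = f As" using f that(2) conjugate_AGL1(2)[OF As that(1)] by simp
    finally show ?thesis .
  qed
  with f show "f \<in> ?I" by (simp add: invariant_sections_def)
qed

text \<open>The diagonal representations are a copy of the base inside the representation variety,
  and \<open>multipliers\<close> retracts onto it; the quotient is this retract.\<close>

lemma character_variety_isomorphic:
  "character_variety (AGL1 :: ('k::field alg_closure^2^2) set) r \<cong>\<^sub>v locus_space r (square_one_locus r :: 'k alg_closure list set)"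
proof -
  define P where "P = {\<lambda>x :: 'k alg_closure list. (\<Prod>j<r. (x ! j)\<^sup>2) - 1}"
  have T: "square_one_locus r = zero_set r P"
    by (auto simp: square_one_locus_def zero_set_def P_def)
  have P: "P \<subseteq> polynomials (coords r)"
    unfolding P_def
    by (simp, intro polynomials_diff polynomials_prod polynomials_power polynomials_coord polynomials_one) simp
  let ?T = "locus_space r (zero_set r P)"
  interpret T: function_space ?T by (rule function_space_locus_space)
  have pts_T: "pts ?T = square_one_locus r" unfolding T by (auto simp: zero_set_def)
  have 1: "regular_map (rep_var r) ?T (multipliers r)"
  proof (rule regular_map_locus_space[OF function_space_rep_var])
    fix As :: "('k alg_closure^2^2) list" assume "As \<in> pts (rep_var r)"
    then have "As \<in> representations r" unfolding pts_rep_var .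
    from representation_coords[OF this] show "multipliers r As \<in> zero_set r P"
      unfolding T[symmetric] by (simp add: kernel_bundle_def multipliers_def tuple_coords_def)
  next
    fix i assume "i < r"
    then show "(\<lambda>As. multipliers r As ! i) \<in> sections (rep_var r) (pts (rep_var r))"
      using matrix_entry_section[of i r 1 1] by (simp add: multipliers_def)
  qed (simp add: multipliers_def)
  have 2: "regular_map ?T (rep_var r) (diagonal_tuple r)"
    unfolding diagonal_tuple_def
  proof (rule regular_map_affine_tuple[OF function_space_locus_space])
    fix i assume i: "i < r + r"
    show "(\<lambda>x. (x @ replicate r 0) ! i) \<in> sections ?T (pts ?T)"
    proof (cases "i < r")
      case True
      from coordinate_section[OF this] show ?thesis
        by (rule T.sections_cong[OF openin_topspace]) (use True in \<open>auto simp: nth_append\<close>)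
    next
      case False
      show ?thesis
        by (rule T.sections_cong[OF openin_topspace T.global_sections(1)]) (use False i in \<open>auto simp: nth_append\<close>)
    qed
  next
    fix x assume "x \<in> pts ?T"
    then have "x \<in> square_one_locus r" unfolding pts_T .
    then have "x @ replicate r 0 \<in> rep_locus r (square_one_locus r)"
      by (auto simp: kernel_bundle_def square_one_locus_def nth_append)
    then show "affine_tuple r (x @ replicate r 0) \<in> representations r"
      using \<open>x \<in> square_one_locus r\<close> by (subst affine_tuple_representation_iff) (auto simp: square_one_locus_def)
  qed
  have 3: "multipliers r (diagonal_tuple r x) = x" if "x \<in> zero_set r P" for x
    using that by (intro nth_equalityI) (auto simp: multipliers_def diagonal_tuple_def zero_set_def nth_append)
  show ?thesis
    unfolding character_variety_def GIT_quotient_def invariant_sections_rep_var T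
    by (rule Spec_retract[OF function_space_rep_var P 1 2 3])
qed

section \<open>The two virtual classes\<close>

lemma virtual_class_rep_var:
  fixes q :: "'k::field K0"
  assumes "CHAR('k) \<noteq> 2" and r: "r > 0" and q: "q = virtual_class (affine_space 1)"
  shows "virtual_class (rep_var r :: ('k, _) fspace) = 2 * q ^ (r - 1) * (q - 1) ^ (r - 1) + q ^ (r - 1) * (q - 1)"
proof -
  let ?T = "square_one_locus r :: 'k alg_closure list set"
  \<comment> \<open>At \<open>m = 0\<close> no coordinate is prescribed, so the stratum is the whole
    base.\<close>
  have T: "stratum r 0 = ?T" by (simp add: stratum_def)
  have "virtual_class (rep_var r :: ('k, _) fspace) = virtual_class (locus_space (r + r) (rep_locus r ?T))"
    by (rule virtual_class_cong[OF rep_var_isomorphic])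
  also have "\<dots> = q ^ (r - 1) * (virtual_class (locus_space r ?T) - 1) + q ^ r"
    using virtual_class_rep_locus_stratum[OF r _ q, of 0] unfolding T by simp
  also have "virtual_class (locus_space r ?T) = 2 * (q - 1) ^ (r - 1)"
    unfolding q by (rule virtual_class_square_one_locus[OF assms(1) r])
  \<comment> \<open>For \<open>r > 0\<close> this turns \<open>q ^ r - q ^ (r - 1)\<close> into
    \<open>q ^ (r - 1) * (q - 1)\<close>, the contribution of the jump of the fibre at the point
    with all multipliers \<open>- 1\<close>.\<close>
  also have "q ^ r = q ^ (r - 1) * q" using r by (metis power_minus_mult)
  finally show ?thesis by (simp add: algebra_simps)
qed

lemma virtual_class_character_variety:
  assumes "CHAR('k::field) \<noteq> 2" "r > 0"
  shows "virtual_class (character_variety (AGL1 :: ('k alg_closure^2^2) set) r) =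
    2 * (virtual_class (affine_space 1) - 1) ^ (r - 1)"
  unfolding virtual_class_cong[OF character_variety_isomorphic] by (rule virtual_class_square_one_locus[OF assms])

theorem theorem1:
  fixes r :: nat and q :: "'k::field K0"
  assumes "CHAR('k) \<noteq> 2"
    and "r > 0"
    and "q = virtual_class (affine_space 1)"
  shows "virtual_class (representation_variety (AGL1 :: ('k alg_closure^2^2) set) r) =
           2 * q ^ (r - 1) * (q - 1) ^ (r - 1) + q ^ (r - 1) * (q - 1) \<and>
         virtual_class (character_variety (AGL1 :: ('k alg_closure^2^2) set) r) = 2 * (q - 1) ^ (r - 1)"
  using virtual_class_rep_var[OF assms] virtual_class_character_variety[OF assms(1,2)] assms(3) by simp

end
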